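(* Every automorphism $\varphi\in\mathrm{Aut}(\mathcal{C})$ of the asymptotic pants complex $\mathcal{C}$ is either orientation preserving or orientation reversing.
   Context: The complex $\mathcal{C}$: Let $\mathbb{D}^2$ be the (oriented) hyperbolic disc with boundary circle $\partial\mathbb{D}^2$ parametrized by $\mathbb{R}/\mathbb{Z}$. A dyadic point is an element of $\mathbb{Z}[1/2]/\mathbb{Z}\subset\partial\mathbb{D}^2$. An arc is a bi-infinite geodesic of $\mathbb{D}^2$ joining two distinct dyadic points. For $n\ge 1$ and $0\le a\le 2^n-1$ let $I_a^n$ be the arc joining $a/2^n$ and $(a+1)/2^n$ (so $I_0^1=I_1^1$). The set $E$ of all $I_a^n$ is a triangulation of $\mathbb{D}^2$ into ideal triangles. In general, a triangulation is a set of pairwise non-crossing arcs cutting $\mathbb{D}^2$ into ideal triangles with dyadic vertices. The vertices of $\mathcal{C}$ are the triangulations which differ from $E$ only in finitely many triangles. If $v$ is such a triangulation and $a$ is an arc of $v$, the two triangles of $v$ having $a$ as a side form an ideal quadrilateral; flipping $a$ means replacing $a$ by the other diagonal of this quadrilateral. Two vertices of $\mathcal{C}$ are joined by an edge iff one is obtained from the other by flipping one arc. The 2-cells: let $a\neq b$ be two arcs of a vertex $v$. If no triangle of $v$ has both $a$ and $b$ as sides, the flips of $a$ and $b$ commute and define a 4-cycle in the 1-skeleton, filled by a square 2-cell. If some triangle of $v$ has both $a$ and $b$ as sides, the three triangles of $v$ having $a$ or $b$ as a side form an ideal pentagon, and the five triangulations obtained by triangulating this pentagon and keeping the rest of $v$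 form a 5-cycle, filled by a pentagonal 2-cell. There is one 2-cell for each such cycle. $\mathrm{Aut}(\mathcal{C})$ is the group of cellular automorphisms of $\mathcal{C}$, i.e. automorphisms of the 1-skeleton graph which, together with their inverses, send boundary cycles of 2-cells to boundary cycles of 2-cells. Links: for a vertex $v$ of $\mathcal{C}$, $\mathcal{L}^1(v)$ is the graph whose vertices are the vertices of $\mathcal{C}$ adjacent to $v$, two of them being joined by an edge if they lie, together with $v$, in a common pentagonal 2-cell. The vertices of $\mathcal{L}^1(v)$ correspond bijectively to the arcs of $v$ (the arc $a$ corresponds to the triangulation obtained from $v$ by flipping $a$), and two are joined by an edge iff the corresponding arcs are sides of a common triangle of $v$. The link $\mathcal{L}^2(v)$ is the 2-complex obtained from $\mathcal{L}^1(v)$ by gluing a 2-cell on each triangle; its triangles correspond to the triangles of $v$, and each is oriented by the orientation of $\mathbb{D}^2$, i.e. its three vertices are cyclically ordered as the corresponding three sides of the triangle of $v$ are cyclically ordered along the positively oriented boundary of that triangle. An automorphism $\varphi\in\mathrm{Aut}(\mathcal{C})$ maps triangles of $\mathcal{L}^2(v)$ to triangles of $\mathcal{L}^2(\varphi(v))$. It is orientation preserving (resp. reversing) on a triangle $\Delta$ of $\mathcal{L}^2(v)$ with positively cyclically ordered vertices $(a,b,c)$ if the orientation of the triangle $\varphi(\Delta)$ of $\mathcal{L}^2(\varphi(v))$ induces the cyclic order $(\varphi(a),\varphi(b),\varphi(c))$ (resp. $(\varphi(a),\varphi(c),\varphi(b))$). It is $v$-orientation preserving (resp. reversing) if it is orientation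 preserving (resp. reversing) on every triangle of $\mathcal{L}^2(v)$, and orientation preserving (resp. reversing) if it is $v$-orientation preserving (resp. reversing) for all vertices $v$ of $\mathcal{C}$. *)

theory Defs
  imports "HOL-Analysis.Analysis"
begin

section \<open>The disc, dyadic points and arcs\<close>

text \<open>
  The hyperbolic disc is taken in the projective (Klein) model: the open unit disc of the complex
  plane, in which bi-infinite geodesics are the open chords and the ideal triangle with
  vertices \<open>T\<close> on the circle has \<^term>\<open>interior (convex hull T)\<close> as its open region.
  The boundary circle is parametrized counterclockwise by \<open>\<real>/\<int>\<close>.
\<close>

abbreviation hyp_disc :: "complex set" where
  "hyp_disc \<equiv> ball 0 1"

definition bdry :: "real \<Rightarrow> complex" where
  "bdry t = cis (2 * pi * t)"

definition dyadic_points :: "complex set" where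
  "dyadic_points = {bdry (of_int k / 2 ^ n) | (k::int) (n::nat). True}"

abbreviation geodesic :: "complex \<Rightarrow> complex \<Rightarrow> complex set" where
  "geodesic p q \<equiv> open_segment p q"

definition arcs :: "complex set set" where
  "arcs = {geodesic p q | p q. p \<in> dyadic_points \<and> q \<in> dyadic_points \<and> p \<noteq> q}"

section \<open>Triangulations\<close>

text \<open>An ideal triangle is represented by its set of three ideal vertices.\<close>

definition ideal_triangles :: "complex set set" where
  "ideal_triangles = {T. T \<subseteq> dyadic_points \<and> card T = 3}"

definition triangle_region :: "complex set \<Rightarrow> complex set" where
  "triangle_region T = interior (convex hull T)"

definition is_side :: "complex set \<Rightarrow> complex set \<Rightarrow> bool" where
  "is_side a T \<longleftrightarrow> (\<exists>p\<in>T. \<exists>q\<in>T. p \<noteq> q \<and> a = geodesic p q)"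

text \<open>The pieces into which a set of arcs cuts the disc are the connected components of the
  complement of its union.\<close>

definition ideal_triangulation :: "complex set set \<Rightarrow> bool" where
  "ideal_triangulation v \<longleftrightarrow>
     v \<subseteq> arcs \<and> pairwise disjnt v \<and>
     (\<forall>C\<in>components (hyp_disc - \<Union>v). \<exists>T\<in>ideal_triangles. C = triangle_region T)"

definition triangles_of :: "complex set set \<Rightarrow> complex set set" where
  "triangles_of v =
     {T \<in> ideal_triangles. triangle_region T \<in> components (hyp_disc - \<Union>v)}"

definition base_triangulation :: "complex set set" where
  "base_triangulation =
     {geodesic (bdry (real a / 2 ^ n)) (bdry (real (a + 1) / 2 ^ n)) | a n. 1 \<le> n \<and> a \<le> 2 ^ n - 1}"

section \<open>The 1-skeleton\<close>

definition vertices :: "complex set set set" where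
  "vertices = {v. ideal_triangulation v \<and>
     finite (triangles_of v - triangles_of base_triangulation) \<and>
     finite (triangles_of base_triangulation - triangles_of v)}"

text \<open>\<open>is_flip v a w\<close>: the set of arcs \<open>w\<close> is obtained from \<open>v\<close> by flipping the arc \<open>a\<close>; here
  \<open>p, r, q, s\<close> are the vertices of the quadrilateral with diagonals \<open>a = pq\<close> and \<open>rs\<close>.\<close>

definition is_flip :: "complex set set \<Rightarrow> complex set \<Rightarrow> complex set set \<Rightarrow> bool" where
  "is_flip v a w \<longleftrightarrow> a \<in> v \<and>
     (\<exists>p q r s. p \<noteq> q \<and> r \<noteq> s \<and> a = geodesic p q \<and>
        {p, q, r} \<in> triangles_of v \<and> {p, q, s} \<in> triangles_of v \<and>
        w = insert (geodesic r s) (v - {a}))"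

definition adj :: "complex set set \<Rightarrow> complex set set \<Rightarrow> bool" where
  "adj v w \<longleftrightarrow> v \<in> vertices \<and> w \<in> vertices \<and> ((\<exists>a\<in>v. is_flip v a w) \<or> (\<exists>a\<in>w. is_flip w a v))"

section \<open>The 2-cells\<close>

text \<open>A cycle of the 1-skeleton is represented by its set of edges, an edge being the set of its
  two end vertices. So there is one 2-cell for each cycle, whatever data it arises from.\<close>

definition share_triangle :: "complex set set \<Rightarrow> complex set \<Rightarrow> complex set \<Rightarrow> bool" where
  "share_triangle v a b \<longleftrightarrow> (\<exists>T\<in>triangles_of v. is_side a T \<and> is_side b T)"

definition square_cycles :: "complex set set set set set" where
  "square_cycles =
     {{{v, w1}, {w1, u}, {u, w2}, {w2, v}} | v a b w1 u w2.
        v \<in> vertices \<and> a \<in> v \<and> b \<in> v \<and> a \<noteq> b \<and> \<not> share_triangle v a b \<and>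
        is_flip v a w1 \<and> is_flip v b w2 \<and> is_flip w1 b u \<and> is_flip w2 a u}"

definition pentagon_points :: "complex set set \<Rightarrow> complex set \<Rightarrow> complex set \<Rightarrow> complex set" where
  "pentagon_points v a b = \<Union>{T \<in> triangles_of v. is_side a T \<or> is_side b T}"

text \<open>The triangulations obtained from \<open>v\<close> by erasing the diagonals \<open>a\<close> and \<open>b\<close> of the pentagon,
  and triangulating the pentagon anew by arcs between its vertices.\<close>

definition pentagon_triangulations ::
  "complex set set \<Rightarrow> complex set \<Rightarrow> complex set \<Rightarrow> complex set set set" where
  "pentagon_triangulations v a b =
     {w. ideal_triangulation w \<and>
         (\<exists>S. S \<subseteq> {geodesic p q | p q. p \<in> pentagon_points v a b \<and> q \<in> pentagon_points v a b \<and> p \<noteq> q} \<and>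
              w = (v - {a, b}) \<union> S)}"

definition pentagon_cycles :: "complex set set set set set" where
  "pentagon_cycles =
     {{{w, w'} | w w'. w \<in> pentagon_triangulations v a b \<and> w' \<in> pentagon_triangulations v a b \<and> adj w w'}
        | v a b. v \<in> vertices \<and> a \<in> v \<and> b \<in> v \<and> a \<noteq> b \<and> share_triangle v a b}"

definition cell_cycles :: "complex set set set set set" where
  "cell_cycles = square_cycles \<union> pentagon_cycles"

section \<open>Cellular automorphisms\<close>

definition map_cycle ::
  "(complex set set \<Rightarrow> complex set set) \<Rightarrow> complex set set set set \<Rightarrow> complex set set set set" where
  "map_cycle \<phi> c = (\<lambda>e. \<phi> ` e) ` c"

text \<open>Automorphisms are considered only on \<^const>\<open>vertices\<close>; the values of \<open>\<phi>\<close> elsewhere are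
  irrelevant.\<close>

definition cellular_automorphism :: "(complex set set \<Rightarrow> complex set set) \<Rightarrow> bool" where
  "cellular_automorphism \<phi> \<longleftrightarrow>
     bij_betw \<phi> vertices vertices \<and>
     (\<forall>v\<in>vertices. \<forall>w\<in>vertices. adj v w \<longleftrightarrow> adj (\<phi> v) (\<phi> w)) \<and>
     (\<forall>c\<in>cell_cycles. map_cycle \<phi> c \<in> cell_cycles) \<and>
     (\<forall>c\<in>cell_cycles. map_cycle (the_inv_into vertices \<phi>) c \<in> cell_cycles)"

section \<open>Links and orientations\<close>

definition link_adj ::
  "complex set set \<Rightarrow> complex set set \<Rightarrow> complex set set \<Rightarrow> bool" where
  "link_adj v x y \<longleftrightarrow> adj v x \<and> adj v y \<and> x \<noteq> y \<and> (\<exists>c\<in>pentagon_cycles. {v, x, y} \<subseteq> \<Union>c)"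

definition link_triangles :: "complex set set \<Rightarrow> complex set set set set" where
  "link_triangles v = {{x, y, z} | x y z. link_adj v x y \<and> link_adj v y z \<and> link_adj v z x}"

definition ccw :: "complex \<Rightarrow> complex \<Rightarrow> complex \<Rightarrow> bool" where
  "ccw p q r \<longleftrightarrow>
     (\<exists>s t u. s < t \<and> t < u \<and> u < s + 1 \<and> p = bdry s \<and> q = bdry t \<and> r = bdry u)"

text \<open>\<open>link_oriented v x y z\<close>: the orientation of the triangle \<open>{x, y, z}\<close> of the link of \<open>v\<close>
  induces the cyclic order \<open>(x, y, z)\<close>. The positively oriented boundary of an ideal triangle with
  counterclockwise vertices \<open>p, q, r\<close> runs through the sides \<open>pq\<close>, \<open>qr\<close>, \<open>rp\<close> in this order.\<close>

definition link_oriented ::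
  "complex set set \<Rightarrow> complex set set \<Rightarrow> complex set set \<Rightarrow> complex set set \<Rightarrow> bool" where
  "link_oriented v x y z \<longleftrightarrow>
     {x, y, z} \<in> link_triangles v \<and>
     (\<exists>p q r. ccw p q r \<and> {p, q, r} \<in> triangles_of v \<and>
        is_flip v (geodesic p q) x \<and> is_flip v (geodesic q r) y \<and> is_flip v (geodesic r p) z)"

definition preserving_on ::
  "(complex set set \<Rightarrow> complex set set) \<Rightarrow> complex set set \<Rightarrow> complex set set set \<Rightarrow> bool" where
  "preserving_on \<phi> v \<Delta> \<longleftrightarrow>
     (\<exists>x y z. \<Delta> = {x, y, z} \<and> link_oriented v x y z \<and> link_oriented (\<phi> v) (\<phi> x) (\<phi> y) (\<phi> z))"

definition reversing_on ::
  "(complex set set \<Rightarrow> complex set set) \<Rightarrow> complex set set \<Rightarrow> complex set set set \<Rightarrow> bool" where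
  "reversing_on \<phi> v \<Delta> \<longleftrightarrow>
     (\<exists>x y z. \<Delta> = {x, y, z} \<and> link_oriented v x y z \<and> link_oriented (\<phi> v) (\<phi> x) (\<phi> z) (\<phi> y))"

definition preserving_at :: "(complex set set \<Rightarrow> complex set set) \<Rightarrow> complex set set \<Rightarrow> bool" where
  "preserving_at \<phi> v \<longleftrightarrow> (\<forall>\<Delta>\<in>link_triangles v. preserving_on \<phi> v \<Delta>)"

definition reversing_at :: "(complex set set \<Rightarrow> complex set set) \<Rightarrow> complex set set \<Rightarrow> bool" where
  "reversing_at \<phi> v \<longleftrightarrow> (\<forall>\<Delta>\<in>link_triangles v. reversing_on \<phi> v \<Delta>)"

definition orientation_preserving_aut :: "(complex set set \<Rightarrow> complex set set) \<Rightarrow> bool" where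
  "orientation_preserving_aut \<phi> \<longleftrightarrow> (\<forall>v\<in>vertices. preserving_at \<phi> v)"

definition orientation_reversing_aut :: "(complex set set \<Rightarrow> complex set set) \<Rightarrow> bool" where
  "orientation_reversing_aut \<phi> \<longleftrightarrow> (\<forall>v\<in>vertices. reversing_at \<phi> v)"

end

theory Submission
  imports Defs
begin

text \<open>
  An automorphism \<open>\<phi>\<close> sends the flip of an arc \<open>a\<close> of \<open>v\<close> to the flip of some arc of \<open>\<phi> v\<close>, and so
  acts on arcs (\<open>arc_map\<close>). Pentagons have five vertices and squares at most four, hence \<open>\<phi>\<close> maps
  pentagons to pentagons and the action on arcs respects being sides of a common triangle. Three
  arcs that pairwise have this property are the sides of one triangle
  (\<open>pairwise_share_triangle\<close>). Thus a triangle \<open>pqr\<close> of \<open>v\<close> has an image triangle \<open>PQR\<close> of \<open>\<phi> v\<close>, with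
  vertices labelled such that \<open>pq\<close>, \<open>qr\<close>, \<open>rp\<close> go to \<open>PQ\<close>, \<open>QR\<close>, \<open>RP\<close> (\<open>triangle_image\<close>). If \<open>pqr\<close> is
  counterclockwise, then \<open>\<phi>\<close> preserves orientation on it if \<open>PQR\<close> is counterclockwise and reverses it
  otherwise. This sign has to be shown to be independent of the triangle and of \<open>v\<close>.

  Let \<open>pqr\<close> and \<open>qps\<close> be the two triangles at the arc \<open>pq\<close>. The pentagon through \<open>v\<close> and its flips at
  \<open>pq\<close> and at \<open>rp\<close> shows that flipping \<open>pq\<close> does not change the image of \<open>rp\<close>; the same holds for the
  other sides of the two triangles (\<open>arc_map_flip\<close>). If the image of \<open>qps\<close> were glued to \<open>PQR\<close> with a
  twist, as \<open>PQS\<close>, then \<open>rp\<close> and \<open>ps\<close>, which are sides of the same triangle after the flip, would go to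
  \<open>RP\<close> and \<open>QS\<close>, which are not. So the image of \<open>qps\<close> is \<open>QPS\<close> with the same sign
  (\<open>neighbour_image\<close>), and after the flip the triangle \<open>rps\<close> goes to \<open>RPS\<close>, again with the same sign
  (\<open>orientation_on_flip\<close>). Therefore the sign is constant on each \<open>v\<close> because the dual graph of \<open>v\<close>
  is connected (\<open>dual_graph_connected\<close>), and it does not depend on \<open>v\<close> because any two vertices are
  joined by flips (\<open>flip_graph_connected\<close>).

  Both kinds of connectedness rest on the fact that \<open>v\<close> contains all arcs \<open>I_a^m\<close> from some level
  \<open>n\<close> on (\<open>vertex_has_dyadic_tail\<close>); its other arcs are diagonals of the polygon with vertices
  \<open>k/2^n\<close>. Hence \<open>v\<close> is locally finite and every arc has a triangle on each side, so that a class
  of triangles closed under adjacency fills, together with the sides of these triangles, an open subset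
  of the disc, which is connected. Inside
  the polygon, repeated flips that increase the number of diagonals at the point \<open>0\<close> lead to a fan,
  and the fan is the same for all \<open>v\<close>.

  The plane geometry is expressed by signed areas: \<open>area p q r\<close> is positive iff \<open>p, q, r\<close> are
  counterclockwise on the circle, an ideal triangle is cut out by three area inequalities, and two geodesics
  cross iff the end points of one have areas of opposite signs with respect to the other. The
  bridge from components to combinatorics is \<open>mem_triangles_of_iff\<close>: three distinct points of the
  circle span a triangle of \<open>v\<close> iff the three geodesics between them belong to \<open>v\<close>. From there on, only the
  cyclic order on the circle matters.
\<close>

section \<open>Signed area and the cyclic order of the circle\<close>

text \<open>
  Twice the signed area of the triangle \<open>p, q, z\<close>; it is positive iff \<open>z\<close> lies to the left of
  the line from \<open>p\<close> to \<open>q\<close>.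
\<close>

definition area :: "complex \<Rightarrow> complex \<Rightarrow> complex \<Rightarrow> real" where
  "area p q z = Im (cnj (q - p) * (z - p))"

text \<open>
  The parameter in \<open>[0, 1)\<close> of a point of the circle. It turns the cyclic order into
  inequalities between reals, so that statements about a few points on the circle are decided by
  linear arithmetic.
\<close>

definition pos :: "complex \<Rightarrow> real" where
  "pos z = Arg2pi z / (2 * pi)"

lemma area_eq:
  "area p q z = (Re q - Re p) * (Im z - Im p) - (Im q - Im p) * (Re z - Re p)"
  by (simp add: area_def algebra_simps)

lemma area_rot: "area q z p = area p q z"
  by (simp add: area_eq algebra_simps)

lemma area_swap: "area q p z = - area p q z"
  by (simp add: area_eq algebra_simps)

lemma area_degenerate [simp]: "area p p z = 0" "area p q p = 0" "area p q q = 0"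
  by (simp_all add: area_eq)

lemma area_sum: "area p q z + area q r z + area r p z = area p q r"
  by (simp add: area_eq algebra_simps)

text \<open>
  Signed area is affine in the last point: its sign on a segment is controlled by the end
  points.
\<close>

lemma area_affine:
  "area p q ((1 - t) *\<^sub>R x + t *\<^sub>R y) = (1 - t) * area p q x + t * area p q y"
  by (simp add: area_eq algebra_simps)

lemma norm_bdry [simp]: "norm (bdry t) = 1"
  by (simp add: bdry_def)

lemma dyadic_points_on_circle: "p \<in> dyadic_points \<Longrightarrow> norm p = 1"
  by (auto simp: dyadic_points_def)

lemma pos_range: "0 \<le> pos z" "pos z < 1"
  using Arg2pi_ge_0[of z] Arg2pi_lt_2pi[of z] by (auto simp: pos_def field_simps)

lemma bdry_pos: "norm z = 1 \<Longrightarrow> bdry (pos z) = z"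
  using Arg2pi_eq[of z] by (simp add: bdry_def pos_def cis_conv_exp)

lemma pos_bdry: "0 \<le> t \<Longrightarrow> t < 1 \<Longrightarrow> pos (bdry t) = t"
  unfolding pos_def bdry_def
  by (subst Arg2pi_unique[of 1 "2 * pi * t"]) (auto simp: cis_conv_exp)

lemma pos_eq_iff: "norm p = 1 \<Longrightarrow> norm q = 1 \<Longrightarrow> pos p = pos q \<longleftrightarrow> p = q"
  by (metis bdry_pos)

lemma bdry_add_int: "bdry (t + of_int k) = bdry t"
proof -
  have "cis (2 * pi * of_int k) = 1"
    by (intro cis_multiple_2pi) simp
  then show ?thesis
    by (simp add: bdry_def cis_mult[symmetric] distrib_left)
qed

text \<open>
  With half angles \<open>A\<close> and \<open>B\<close> this is
  \<open>sin 2A + sin 2B - sin (2A + 2B) = 4 sin A sin B sin (A + B)\<close>. All three factors are positive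
  for parameters in increasing order within one turn.
\<close>

lemma area_bdry:
  "area (bdry s) (bdry t) (bdry u) = 4 * sin (pi * (t - s)) * sin (pi * (u - t)) * sin (pi * (u - s))"
proof -
  define A where "A = pi * (t - s)"
  define B where "B = pi * (u - t)"
  have *: "sin (2 * A) + sin (2 * B) - sin (2 * A + 2 * B) = 4 * sin A * sin B * sin (A + B)"
  proof -
    have a: "sin A * sin A = 1 - cos A * cos A" and b: "sin B * sin B = 1 - cos B * cos B"
      using sin_cos_squared_add[of A] sin_cos_squared_add[of B] by (simp_all add: power2_eq_square)
    have "sin (2 * A) + sin (2 * B) - sin (2 * A + 2 * B) =
      2 * sin A * cos A * (1 - cos (2 * B)) + 2 * sin B * cos B * (1 - cos (2 * A))"
      by (simp only: sin_add sin_double[of A] sin_double[of B]) (simp add: algebra_simps)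
    also have "\<dots> = 4 * sin A * cos A * (sin B * sin B) + 4 * sin B * cos B * (sin A * sin A)"
      by (simp only: cos_double_sin) (simp add: power2_eq_square)
    finally show ?thesis
      by (simp add: sin_add algebra_simps)
  qed
  have area_sin: "area (bdry s) (bdry t) (bdry u) =
      sin (2 * pi * t - 2 * pi * s) + sin (2 * pi * u - 2 * pi * t) - sin (2 * pi * u - 2 * pi * s)"
    by (simp add: area_eq bdry_def sin_diff algebra_simps)
  have AB: "2 * pi * t - 2 * pi * s = 2 * A" "2 * pi * u - 2 * pi * t = 2 * B"
    "2 * pi * u - 2 * pi * s = 2 * A + 2 * B" "A + B = pi * (u - s)"
    by (simp_all add: A_def B_def algebra_simps)
  show ?thesis
    unfolding area_sin AB * A_def[symmetric] B_def[symmetric] by simp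
qed

lemma ccw_imp_area:
  assumes "ccw p q r" shows "area p q r > 0"
proof -
  from assms obtain s t u where st: "s < t" "t < u" "u < s + 1" and eq: "p = bdry s" "q = bdry t" "r = bdry u"
    by (auto simp: ccw_def)
  have "sin (pi * x) > 0" if "0 < x" "x < 1" for x
    using that by (intro sin_gt_zero) auto
  with st show ?thesis
    unfolding eq area_bdry by simp
qed

lemma ccw_rot: "ccw p q r \<Longrightarrow> ccw q r p"
proof -
  assume "ccw p q r"
  then obtain s t u where st: "s < t" "t < u" "u < s + 1" and eq: "p = bdry s" "q = bdry t" "r = bdry u"
    by (auto simp: ccw_def)
  have "t < u" "u < s + 1" "s + 1 < t + 1" "p = bdry (s + 1)"
    using st bdry_add_int[of s 1] by (auto simp: eq)
  with eq show ?thesis unfolding ccw_def by blast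
qed

lemma ccw_on_circle: "ccw p q r \<Longrightarrow> norm p = 1 \<and> norm q = 1 \<and> norm r = 1"
  by (auto simp: ccw_def)

text \<open>
  The positions of three distinct points are in one of six orders; three of them are
  counterclockwise by definition and rotation, and the other three give a negative area.
\<close>

lemma ccw_iff_pos:
  assumes "norm p = 1" "norm q = 1" "norm r = 1"
  shows "ccw p q r \<longleftrightarrow> pos p < pos q \<and> pos q < pos r \<or> pos q < pos r \<and> pos r < pos p
    \<or> pos r < pos p \<and> pos p < pos q"
proof -
  have base: "ccw x y z" if "pos x < pos y" "pos y < pos z" "norm x = 1" "norm y = 1" "norm z = 1" for x y z
    unfolding ccw_def using that pos_range[of x] pos_range[of z]
    by (intro exI[of _ "pos x"] exI[of _ "pos y"] exI[of _ "pos z"]) (auto simp: bdry_pos)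
  have fwd: "ccw x y z" if "pos x < pos y \<and> pos y < pos z \<or> pos y < pos z \<and> pos z < pos x
    \<or> pos z < pos x \<and> pos x < pos y" "norm x = 1" "norm y = 1" "norm z = 1" for x y z
    using that base[of x y z] base[of y z x] base[of z x y] ccw_rot by blast
  show ?thesis
  proof
    assume c: "ccw p q r"
    have ne: "p \<noteq> q" "q \<noteq> r" "p \<noteq> r" using ccw_imp_area[OF c] by auto
    then have ne': "pos p \<noteq> pos q" "pos q \<noteq> pos r" "pos p \<noteq> pos r" using assms pos_eq_iff by auto
    have "\<not> ccw p r q"
      using ccw_imp_area[OF c] ccw_imp_area[of p r q] area_swap[of r p q] area_rot[of r p q]  by (smt area_rot)
    then have "\<not> (pos p < pos r \<and> pos r < pos q \<or> pos r < pos q \<and> pos q < pos p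
    \<or> pos q < pos p \<and> pos p < pos r)" using fwd assms by blast
    then show "pos p < pos q \<and> pos q < pos r \<or> pos q < pos r \<and> pos r < pos p
    \<or> pos r < pos p \<and> pos p < pos q" using ne' by linarith
  qed (use fwd assms in blast)
qed

lemma area_pos_iff_ccw:
  assumes "norm p = 1" "norm q = 1" "norm r = 1"
  shows "area p q r > 0 \<longleftrightarrow> ccw p q r"
proof
  assume a: "area p q r > 0"
  have "\<not> ccw p r q" using a ccw_imp_area[of p r q] area_swap[of r p q] area_rot by smt
  moreover have "p \<noteq> q" "q \<noteq> r" "p \<noteq> r" using a by auto
  ultimately show "ccw p q r"
    using assms pos_eq_iff[of p q] pos_eq_iff[of q r] pos_eq_iff[of p r] by (simp add: ccw_iff_pos) linarith
qed (rule ccw_imp_area)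

lemma area_neg_iff_ccw:
  assumes "norm p = 1" "norm q = 1" "norm r = 1"
  shows "area p q r < 0 \<longleftrightarrow> ccw q p r"
  using area_pos_iff_ccw[of q p r] assms area_swap[of p q r] by simp

lemma area_eq_0_iff:
  assumes "norm p = 1" "norm q = 1" "norm r = 1"
  shows "area p q r = 0 \<longleftrightarrow> p = q \<or> q = r \<or> p = r"
proof
  assume "area p q r = 0"
  then have "\<not> ccw p q r" "\<not> ccw q p r"
    using assms area_pos_iff_ccw[of p q r] area_neg_iff_ccw[of p q r] by auto
  then show "p = q \<or> q = r \<or> p = r"
    using assms pos_eq_iff[of p q] pos_eq_iff[of q r] pos_eq_iff[of p r] by (simp add: ccw_iff_pos) linarith
qed auto

lemma ccw_distinct: "ccw p q r \<Longrightarrow> p \<noteq> q \<and> q \<noteq> r \<and> p \<noteq> r"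
  using ccw_imp_area[of p q r] by auto

lemma ccw_asym: "ccw p q r \<Longrightarrow> \<not> ccw q p r"
  by (metis area_swap ccw_imp_area less_asym neg_0_less_iff_less)

lemma ccw_total:
  assumes "norm p = 1" "norm q = 1" "norm r = 1" "p \<noteq> q" "q \<noteq> r" "p \<noteq> r"
  shows "ccw p q r \<or> ccw q p r"
  using assms area_eq_0_iff[of p q r] area_pos_iff_ccw[of p q r] area_neg_iff_ccw[of p q r]
  by linarith

section \<open>Geodesics and ideal triangles\<close>

lemma norm_point_on_line:
  fixes p q :: complex
  assumes "norm p = 1" "norm q = 1"
  shows "(norm ((1 - t) *\<^sub>R p + t *\<^sub>R q))\<^sup>2 = 1 - t * (1 - t) * (norm (q - p))\<^sup>2"
proof -
  have pq: "Re p * Re p + Im p * Im p = 1" "Re q * Re q + Im q * Im q = 1"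
    using assms by (simp_all add: norm_complex_def power2_eq_square)
  show ?thesis using pq unfolding cmod_power2
    by (simp add: power2_eq_square) algebra
qed

lemma norm_less_one_geodesic:
  assumes "norm p = 1" "norm q = 1" "z \<in> geodesic p q"
  shows "norm z < 1"
proof -
  obtain t where t: "0 < t" "t < 1" "p \<noteq> q" and z: "z = (1 - t) *\<^sub>R p + t *\<^sub>R q"
    using assms(3) by (auto simp: in_segment)
  have "(norm z)\<^sup>2 < 1"
    unfolding z norm_point_on_line[OF assms(1,2)] using t by simp
  then show ?thesis using power_less_imp_less_base[of "norm z" 2 1] by simp
qed

text \<open>
  A chord is the part of its line inside the disc, because \<open>|z|^2 = 1 - t (1 - t) |q - p|^2\<close> for
  the point with parameter \<open>t\<close>.
\<close>

lemma mem_geodesic_iff: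
  assumes "norm p = 1" "norm q = 1" "p \<noteq> q"
  shows "z \<in> geodesic p q \<longleftrightarrow> norm z < 1 \<and> area p q z = 0"
proof
  assume z: "z \<in> geodesic p q"
  then obtain t where "z = (1 - t) *\<^sub>R p + t *\<^sub>R q" by (auto simp: in_segment)
  then show "norm z < 1 \<and> area p q z = 0"
    using norm_less_one_geodesic[OF assms(1,2) z] by (simp add: area_affine)
next
  assume z: "norm z < 1 \<and> area p q z = 0"
  then have "Im (cnj (q - p) * (z - p)) = 0" by (simp add: area_def)
  then have r: "cnj (q - p) * (z - p) = of_real (Re (cnj (q - p) * (z - p)))"
    by (simp add: complex_eq_iff)
  \<comment> \<open>The real number \<open>cnj (q - p) * (z - p)\<close> gives the position of \<open>z\<close> on the line \<open>pq\<close>; the norm decides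
    whether it lies between \<open>p\<close> and \<open>q\<close>.\<close>
  define t where "t = Re (cnj (q - p) * (z - p)) / (norm (q - p))\<^sup>2"
  have "z - p = of_real t * (q - p)"
  proof -
    have "(q - p) * (cnj (q - p) * (z - p)) = of_real (t * (norm (q - p))\<^sup>2) * (q - p)"
      using r assms(3) by (simp add: t_def mult.commute)
    moreover have "(q - p) * cnj (q - p) = of_real ((norm (q - p))\<^sup>2)"
      by (rule complex_norm_square[symmetric])
    ultimately have "of_real ((norm (q - p))\<^sup>2) * (z - p) = of_real ((norm (q - p))\<^sup>2) * (of_real t * (q - p))"
      by (metis (no_types, opaque_lifting) mult.assoc mult.commute of_real_mult)
    then show ?thesis using assms(3) by simp
  qed
  then have zt: "z = (1 - t) *\<^sub>R p + t *\<^sub>R q" by (simp add: scaleR_conv_of_real algebra_simps)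
  have "0 < t \<and> t < 1"
  proof (rule ccontr)
    assume nt: "\<not> (0 < t \<and> t < 1)"
    have n: "(norm z)\<^sup>2 = 1 - t * (1 - t) * (norm (q - p))\<^sup>2"
      unfolding zt by (rule norm_point_on_line[OF assms(1,2)])
    have "t * (1 - t) \<le> 0" using nt by (simp add: mult_le_0_iff) linarith
    then have "t * (1 - t) * (norm (q - p))\<^sup>2 \<le> 0" by (rule mult_nonpos_nonneg) simp
    then have "norm z ^ 2 \<ge> 1" using n by linarith
    then show False using z power_strict_mono[of "norm z" 1 2] by simp
  qed
  then show "z \<in> geodesic p q" using zt assms(3) by (auto simp: in_segment)
qed

lemma geodesic_eq_iff:
  fixes p q r s :: complex
  assumes "p \<noteq> q"
  shows "geodesic p q = geodesic r s \<longleftrightarrow> {p, q} = {r, s}"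
  using assms by auto

text \<open>
  If the areas have weakly the same sign, the segment \<open>rs\<close> stays on one side of the line \<open>pq\<close>;
  otherwise it meets this line at a point of the disc, which then is on the chord \<open>pq\<close>.
\<close>

lemma geodesics_meet_iff:
  assumes "norm p = 1" "norm q = 1" "p \<noteq> q" "norm r = 1" "norm s = 1" "r \<noteq> s" "{p, q} \<noteq> {r, s}"
  shows "geodesic p q \<inter> geodesic r s \<noteq> {} \<longleftrightarrow> area p q r * area p q s < 0"
proof
  assume "geodesic p q \<inter> geodesic r s \<noteq> {}"
  then obtain z where z: "z \<in> geodesic p q" "z \<in> geodesic r s" by auto
  then obtain t where t: "0 < t" "t < 1" and zt: "z = (1 - t) *\<^sub>R r + t *\<^sub>R s" by (auto simp: in_segment)
  have 0: "(1 - t) * area p q r + t * area p q s = 0"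
    using z(1) mem_geodesic_iff[OF assms(1-3)] zt by (simp add: area_affine)
  show "area p q r * area p q s < 0"
  proof (rule ccontr)
    assume "\<not> ?thesis"
    then have "0 \<le> area p q r \<and> 0 \<le> area p q s \<or> area p q r \<le> 0 \<and> area p q s \<le> 0"
      by (auto simp: mult_less_0_iff)
    then have "area p q r = 0 \<and> area p q s = 0"
      using 0 t by (smt (verit) mult_nonneg_nonneg mult_pos_pos mult_pos_neg mult_nonneg_nonpos)
    then show False using assms area_eq_0_iff[of p q r] area_eq_0_iff[of p q s] by auto
  qed
next
  assume a: "area p q r * area p q s < 0"
  define x where "x = area p q r" define y where "y = area p q s"
  \<comment> \<open>The affine function \<open>area p q\<close> goes from \<open>x\<close> at \<open>r\<close> to \<open>y\<close> at \<open>s\<close>; it vanishes at this parameter.\<close>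
  define t where "t = x / (x - y)"
  have xy: "x * y < 0" using a by (simp add: x_def y_def)
  have t: "0 < t" "t < 1" using xy by (auto simp: t_def mult_less_0_iff field_simps)
  define z where "z = (1 - t) *\<^sub>R r + t *\<^sub>R s"
  have "z \<in> geodesic r s" using t assms by (auto simp: z_def in_segment)
  moreover have "area p q z = 0"
  proof -
    have "x \<noteq> y" using xy by auto
    then have "(1 - t) * x + t * y = 0" by (simp add: t_def field_simps)
    then show ?thesis by (simp add: z_def area_affine x_def y_def)
  qed
  ultimately show "geodesic p q \<inter> geodesic r s \<noteq> {}"
    using norm_less_one_geodesic[OF assms(4,5)] mem_geodesic_iff[OF assms(1-3)] by blast
qed

lemma mem_triangle_region_iff:
  assumes "ccw p q r"
  shows "z \<in> triangle_region {p, q, r} \<longleftrightarrow> area p q z > 0 \<and> area q r z > 0 \<and> area r p z > 0"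
proof -
  let ?A = "area p q r"
  have A: "?A > 0" using assms by (rule ccw_imp_area)
  have "\<not> collinear {p, q, r}"
  proof
    assume "collinear {p, q, r}"
    then obtain u where u: "\<forall>x\<in>{p,q,r}. \<forall>y\<in>{p,q,r}. \<exists>c. x - y = c *\<^sub>R u" unfolding collinear_def by blast
    then obtain c d where "q - p = c *\<^sub>R u" "r - p = d *\<^sub>R u" by (metis insertI1 insertI2)
    then have "area p q r = 0" by (simp add: area_def)
    then show False using A by simp
  qed
  then have *: "triangle_region {p, q, r} =
      {v. \<exists>x y z. 0 < x \<and> 0 < y \<and> 0 < z \<and> x + y + z = 1 \<and> x *\<^sub>R p + y *\<^sub>R q + z *\<^sub>R r = v}"
    unfolding triangle_region_def by (intro interior_convex_hull_3_minimal) auto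
  show ?thesis
  proof
    assume "z \<in> triangle_region {p, q, r}"
    then obtain a b c where abc: "0 < a" "0 < b" "0 < c" "a + b + c = 1"
      and z: "z = a *\<^sub>R p + b *\<^sub>R q + c *\<^sub>R r" unfolding * by auto
    have a: "a = 1 - b - c" using abc by simp
    have "area p q z = c * ?A" "area q r z = a * ?A" "area r p z = b * ?A"
      unfolding z a by (simp_all add: area_eq algebra_simps)
    then show "area p q z > 0 \<and> area q r z > 0 \<and> area r p z > 0" using abc A by simp
  next
    assume h: "area p q z > 0 \<and> area q r z > 0 \<and> area r p z > 0"
    have s: "area p q z + area q r z + area r p z = ?A" by (rule area_sum)
    \<comment> \<open>Barycentric coordinates are quotients of areas.\<close>
    have "area q r z *\<^sub>R p + area r p z *\<^sub>R q + area p q z *\<^sub>R r = ?A *\<^sub>R z"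
      by (simp add: complex_eq_iff area_eq algebra_simps)
    then have "(area q r z / ?A) *\<^sub>R p + (area r p z / ?A) *\<^sub>R q + (area p q z / ?A) *\<^sub>R r = z"
    proof -
      have "(area q r z / ?A) *\<^sub>R p + (area r p z / ?A) *\<^sub>R q + (area p q z / ?A) *\<^sub>R r =
          (1 / ?A) *\<^sub>R (area q r z *\<^sub>R p + area r p z *\<^sub>R q + area p q z *\<^sub>R r)"
        by (simp add: scaleR_add_right)
      also have "\<dots> = z" using A by (simp only: \<open>_ = ?A *\<^sub>R z\<close> scaleR_scaleR) simp
      finally show ?thesis .
    qed
    moreover have "area q r z / ?A + area r p z / ?A + area p q z / ?A = 1"
      using s A by (simp add: field_simps)
    ultimately show "z \<in> triangle_region {p, q, r}"
      unfolding * using h A by (smt (verit) divide_pos_pos mem_Collect_eq)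
  qed
qed

lemma closure_triangle_region:
  assumes "ccw p q r"
  shows "closure (triangle_region {p, q, r}) = convex hull {p, q, r}"
proof -
  have "triangle_region {p, q, r} \<noteq> {}"
  proof -
    have "area p q r > 0" using assms by (rule ccw_imp_area)
    moreover have "area p q ((1/3) *\<^sub>R (p + q + r)) = area p q r / 3"
      "area q r ((1/3) *\<^sub>R (p + q + r)) = area p q r / 3"
      "area r p ((1/3) *\<^sub>R (p + q + r)) = area p q r / 3"
      by (simp_all add: area_eq field_simps)
    ultimately have "(1/3) *\<^sub>R (p + q + r) \<in> triangle_region {p, q, r}"
      unfolding mem_triangle_region_iff[OF assms] by simp
    then show ?thesis by auto
  qed
  then have "closure (triangle_region {p, q, r}) = closure (convex hull {p, q, r})"
    unfolding triangle_region_def by (intro convex_closure_interior) auto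
  then show ?thesis by (simp add: compact_imp_closed finite_imp_compact_convex_hull)
qed

lemma triangle_region_nonempty: "ccw p q r \<Longrightarrow> triangle_region {p, q, r} \<noteq> {}"
proof -
  assume "ccw p q r"
  then have "closure (triangle_region {p, q, r}) \<noteq> {}"
    by (simp add: closure_triangle_region)
  then show ?thesis by auto
qed

lemma area_nonneg_closure_triangle_region:
  assumes "ccw p q r" "z \<in> closure (triangle_region {p, q, r})"
  shows "area p q z \<ge> 0" "area q r z \<ge> 0" "area r p z \<ge> 0"
proof -
  let ?C = "{z. area p q z \<ge> 0 \<and> area q r z \<ge> 0 \<and> area r p z \<ge> 0}"
  have "closed ?C" unfolding area_eq by (intro closed_Collect_conj closed_Collect_le continuous_intros)
  moreover have "triangle_region {p, q, r} \<subseteq> ?C" using mem_triangle_region_iff[OF assms(1)] by auto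
  ultimately have "closure (triangle_region {p, q, r}) \<subseteq> ?C" by (simp add: closure_minimal)
  then show "area p q z \<ge> 0" "area q r z \<ge> 0" "area r p z \<ge> 0" using assms(2) by auto
qed

lemma norm_less_one_triangle_region:
  assumes "ccw p q r" "z \<in> triangle_region {p, q, r}"
  shows "norm z < 1"
proof -
  have "convex hull {p, q, r} \<subseteq> cball 0 1"
    using ccw_on_circle[OF assms(1)] by (intro hull_minimal) auto
  then have "triangle_region {p, q, r} \<subseteq> interior (cball 0 1)"
    unfolding triangle_region_def by (rule interior_mono)
  then show ?thesis using assms by auto
qed

lemma open_triangle_region: "open (triangle_region T)"
  by (simp add: triangle_region_def)

lemma connected_triangle_region: "connected (triangle_region T)"
  by (simp add: triangle_region_def convex_connected)

text \<open>
  The circle meets the ideal triangle only in its vertices, since every other point of the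
  circle is separated from it by a side.
\<close>

lemma circle_point_of_triangle:
  assumes "ccw p q r" "norm x = 1" "area p q x \<ge> 0" "area q r x \<ge> 0" "area r p x \<ge> 0"
  shows "x \<in> {p, q, r}"
proof (rule ccontr)
  assume x: "x \<notin> {p, q, r}"
  note c = ccw_on_circle[OF assms(1)]
  have "ccw p q x" "ccw q r x" "ccw r p x"
    using assms x c ccw_distinct[OF assms(1)]
    by (auto simp: area_eq_0_iff order_le_less simp flip: area_pos_iff_ccw)
  then show False using assms(1,2) c by (auto simp: ccw_iff_pos)
qed

lemma ideal_triangle_ccwE:
  assumes "T \<in> ideal_triangles"
  obtains p q r where "T = {p, q, r}" "ccw p q r"
proof -
  from assms obtain p q r where T: "T = {p, q, r}" "p \<noteq> q" "q \<noteq> r" "p \<noteq> r" "T \<subseteq> dyadic_points"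
    unfolding ideal_triangles_def by (auto simp: card_3_iff)
  then have n: "norm p = 1" "norm q = 1" "norm r = 1" using dyadic_points_on_circle by auto
  have "T = {q, p, r}" using T by auto
  then show ?thesis using that T ccw_total[OF n] by metis
qed

text \<open>
  The vertices are recovered from the region as the points of its closure on the circle.
\<close>

lemma triangle_region_inj:
  assumes "ccw p q r" "T = {p, q, r}" "ccw p' q' r'" "T' = {p', q', r'}"
    and "triangle_region T = triangle_region T'"
  shows "T = T'"
proof -
  have "sphere 0 1 \<inter> convex hull {x, y, z} = {x, y, z}" if c: "ccw x y z" for x y z
  proof
    show "sphere 0 1 \<inter> convex hull {x, y, z} \<subseteq> {x, y, z}"
    proof
      fix x' assume "x' \<in> sphere 0 1 \<inter> convex hull {x, y, z}"
      then show "x' \<in> {x, y, z}"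
        using area_nonneg_closure_triangle_region[OF c, of x']
        by (intro circle_point_of_triangle[OF c]) (auto simp: closure_triangle_region[OF c])
    qed
    show "{x, y, z} \<subseteq> sphere 0 1 \<inter> convex hull {x, y, z}"
      using ccw_on_circle[OF c] by (auto simp: hull_inc)
  qed
  then show ?thesis using assms closure_triangle_region by metis
qed

section \<open>Triangulations as non-crossing sets of arcs\<close>

lemma arcsE:
  assumes "a \<in> arcs"
  obtains p q where "a = geodesic p q" "p \<noteq> q" "p \<in> dyadic_points" "q \<in> dyadic_points"
    "norm p = 1" "norm q = 1"
  using assms dyadic_points_on_circle by (auto simp: arcs_def)

lemma geodesic_in_arcsD:
  assumes "geodesic p q \<in> arcs" "norm p = 1" "norm q = 1"
  shows "p \<in> dyadic_points" "q \<in> dyadic_points" "p \<noteq> q"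
proof -
  from assms(1) obtain p' q' where pq: "geodesic p q = geodesic p' q'" "p' \<noteq> q'" "p' \<in> dyadic_points" "q' \<in> dyadic_points"
    "norm p' = 1" "norm q' = 1" by (rule arcsE)
  show "p \<noteq> q" using pq(1,2) by auto
  then have "{p, q} = {p', q'}" using geodesic_eq_iff[of p q p' q'] pq(1) by simp
  then show "p \<in> dyadic_points" "q \<in> dyadic_points" using pq by (auto simp: doubleton_eq_iff)
qed

lemma arcs_subset_disc: "a \<in> arcs \<Longrightarrow> a \<subseteq> hyp_disc"
  by (erule arcsE) (auto intro: norm_less_one_geodesic)

text \<open>The part of being an ideal triangulation that does not mention components.\<close>

definition noncrossing :: "complex set set \<Rightarrow> bool" where
  "noncrossing v \<longleftrightarrow> v \<subseteq> arcs \<and> pairwise disjnt v"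

text \<open>
  Arcs that do not cross lie weakly on one side of each other; a common end point has area \<open>0\<close>.
\<close>

lemma noncrossing_area:
  assumes "noncrossing v" "geodesic p q \<in> v" "geodesic g h \<in> v"
    and n: "norm p = 1" "norm q = 1" "norm g = 1" "norm h = 1"
  shows "area p q g * area p q h \<ge> 0"
proof (cases "geodesic p q = geodesic g h")
  case True
  then have "{p, q} = {g, h}"
    using assms geodesic_eq_iff geodesic_in_arcsD(3) by (metis noncrossing_def subset_eq)
  then show ?thesis by (auto simp: doubleton_eq_iff)
next
  case False
  then have "geodesic p q \<inter> geodesic g h = {}"
    using assms by (auto simp: noncrossing_def pairwise_def disjnt_def)
  moreover have "p \<noteq> q" "g \<noteq> h" using assms geodesic_in_arcsD(3) by (auto simp: noncrossing_def)
  moreover have "{p, q} \<noteq> {g, h}" using False by (auto simp: doubleton_eq_iff open_segment_commute)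
  ultimately show ?thesis using geodesics_meet_iff[of p q g h] n by (meson not_le)
qed

text \<open>
  An arc through a point of the triangle that crosses none of the sides has both end points on
  the inner side of each of them, and so ends in two vertices of the triangle: it is a side,
  which does not meet the open triangle.
\<close>

lemma noncrossing_triangle_region:
  assumes v: "noncrossing v" and c: "ccw p q r"
    and s: "geodesic p q \<in> v" "geodesic q r \<in> v" "geodesic r p \<in> v"
  shows "triangle_region {p, q, r} \<inter> \<Union>v = {}"
proof (rule ccontr)
  note n = ccw_on_circle[OF c]
  assume "\<not> ?thesis"
  then obtain z a where z: "z \<in> triangle_region {p, q, r}" "z \<in> a" "a \<in> v" by auto
  then obtain g h where a: "a = geodesic g h" "g \<noteq> h" "norm g = 1" "norm h = 1"
    using v by (metis arcsE noncrossing_def subset_eq)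
  then obtain t where t: "0 < t" "t < 1" "z = (1 - t) *\<^sub>R g + t *\<^sub>R h" using z by (auto simp: in_segment)
  have pos: "area p q z > 0" "area q r z > 0" "area r p z > 0"
    using z mem_triangle_region_iff[OF c] by auto
  have side: "area x y g \<ge> 0 \<and> area x y h \<ge> 0"
    if "geodesic x y \<in> v" "area x y z > 0" "norm x = 1" "norm y = 1" for x y
  proof (rule ccontr)
    assume "\<not> ?thesis"
    moreover have "area x y g * area x y h \<ge> 0"
      using noncrossing_area[OF v that(1) _ that(3,4) a(3,4)] z a by auto
    ultimately have "area x y g \<le> 0 \<and> area x y h \<le> 0"
      by (auto simp: zero_le_mult_iff)
    then have "(1 - t) * area x y g + t * area x y h \<le> 0" using t
      by (intro add_nonpos_nonpos mult_nonneg_nonpos) auto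
    then show False using that t by (simp add: area_affine)
  qed
  have "g \<in> {p, q, r}" "h \<in> {p, q, r}"
    using side[of p q] side[of q r] side[of r p] pos s n a
    by (intro circle_point_of_triangle[OF c]; simp)+
  moreover have "area g h z = 0" "area h g z = 0"
    using z a mem_geodesic_iff[of g h] area_swap[of g h z] by auto
  ultimately show False using pos a(2) by auto
qed

text \<open>
  The region is connected, and it is relatively closed in the complement of the arcs because its
  sides have been removed. So it is a component.
\<close>

lemma triangles_ofI:
  assumes v: "noncrossing v" and c: "ccw p q r"
    and s: "geodesic p q \<in> v" "geodesic q r \<in> v" "geodesic r p \<in> v"
  shows "{p, q, r} \<in> triangles_of v"
proof -
  let ?R = "triangle_region {p, q, r}" and ?X = "hyp_disc - \<Union>v"
  note n = ccw_on_circle[OF c] and ne = ccw_distinct[OF c]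
  have sub: "?R \<subseteq> ?X"
    using noncrossing_triangle_region[OF v c s] norm_less_one_triangle_region[OF c] by auto
  have cl: "closure ?R \<inter> ?X \<subseteq> ?R"
  proof
    fix z assume z: "z \<in> closure ?R \<inter> ?X"
    have "area x y z \<noteq> 0" if "geodesic x y \<in> v" "norm x = 1" "norm y = 1" "x \<noteq> y" for x y
      using that z mem_geodesic_iff[of x y z] by auto
    then have "area p q z \<noteq> 0" "area q r z \<noteq> 0" "area r p z \<noteq> 0" using s n ne by auto
    then show "z \<in> ?R" using area_nonneg_closure_triangle_region[OF c, of z] z
      by (auto simp: mem_triangle_region_iff[OF c] order_le_less)
  qed
  have "?R \<in> components ?X"
    unfolding in_components_maximal
  proof (intro conjI allI impI)
    fix D assume D: "D \<noteq> {} \<and> ?R \<subseteq> D \<and> D \<subseteq> ?X \<and> connected D"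
    have "openin (top_of_set D) ?R"
      using D open_triangle_region by (auto intro: open_openin_trans open_subset)
    moreover have "closedin (top_of_set D) ?R"
      using D cl closure_subset[of ?R] by (auto simp: closedin_closed intro!: exI[of _ "closure ?R"])
    ultimately show "D = ?R"
      using D triangle_region_nonempty[OF c] unfolding connected_clopen by metis
  qed (use sub triangle_region_nonempty[OF c] connected_triangle_region in auto)
  moreover have "{p, q, r} \<in> ideal_triangles"
    using geodesic_in_arcsD s v n ne by (auto simp: ideal_triangles_def noncrossing_def)
  ultimately show ?thesis by (simp add: triangles_of_def)
qed

lemma ideal_triangulation_noncrossing: "ideal_triangulation v \<Longrightarrow> noncrossing v"
  by (simp add: ideal_triangulation_def noncrossing_def)

lemma ideal_triangulationD:
  assumes "ideal_triangulation v" "norm z < 1" "z \<notin> \<Union>v"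
  obtains T where "T \<in> triangles_of v" "z \<in> triangle_region T"
proof -
  have "z \<in> hyp_disc - \<Union>v" using assms by simp
  then obtain C where C: "C \<in> components (hyp_disc - \<Union>v)" "z \<in> C"
    using Union_components[of "hyp_disc - \<Union>v"] by blast
  then obtain T where "T \<in> ideal_triangles" "C = triangle_region T"
    using assms(1) unfolding ideal_triangulation_def by blast
  then show ?thesis using C that[of T] unfolding triangles_of_def by simp
qed

lemma triangles_of_ccwE:
  assumes "T \<in> triangles_of v"
  obtains p q r where "T = {p, q, r}" "ccw p q r"
  using assms by (auto simp: triangles_of_def elim: ideal_triangle_ccwE)

lemma triangles_of_regions_meet:
  assumes "T \<in> triangles_of v" "T' \<in> triangles_of v" "triangle_region T \<inter> triangle_region T' \<noteq> {}"
  shows "T = T'"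
proof -
  have "triangle_region T = triangle_region T'"
    using assms components_eq unfolding triangles_of_def by blast
  then show ?thesis using assms triangle_region_inj by (metis triangles_of_ccwE)
qed

lemma triangles_of_region_disjoint:
  "T \<in> triangles_of v \<Longrightarrow> triangle_region T \<inter> \<Union>v = {}"
  unfolding triangles_of_def using in_components_subset by fastforce

text \<open>
  A point \<open>z\<close> of the side cannot be in the complement of the arcs: its component would be an
  open triangle that meets the given one. An arc through \<open>z\<close> other than the side would enter the
  given triangle, which is free of arcs.
\<close>

lemma side_in_triangulation:
  assumes v: "ideal_triangulation v" and T: "{p, q, r} \<in> triangles_of v" and c: "ccw p q r"
  shows "geodesic p q \<in> v"
proof -
  let ?T = "{p, q, r}"
  note n = ccw_on_circle[OF c] and ne = ccw_distinct[OF c]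
  have "geodesic p q \<noteq> {}" using ne by simp
  then obtain z where z: "z \<in> geodesic p q" by blast
  then have z0: "norm z < 1" "area p q z = 0" using n ne mem_geodesic_iff[of p q] by auto
  obtain u where u: "0 < u" "u < 1" "z = (1 - u) *\<^sub>R p + u *\<^sub>R q" using z by (auto simp: in_segment)
  have A: "area p q r > 0" using c by (rule ccw_imp_area)
  have z1: "area q r z > 0" "area r p z > 0"
    using u A by (simp_all add: area_affine area_rot[of q r p] area_rot[of r p q])
  have "z \<in> closed_segment p q" using z by (simp add: open_segment_def)
  then have "z \<in> convex hull ?T"
    using hull_mono[of "{p, q}" ?T convex] by (auto simp: segment_convex_hull)
  then have zc: "z \<in> closure (triangle_region ?T)" by (simp add: closure_triangle_region[OF c])
  have "z \<in> \<Union>v"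
  proof (rule ccontr)
    assume "z \<notin> \<Union>v"
    then obtain T' where T': "T' \<in> triangles_of v" "z \<in> triangle_region T'"
      using ideal_triangulationD[OF v z0(1)] by blast
    then have "triangle_region T' \<inter> triangle_region ?T \<noteq> {}"
      using zc open_triangle_region open_Int_closure_eq_empty by blast
    then have "T' = ?T" using T T' triangles_of_regions_meet by blast
    then show False using T'(2) z0 mem_triangle_region_iff[OF c] by simp
  qed
  then obtain a where a: "a \<in> v" "z \<in> a" by blast
  then obtain g h where gh: "a = geodesic g h" "g \<noteq> h" "norm g = 1" "norm h = 1"
    using v by (metis arcsE ideal_triangulation_def subset_eq)
  obtain t where t: "0 < t" "t < 1" "z = (1 - t) *\<^sub>R g + t *\<^sub>R h" using a gh by (auto simp: in_segment)
  have no: "\<not> area p q x > 0" if x: "x = g \<or> x = h" for x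
  proof
    assume ax: "area p q x > 0"
    \<comment> \<open>Moving along the arc from \<open>z\<close> towards \<open>x\<close> enters the triangle at once: the two other sides are
      at positive distance from \<open>z\<close>.\<close>
    define f where "f s = (1 - s) *\<^sub>R z + s *\<^sub>R x" for s :: real
    have cont: "((\<lambda>s. area w w' (f s)) \<longlongrightarrow> area w w' z) (at_right 0)" for w w'
      unfolding f_def area_affine by (rule tendsto_eq_intros refl | simp)+
    have "eventually (\<lambda>s. area q r (f s) > 0) (at_right 0)"
      "eventually (\<lambda>s. area r p (f s) > 0) (at_right 0)"
      using cont[of q r] cont[of r p] z1 by (auto dest: order_tendstoD)
    moreover have "eventually (\<lambda>s::real. 0 < s \<and> s < 1) (at_right 0)"
      unfolding eventually_at_right_field by (auto intro!: exI[of _ 1])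
    ultimately have "eventually (\<lambda>s. area q r (f s) > 0 \<and> area r p (f s) > 0 \<and> 0 < s \<and> s < 1) (at_right 0)"
      by eventually_elim auto
    then obtain s where s: "area q r (f s) > 0" "area r p (f s) > 0" "0 < s" "s < 1"
      using eventually_happens trivial_limit_at_right_real by blast
    have "area p q (f s) = s * area p q x" by (simp add: f_def area_affine z0)
    then have "f s \<in> triangle_region ?T" using s ax by (simp add: mem_triangle_region_iff[OF c])
    moreover have "f s \<in> a"
    proof -
      have "f s = (1 - (t - s * t)) *\<^sub>R g + (t - s * t) *\<^sub>R h" if "x = g"
        unfolding f_def t(3) that by (simp add: algebra_simps)
      moreover have "f s = (1 - (t + s * (1 - t))) *\<^sub>R g + (t + s * (1 - t)) *\<^sub>R h" if "x = h"
        unfolding f_def t(3) that by (simp add: algebra_simps)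
      moreover have "0 < t - s * t" "t - s * t < 1" "0 < t + s * (1 - t)" "t + s * (1 - t) < 1"
      proof -
        have "s * t < t" "0 < s * t" using s t by auto
        moreover have "s * (1 - t) < 1 - t" "0 < s * (1 - t)" using s t by auto
        ultimately show "0 < t - s * t" "t - s * t < 1" "0 < t + s * (1 - t)" "t + s * (1 - t) < 1"
          using t by linarith+
      qed
      ultimately show ?thesis using x gh unfolding gh(1) in_segment by blast
    qed
    ultimately show False using triangles_of_region_disjoint[OF T] a by blast
  qed
  have "(1 - t) * area p q g + t * area p q h = 0" using z0 t by (simp add: area_affine)
  moreover have "area p q g \<le> 0" "area p q h \<le> 0" using no by (auto simp: not_less)
  ultimately have "area p q g = 0 \<and> area p q h = 0"
    using t by (smt (verit) mult_pos_neg mult_nonneg_nonpos)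
  then have "{g, h} = {p, q}" using n ne gh area_eq_0_iff[of p q g] area_eq_0_iff[of p q h] by auto
  then have "a = geodesic p q" using gh by (auto simp: doubleton_eq_iff open_segment_commute)
  then show ?thesis using a by simp
qed

text \<open>
  This reduces triangles, which are defined through components of the complement, to incidence
  of arcs.
\<close>

lemma mem_triangles_of_iff:
  assumes v: "ideal_triangulation v"
  shows "{p, q, r} \<in> triangles_of v \<longleftrightarrow>
    norm p = 1 \<and> norm q = 1 \<and> norm r = 1 \<and> p \<noteq> q \<and> q \<noteq> r \<and> p \<noteq> r \<and>
    geodesic p q \<in> v \<and> geodesic q r \<in> v \<and> geodesic r p \<in> v"
    (is "?L \<longleftrightarrow> ?R")
proof
  assume L: ?L
  then have it: "{p, q, r} \<in> ideal_triangles" by (simp add: triangles_of_def)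
  then have d: "p \<noteq> q" "q \<noteq> r" "p \<noteq> r" and n: "norm p = 1" "norm q = 1" "norm r = 1"
    using dyadic_points_on_circle by (auto simp: ideal_triangles_def card_insert_if split: if_splits)
  have *: "geodesic x y \<in> v \<and> geodesic y z \<in> v \<and> geodesic z x \<in> v"
    if "{x, y, z} = {p, q, r}" "ccw x y z" for x y z
  proof -
    have "{y, z, x} = {p, q, r}" "{z, x, y} = {p, q, r}" using that by auto
    then show ?thesis using side_in_triangulation[OF v] L that ccw_rot by metis
  qed
  have "{q, p, r} = {p, q, r}" by auto
  then show ?R using ccw_total[OF n d] *[of p q r] *[of q p r] d n by (auto simp: open_segment_commute)
next
  assume R: ?R
  then have "ccw p q r \<or> ccw q p r" using ccw_total by blast
  moreover have "{q, p, r} = {p, q, r}" by auto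
  ultimately show ?L using triangles_ofI[OF ideal_triangulation_noncrossing[OF v]] R
    by (metis open_segment_commute)
qed

text \<open>
  An arc that meets no arc of \<open>v\<close> would be contained in an open triangle; but its end points lie
  on the circle, where the closed triangle has only its vertices.
\<close>

lemma triangulation_maximal:
  assumes v: "ideal_triangulation v" and a: "a \<in> arcs"
  shows "\<exists>b\<in>v. a \<inter> b \<noteq> {}"
proof (rule ccontr)
  assume "\<not> ?thesis"
  then have no: "a \<inter> \<Union>v = {}" by blast
  obtain g h where gh: "a = geodesic g h" "g \<noteq> h" "norm g = 1" "norm h = 1" using a by (rule arcsE)
  have aX: "a \<subseteq> hyp_disc - \<Union>v" using no arcs_subset_disc[OF a] by blast
  obtain z where z: "z \<in> a" using gh by fastforce
  then have "norm z < 1" "z \<notin> \<Union>v" using aX by auto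
  then obtain T where T: "T \<in> triangles_of v" "z \<in> triangle_region T" by (rule ideal_triangulationD[OF v])
  obtain p q r where pqr: "T = {p, q, r}" and c: "ccw p q r" using T(1) by (rule triangles_of_ccwE)
  have "connected a" unfolding gh(1) by (intro convex_connected convex_open_segment)
  moreover have "triangle_region T \<in> components (hyp_disc - \<Union>v)" using T by (simp add: triangles_of_def)
  ultimately have sub: "a \<subseteq> triangle_region T"
    using components_maximal[OF _ _ aX] z T(2) by blast
  then have "closure a \<subseteq> closure (triangle_region T)" by (rule closure_mono)
  then have gc: "g \<in> closure (triangle_region T)" "h \<in> closure (triangle_region T)"
    using gh by auto
  have "g \<in> {p, q, r}" "h \<in> {p, q, r}"
    using area_nonneg_closure_triangle_region[OF c] gc gh unfolding pqr
    by (intro circle_point_of_triangle[OF c]; simp)+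
  moreover have "area g h z = 0" "area h g z = 0"
    using z gh mem_geodesic_iff[of g h] area_swap[of g h z] by auto
  moreover have "area p q z > 0" "area q r z > 0" "area r p z > 0"
    using T pqr mem_triangle_region_iff[OF c] by auto
  ultimately show False using gh(2) by auto
qed

lemma triangulation_subset_eq:
  assumes "ideal_triangulation v" "noncrossing w" "v \<subseteq> w"
  shows "v = w"
proof (rule ccontr)
  assume "v \<noteq> w"
  then obtain a where a: "a \<in> w" "a \<notin> v" using assms by auto
  then obtain b where "b \<in> v" "a \<inter> b \<noteq> {}"
    using triangulation_maximal[OF assms(1), of a] assms(2) unfolding noncrossing_def by blast
  then show False using a assms unfolding noncrossing_def pairwise_def disjnt_def by (metis subset_eq)
qed

section \<open>Flips of triangulations\<close>

text \<open>
  An affine function is determined by its values at \<open>a, b, c\<close>, with the areas as barycentric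
  weights.
\<close>

lemma area_barycentric:
  "area u w z * area a b c = area b c z * area u w a + area c a z * area u w b + area a b z * area u w c"
  by (simp add: area_eq algebra_simps)

text \<open>
  Cutting the quadrilateral \<open>p, s, q, r\<close> along \<open>pq\<close> and cutting it along \<open>rs\<close> fill the same set,
  which is cut out by its four sides.
\<close>

lemma quadrilateral_two_diagonals:
  assumes c1: "ccw p s q" and c2: "ccw p q r"
    and z: "z \<in> triangle_region {p, s, q} \<union> geodesic p q \<union> triangle_region {p, q, r}"
  shows "z \<in> triangle_region {s, q, r} \<union> geodesic s r \<union> triangle_region {s, r, p}"
proof -
  note n = ccw_on_circle[OF c1] ccw_on_circle[OF c2]
  have c3: "ccw s q r" "ccw s r p" using n c1 c2 by (auto simp: ccw_iff_pos)
  have A: "area p s q > 0" "area p q r > 0" "area s q r > 0" "area s r p > 0"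
    using c1 c2 c3 ccw_imp_area by auto
  have A': "area p s r > 0" "area q r s > 0" "area q r p > 0" "area r p s > 0" "area r p q > 0" "area s q p > 0"
    using A area_rot by metis+
  have part: "area p s z > 0 \<and> area s q z > 0 \<and> area q r z > 0 \<and> area r p z > 0"
    if c: "ccw p s q" and z: "z \<in> triangle_region {p, s, q}"
      and A: "area p s q > 0" "area q r p > 0" "area q r s > 0" "area r p s > 0" "area r p q > 0"
    for p s q r
  proof -
    have h: "area p s z > 0" "area s q z > 0" "area q p z > 0"
      using z mem_triangle_region_iff[OF c] by auto
    have "area q r z * area p s q > 0" "area r p z * area p s q > 0"
      unfolding area_barycentric[of _ _ z p s q] using h A by (simp_all add: add_pos_pos)
    then show ?thesis using h A(1) by (auto simp: zero_less_mult_iff)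
  qed
  have "area p s z > 0 \<and> area s q z > 0 \<and> area q r z > 0 \<and> area r p z > 0"
    using z
  proof (elim UnE)
    assume "z \<in> triangle_region {p, s, q}"
    then show ?thesis using part[of p s q r] c1 A A' by blast
  next
    assume "z \<in> triangle_region {p, q, r}"
    moreover have "{q, r, p} = {p, q, r}" by auto
    ultimately show ?thesis using part[of q r p s] ccw_rot[OF c2] A A' area_rot by metis
  next
    assume "z \<in> geodesic p q"
    then obtain t where t: "0 < t" "t < 1" "z = (1 - t) *\<^sub>R p + t *\<^sub>R q" by (auto simp: in_segment)
    then show ?thesis using A A' by (simp add: area_affine)
  qed
  moreover have "norm z < 1"
    using z norm_less_one_triangle_region[OF c1] norm_less_one_triangle_region[OF c2]
      norm_less_one_geodesic[of p q] n by auto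
  ultimately show ?thesis
    using mem_triangle_region_iff[OF c3(1), of z] mem_triangle_region_iff[OF c3(2), of z]
      mem_geodesic_iff[of s r z] n ccw_distinct[OF c3(1)] area_swap[of s r z]
    by (cases "area s r z" "0::real" rule: linorder_cases) auto
qed

text \<open>Non-crossing in terms of the cyclic order only.\<close>

lemma noncrossing_ccw:
  assumes "noncrossing v" "geodesic p q \<in> v" "geodesic g h \<in> v" "ccw p q g" "ccw q p h"
  shows False
proof -
  have "area p q g > 0" "area p q h < 0"
    using assms(4,5) ccw_imp_area[of p q g] ccw_imp_area[of q p h] area_swap[of q p h] by auto
  then have "area p q g * area p q h < 0" by (rule mult_pos_neg)
  then show False
    using noncrossing_area[OF assms(1-3)] ccw_on_circle[OF assms(4)] ccw_on_circle[OF assms(5)] by auto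
qed

text \<open>Two third vertices on the same side of \<open>pq\<close> would produce crossing sides.\<close>

lemma third_vertex_unique:
  assumes v: "ideal_triangulation v" and T: "{p, q, r} \<in> triangles_of v" "{p, q, r'} \<in> triangles_of v"
    and c: "ccw p q r" "ccw p q r'"
  shows "r = r'"
proof (rule ccontr)
  assume ne: "r \<noteq> r'"
  note n = ccw_on_circle[OF c(1)] ccw_on_circle[OF c(2)]
  note v' = ideal_triangulation_noncrossing[OF v]
  have s: "geodesic q r \<in> v" "geodesic p r \<in> v" "geodesic q r' \<in> v" "geodesic p r' \<in> v"
    using T mem_triangles_of_iff[OF v] by (auto simp: open_segment_commute)
  have "pos r \<noteq> pos r'" using n ne pos_eq_iff by auto
  then have "ccw p r r' \<and> ccw r p q \<or> ccw p r' r \<and> ccw r' p q"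
    using c n by (simp add: ccw_iff_pos) linarith
  then show False
    using noncrossing_ccw[OF v', of p r r' q] noncrossing_ccw[OF v', of p r' r q] s
      by (auto simp: open_segment_commute)
qed

lemma opposite_third_vertices:
  assumes v: "ideal_triangulation v" and T: "{p, q, r} \<in> triangles_of v" "{p, q, s} \<in> triangles_of v" "r \<noteq> s"
  shows "ccw p q r \<and> ccw q p s \<or> ccw q p r \<and> ccw p q s"
proof -
  have T': "{q, p, r} \<in> triangles_of v" "{q, p, s} \<in> triangles_of v" using T by (auto simp: insert_commute)
  show ?thesis
    using third_vertex_unique[OF v T(1,2)] third_vertex_unique[OF v T'] T(3)
      mem_triangles_of_iff[OF v] T(1,2) ccw_total[of p q r] ccw_total[of p q s] by blast
qed

lemma third_vertex_cases:
  assumes v: "ideal_triangulation v" and T: "{p, q, r} \<in> triangles_of v" "{p, q, s} \<in> triangles_of v" "r \<noteq> s"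
    and y: "{p, q, y} \<in> triangles_of v"
  shows "y = r \<or> y = s"
proof (rule ccontr)
  assume "\<not> ?thesis"
  then show False
    using opposite_third_vertices[OF v T(1,2)] opposite_third_vertices[OF v T(1) y] opposite_third_vertices[OF v T(2) y]
      T(3) ccw_asym by blast
qed

text \<open>
  Among four points of a circle, one of the three ways to pair them up gives two crossing
  chords.
\<close>

lemma no_noncrossing_K4:
  assumes v: "noncrossing v" and n: "norm p = 1" "norm q = 1" "norm r = 1" "norm s = 1"
    and "geodesic p q \<in> v" "geodesic p r \<in> v" "geodesic p s \<in> v" "geodesic q r \<in> v" "geodesic q s \<in> v" "geodesic r s \<in> v"
  shows False
proof -
  have "x \<noteq> y" if "geodesic x y \<in> v" "norm x = 1" "norm y = 1" for x y
    using that v geodesic_in_arcsD(3) by (auto simp: noncrossing_def)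
  then have ne: "p \<noteq> q" "p \<noteq> r" "p \<noteq> s" "q \<noteq> r" "q \<noteq> s" "r \<noteq> s"
    using assms by auto
  have same_side: "ccw x y a \<longleftrightarrow> ccw x y b"
    if "geodesic x y \<in> v" "geodesic a b \<in> v" "norm x = 1" "norm y = 1" "norm a = 1" "norm b = 1"
      "x \<noteq> y" "a \<noteq> x" "a \<noteq> y" "b \<noteq> x" "b \<noteq> y" for x y a b
    using that noncrossing_ccw[OF v that(1,2)] noncrossing_ccw[OF v that(1), of b a]
      ccw_total[of x y a] ccw_total[of x y b] by (metis open_segment_commute)
  have "ccw p q r \<longleftrightarrow> ccw p q s" "ccw p r q \<longleftrightarrow> ccw p r s" "ccw p s q \<longleftrightarrow> ccw p s r"
    using same_side[of p q r s] same_side[of p r q s] same_side[of p s q r] assms ne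
    by (auto simp: open_segment_commute)
  moreover have "ccw p x y \<longleftrightarrow> \<not> ccw p y x" if "norm x = 1" "norm y = 1" "x \<noteq> y" "p \<noteq> x" "p \<noteq> y" for x y
    using ccw_total[of p x y] ccw_asym[of p x y] ccw_rot ccw_asym that n by metis
  ultimately show False using n ne by metis
qed

lemma crossing_not_in:
  assumes "noncrossing v" "geodesic p q \<in> v" "ccw p q r" "ccw q p s"
  shows "geodesic r s \<notin> v" "geodesic s r \<notin> v"
  using noncrossing_ccw[OF assms(1,2) _ assms(3,4)] by (auto simp: open_segment_commute)

text \<open>
  Outside the quadrilateral nothing changes, and inside it \<open>quadrilateral_two_diagonals\<close> shows
  that the two new triangles cover what the two old ones and the old diagonal did.
\<close>

lemma flip_triangulation_ccw:
  assumes v: "ideal_triangulation v" and c: "ccw p q r" "ccw q p s"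
    and T: "{p, q, r} \<in> triangles_of v" "{p, q, s} \<in> triangles_of v"
    and w: "w = insert (geodesic r s) (v - {geodesic p q})"
  shows "ideal_triangulation w"
proof -
  note n = ccw_on_circle[OF c(1)] ccw_on_circle[OF c(2)]
  note v' = ideal_triangulation_noncrossing[OF v]
  have c': "ccw p s q" using ccw_rot[OF c(2)] .
  have c3: "ccw s q r" "ccw s r p" "ccw q r p" using n c c' by (auto simp: ccw_iff_pos)
  have ne: "p \<noteq> q" "r \<noteq> s" "p \<noteq> r" "p \<noteq> s" "q \<noteq> r" "q \<noteq> s"
    using ccw_distinct[OF c(1)] ccw_distinct[OF c'] ccw_distinct[OF c3(1)] by auto
  have sides: "geodesic p q \<in> v" "geodesic q r \<in> v" "geodesic r p \<in> v" "geodesic q s \<in> v" "geodesic s p \<in> v"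
    using T mem_triangles_of_iff[OF v] by auto
  have psq: "{p, s, q} = {p, q, s}" "{q, r, p} = {p, q, r}" "{s, p, q} = {p, q, s}" by auto
  have rsv: "geodesic r s \<notin> v" using crossing_not_in[OF v' sides(1) c] by auto
  have arc: "geodesic r s \<in> arcs"
  proof -
    have "geodesic q r \<in> arcs" "geodesic q s \<in> arcs" using sides v' by (auto simp: noncrossing_def)
    then have "r \<in> dyadic_points" "s \<in> dyadic_points" using n geodesic_in_arcsD(2) by auto
    then show ?thesis using ne unfolding arcs_def by blast
  qed
  \<comment> \<open>The new diagonal runs inside the quadrilateral, which meets no arc of \<open>v\<close> but \<open>pq\<close>.\<close>
  have dis: "geodesic r s \<inter> g = {}" if g: "g \<in> v" "g \<noteq> geodesic p q" for g
  proof (rule ccontr)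
    assume "geodesic r s \<inter> g \<noteq> {}"
    then obtain z where z: "z \<in> geodesic s r" "z \<in> g" by (auto simp: open_segment_commute)
    then have "z \<in> triangle_region {q, r, p} \<union> geodesic q p \<union> triangle_region {q, p, s}"
      using quadrilateral_two_diagonals[OF c3(1,2), of z] by auto
    then have "z \<in> geodesic p q"
      using triangles_of_region_disjoint[OF T(1)] triangles_of_region_disjoint[OF T(2)] z g psq
      by (auto simp: insert_commute open_segment_commute)
    moreover have "geodesic p q \<inter> g = {}"
      using v' sides g by (auto simp: noncrossing_def pairwise_def disjnt_def)
    ultimately show False using z by auto
  qed
  have w': "noncrossing w"
    using v' arc dis unfolding w noncrossing_def pairwise_insert
    by (auto simp: disjnt_def pairwise_def)
  have keep: "geodesic x y \<in> w" if "geodesic x y \<in> v" "{x, y} \<noteq> {p, q}" "norm x = 1" "norm y = 1" for x y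
    using that geodesic_eq_iff[of x y p q] n ne v' geodesic_in_arcsD(3)[of x y] by (auto simp: w noncrossing_def)
  have new: "{s, q, r} \<in> triangles_of w" "{s, r, p} \<in> triangles_of w"
  proof -
    have "geodesic q r \<in> w" "geodesic r p \<in> w" "geodesic q s \<in> w" "geodesic s p \<in> w"
      using keep[of q r] keep[of r p] keep[of q s] keep[of s p] sides n ne by (auto simp: doubleton_eq_iff)
    moreover have "geodesic r s \<in> w" by (simp add: w)
    ultimately show "{s, q, r} \<in> triangles_of w" "{s, r, p} \<in> triangles_of w"
      using triangles_ofI[OF w' c3(1)] triangles_ofI[OF w' c3(2)] by (auto simp: open_segment_commute)
  qed
  have comp: "\<exists>T\<in>triangles_of w. z \<in> triangle_region T" if z: "norm z < 1" "z \<notin> \<Union>w" for z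
  proof (cases "z \<in> triangle_region {p, s, q} \<union> geodesic p q \<union> triangle_region {p, q, r}")
    case True
    then have "z \<in> triangle_region {s, q, r} \<or> z \<in> geodesic s r \<or> z \<in> triangle_region {s, r, p}"
      using quadrilateral_two_diagonals[OF c' c(1)] by blast
    moreover have "z \<notin> geodesic s r" using z by (simp add: w open_segment_commute)
    ultimately show ?thesis using new by blast
  next
    case False
    then have "z \<notin> \<Union>v" using z by (auto simp: w)
    then obtain T0 where T0: "T0 \<in> triangles_of v" "z \<in> triangle_region T0"
      using ideal_triangulationD[OF v z(1)] by blast
    obtain a b d where abd: "T0 = {a, b, d}" "ccw a b d" using T0(1) by (rule triangles_of_ccwE)
    have sides0: "geodesic a b \<in> v" "geodesic b d \<in> v" "geodesic d a \<in> v"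
      using T0 abd mem_triangles_of_iff[OF v] by auto
    have "\<not> {p, q} \<subseteq> T0"
    proof
      assume "{p, q} \<subseteq> T0"
      then obtain y where "T0 = {p, q, y}"
        using ne(1) unfolding abd(1) by (auto simp: insert_commute)
      then have "T0 = {p, q, r} \<or> T0 = {p, s, q}"
        using third_vertex_cases[OF v T ne(2), of y] T0 by (auto simp: insert_commute)
      then show False using False T0 by auto
    qed
    then have "{a, b} \<noteq> {p, q}" "{b, d} \<noteq> {p, q}" "{d, a} \<noteq> {p, q}" using abd by auto
    then have "T0 \<in> triangles_of w"
      using keep sides0 ccw_on_circle[OF abd(2)] unfolding abd(1)
      by (intro triangles_ofI[OF w' abd(2)]) auto
    then show ?thesis using T0 by auto
  qed
  have "\<exists>T\<in>ideal_triangles. C = triangle_region T" if C: "C \<in> components (hyp_disc - \<Union>w)" for C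
  proof -
    obtain z where z: "z \<in> C" using C in_components_nonempty by blast
    then have "z \<in> hyp_disc - \<Union>w" using C in_components_subset by blast
    then obtain T where T: "T \<in> triangles_of w" "z \<in> triangle_region T" using comp by auto
    then have "C = triangle_region T"
      using C z components_nonoverlap[of C "hyp_disc - \<Union>w" "triangle_region T"]
      unfolding triangles_of_def by blast
    then show ?thesis using T unfolding triangles_of_def by blast
  qed
  then show ?thesis using w' by (auto simp: ideal_triangulation_def noncrossing_def)
qed

text \<open>
  The roles of \<open>pq\<close> and \<open>rs\<close> are symmetric: the last conclusions say that \<open>v\<close> arises from \<open>w\<close> in
  the same way.
\<close>

lemma flip_triangulation:
  assumes v: "ideal_triangulation v"
    and T: "{p, q, r} \<in> triangles_of v" "{p, q, s} \<in> triangles_of v" "r \<noteq> s"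
    and w: "w = insert (geodesic r s) (v - {geodesic p q})"
  shows "ideal_triangulation w" "geodesic r s \<notin> v" "{r, s, p} \<in> triangles_of w" "{r, s, q} \<in> triangles_of w"
    "geodesic p q \<in> v" "v = insert (geodesic p q) (w - {geodesic r s})" "geodesic p q \<notin> w" "p \<noteq> q"
proof -
  have order: "ccw p q r \<and> ccw q p s \<or> ccw q p r \<and> ccw p q s"
    by (rule opposite_third_vertices[OF v T])
  note v' = ideal_triangulation_noncrossing[OF v]
  show w': "ideal_triangulation w"
    using order flip_triangulation_ccw[OF v, of p q r s w] flip_triangulation_ccw[OF v, of q p r s w] T w
    by (metis insert_commute open_segment_commute)
  have sides: "geodesic p q \<in> v" "geodesic q r \<in> v" "geodesic r p \<in> v" "geodesic q s \<in> v" "geodesic s p \<in> v"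
    and n: "norm p = 1" "norm q = 1" "norm r = 1" "norm s = 1" and ne: "p \<noteq> q" "q \<noteq> r" "p \<noteq> r" "q \<noteq> s" "p \<noteq> s"
    using T mem_triangles_of_iff[OF v] by auto
  show "geodesic p q \<in> v" "p \<noteq> q" by fact+
  show rs: "geodesic r s \<notin> v"
    using order crossing_not_in[OF v' sides(1)] crossing_not_in[OF v', of q p r s] sides by (metis open_segment_commute)
  have "geodesic p q \<noteq> geodesic r s" using rs sides(1) by metis
  then show "v = insert (geodesic p q) (w - {geodesic r s})" "geodesic p q \<notin> w"
    using rs sides unfolding w by auto
  show "{r, s, p} \<in> triangles_of w" "{r, s, q} \<in> triangles_of w"
    using sides n ne T(3) unfolding mem_triangles_of_iff[OF w'] unfolding w
    by (auto simp: geodesic_eq_iff doubleton_eq_iff open_segment_commute)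
qed

lemma flip_new_triangles:
  assumes v: "ideal_triangulation v"
    and T: "{p, q, r} \<in> triangles_of v" "{p, q, s} \<in> triangles_of v" "r \<noteq> s"
    and w: "w = insert (geodesic r s) (v - {geodesic p q})"
  shows "triangles_of w - triangles_of v \<subseteq> {{r, s, p}, {r, s, q}}"
proof
  note F = flip_triangulation[OF assms]
  have n: "norm p = 1" "norm q = 1" "norm r = 1" "norm s = 1" 
    using T mem_triangles_of_iff[OF v] by auto
  fix T0 assume T0: "T0 \<in> triangles_of w - triangles_of v"
  then obtain a b d where abd: "T0 = {a, b, d}" "ccw a b d" using triangles_of_ccwE by (metis DiffD1)
  note n' = ccw_on_circle[OF abd(2)] and ne = ccw_distinct[OF abd(2)]
  have "geodesic a b = geodesic r s \<or> geodesic b d = geodesic r s \<or> geodesic d a = geodesic r s"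
    using T0 unfolding abd(1) Diff_iff mem_triangles_of_iff[OF v] mem_triangles_of_iff[OF F(1)] unfolding w by blast
  then have "{a, b} = {r, s} \<or> {b, d} = {r, s} \<or> {d, a} = {r, s}"
    using n n' ne T(3) by (auto simp: geodesic_eq_iff)
  then obtain y where y: "T0 = {r, s, y}" using abd by (auto simp: doubleton_eq_iff insert_commute)
  then show "T0 \<in> {{r, s, p}, {r, s, q}}"
    using third_vertex_cases[OF F(1,3,4,8), of y] T0 by auto
qed

lemma vertex_triangulation: "v \<in> vertices \<Longrightarrow> ideal_triangulation v"
  by (simp add: vertices_def)

lemma vertex_noncrossing: "v \<in> vertices \<Longrightarrow> noncrossing v"
  by (rule ideal_triangulation_noncrossing[OF vertex_triangulation])

text \<open>A flip changes only the two triangles of the quadrilateral.\<close>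

lemma flip_vertex:
  assumes v: "v \<in> vertices"
    and T: "{p, q, r} \<in> triangles_of v" "{p, q, s} \<in> triangles_of v" "r \<noteq> s"
    and w: "w = insert (geodesic r s) (v - {geodesic p q})"
  shows "w \<in> vertices"
proof -
  note v' = vertex_triangulation[OF v]
  note F = flip_triangulation[OF v' T w]
  have 1: "finite (triangles_of w - triangles_of v)"
    by (rule finite_subset[OF flip_new_triangles[OF v' T w]]) simp
  have 2: "finite (triangles_of v - triangles_of w)"
    by (rule finite_subset[OF flip_new_triangles[OF F(1,3,4,8,6)]]) simp
  have "finite (triangles_of w - triangles_of base_triangulation)"
    by (rule finite_subset[of _ "(triangles_of w - triangles_of v) \<union> (triangles_of v - triangles_of base_triangulation)"])
      (use 1 v in \<open>auto simp: vertices_def\<close>)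
  moreover have "finite (triangles_of base_triangulation - triangles_of w)"
    by (rule finite_subset[of _ "(triangles_of v - triangles_of w) \<union> (triangles_of base_triangulation - triangles_of v)"])
      (use 2 v in \<open>auto simp: vertices_def\<close>)
  ultimately show ?thesis using F(1) by (simp add: vertices_def)
qed

lemma is_flipE:
  assumes v: "v \<in> vertices" and f: "is_flip v a w"
  obtains p q r s where "a = geodesic p q" "{p, q, r} \<in> triangles_of v" "{p, q, s} \<in> triangles_of v" "r \<noteq> s"
    "w = insert (geodesic r s) (v - {a})" "ccw p q r" "ccw q p s"
proof -
  from f obtain p q r s where h: "r \<noteq> s" "a = geodesic p q" "{p, q, r} \<in> triangles_of v" "{p, q, s} \<in> triangles_of v"
    "w = insert (geodesic r s) (v - {a})" unfolding is_flip_def by (elim conjE exE)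
  have h': "a = geodesic q p" "{q, p, r} \<in> triangles_of v" "{q, p, s} \<in> triangles_of v"
    using h by (auto simp: insert_commute open_segment_commute)
  consider "ccw p q r" "ccw q p s" | "ccw q p r" "ccw p q s"
    using opposite_third_vertices[OF vertex_triangulation[OF v] h(3,4,1)] by auto
  then show thesis
    using that[OF h(2,3,4,1,5)] that[OF h' h(1,5)] by cases
qed

lemma is_flipI:
  assumes "v \<in> vertices" "{p, q, r} \<in> triangles_of v" "{p, q, s} \<in> triangles_of v" "r \<noteq> s"
  shows "is_flip v (geodesic p q) (insert (geodesic r s) (v - {geodesic p q}))"
  unfolding is_flip_def
proof (intro conjI exI)
  show "p \<noteq> q" "geodesic p q \<in> v"
    using flip_triangulation(5,8)[OF vertex_triangulation[OF assms(1)] assms(2-4) refl] by auto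
qed (use assms in auto)

section \<open>Dyadic arcs\<close>

text \<open>
  The points \<open>k/2^n\<close> are indexed by all integers; this avoids a special treatment of the edge
  from \<open>(2^n - 1)/2^n\<close> to \<open>0\<close>.
\<close>

definition dpt :: "nat \<Rightarrow> int \<Rightarrow> complex" where
  "dpt n k = bdry (of_int k / 2 ^ n)"

lemma norm_dpt [simp]: "norm (dpt n k) = 1"
  by (simp add: dpt_def)

abbreviation dyadic_edge :: "nat \<Rightarrow> int \<Rightarrow> complex set" where
  "dyadic_edge n k \<equiv> geodesic (dpt n k) (dpt n (k + 1))"

lemma dpt_mod: "dpt n (k mod 2 ^ n) = dpt n k"
proof -
  have "of_int k / 2 ^ n = of_int (k mod 2 ^ n) / 2 ^ n + (of_int (k div 2 ^ n) :: real)"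
  proof -
    have "(of_int k :: real) = of_int (k mod 2 ^ n + 2 ^ n * (k div 2 ^ n))" by simp
    also have "\<dots> = of_int (k mod 2 ^ n) + 2 ^ n * of_int (k div 2 ^ n)" by (simp only: of_int_add of_int_mult of_int_power) simp
    finally show ?thesis by (simp add: field_simps)
  qed
  then show ?thesis by (simp add: bdry_add_int dpt_def)
qed

lemma dpt_mod_Suc: "dpt n (k mod 2 ^ n + 1) = dpt n (k + 1)"
  by (metis dpt_mod mod_add_left_eq)

lemma dpt_double: "dpt (Suc n) (2 * k) = dpt n k"
  by (simp add: dpt_def)

lemma dpt_in_dyadic: "dpt n k \<in> dyadic_points"
  by (auto simp: dyadic_points_def dpt_def)

text \<open>Indices can be reduced modulo \<open>2^n\<close>.\<close>

lemma base_triangulation_eq: "base_triangulation = {dyadic_edge n k | n k. 1 \<le> n}"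
proof (intro equalityI subsetI)
  fix x assume "x \<in> base_triangulation"
  then obtain a n where "1 \<le> n" "x = geodesic (bdry (real a / 2 ^ n)) (bdry (real (a + 1) / 2 ^ n))"
    by (auto simp: base_triangulation_def)
  then have "x = dyadic_edge n (int a)" by (simp add: dpt_def add.commute)
  then show "x \<in> {dyadic_edge n k | n k. 1 \<le> n}" using \<open>1 \<le> n\<close> by blast
next
  fix x assume "x \<in> {dyadic_edge n k | n k. 1 \<le> n}"
  then obtain n k where n: "1 \<le> n" and x: "x = dyadic_edge n k" by auto
  define a where "a = nat (k mod 2 ^ n)"
  have a: "int a = k mod 2 ^ n" by (simp add: a_def)
  have "int a < 2 ^ n" unfolding a by simp
  then have "a < 2 ^ n" by (metis of_nat_less_numeral_power_cancel_iff)
  then have "a \<le> 2 ^ n - 1" by simp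
  moreover have "x = geodesic (bdry (real a / 2 ^ n)) (bdry (real (a + 1) / 2 ^ n))"
  proof -
    have "real a = of_int (k mod 2 ^ n)" "real (a + 1) = of_int (k mod 2 ^ n + 1)" using a by linarith+
    then have "bdry (real a / 2 ^ n) = dpt n (k mod 2 ^ n)" "bdry (real (a + 1) / 2 ^ n) = dpt n (k mod 2 ^ n + 1)"
      unfolding dpt_def by (simp_all only:)
    then show ?thesis unfolding x by (simp only: dpt_mod dpt_mod_Suc)
  qed
  ultimately show "x \<in> base_triangulation" using n by (auto simp: base_triangulation_def)
qed

lemma area_bdry_nonneg:
  assumes "0 \<le> a" "a \<le> b" "b \<le> 1" "0 \<le> x" "x \<le> 1" "x \<le> a \<or> b \<le> x"
  shows "area (bdry a) (bdry b) (bdry x) \<ge> 0"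
proof -
  have s: "sin (pi * y) \<ge> 0" if "0 \<le> y" "y \<le> 1" for y
    using that by (intro sin_ge_zero) auto
  have m: "sin (pi * (x - b)) = - sin (pi * (b - x))" "sin (pi * (x - a)) = - sin (pi * (a - x))"
    by (metis minus_diff_eq mult_minus_right sin_minus)+
  show ?thesis
  proof (cases "b \<le> x")
    case True
    then show ?thesis unfolding area_bdry using s[of "b - a"] s[of "x - a"] s[of "x - b"] assms
      by simp
  next
    case False
    then have "area (bdry a) (bdry b) (bdry x) = 4 * sin (pi * (b - a)) * sin (pi * (b - x)) * sin (pi * (a - x))"
      unfolding area_bdry m by simp
    then show ?thesis using s[of "b - a"] s[of "b - x"] s[of "a - x"] assms False by simp
  qed
qed

lemma dyadic_unit: "0 \<le> k \<Longrightarrow> k \<le> 2 ^ n \<Longrightarrow> 0 \<le> (of_int k :: real) / 2 ^ n \<and> (of_int k :: real) / 2 ^ n \<le> 1"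
  by (simp add: field_simps)

lemma dpt_Suc_neq: "1 \<le> n \<Longrightarrow> dpt n k \<noteq> dpt n (k + 1)"
proof -
  assume n: "1 \<le> n"
  have "ccw (dpt n k) (bdry ((of_int k + 1/2) / 2 ^ n)) (dpt n (k + 1))"
  proof -
    have "(1::real) < 2 ^ n" using n by simp
    then have "of_int (k + 1) / 2 ^ n < of_int k / 2 ^ n + (1::real)" by (simp add: field_simps)
    moreover have "of_int k / 2 ^ n < (of_int k + 1/2) / (2 ^ n :: real)"
      "(of_int k + 1/2) / (2 ^ n :: real) < of_int (k + 1) / 2 ^ n" by (simp_all add: divide_strict_right_mono)
    ultimately show ?thesis unfolding ccw_def dpt_def by blast
  qed
  then show ?thesis using ccw_distinct by blast
qed

text \<open>The vertices of the polygon with sides \<open>I_k^n\<close>.\<close>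

definition dyadic_level :: "nat \<Rightarrow> complex set" where
  "dyadic_level n = range (dpt n)"

lemma dpt_on_level: "dpt n k \<in> dyadic_level n"
  by (simp add: dyadic_level_def)

text \<open>
  A point of level \<open>n\<close> is also a point of level \<open>m\<close>, and no point of level \<open>m\<close> lies strictly
  between two consecutive ones.
\<close>

lemma area_dyadic_edge_nonneg:
  assumes "n \<le> m" "p \<in> dyadic_level n"
  shows "area (dpt m i) (dpt m (i + 1)) p \<ge> 0"
proof -
  obtain k where "p = dpt n k" using assms(2) by (auto simp: dyadic_level_def)
  also have "dpt n k = dpt m (k * 2 ^ (m - n))"
  proof -
    have "(2::real) ^ m = 2 ^ (m - n) * 2 ^ n" using assms(1) by (simp flip: power_add)
    then show ?thesis by (simp add: dpt_def)
  qed
  also have "\<dots> = dpt m (k * 2 ^ (m - n) mod 2 ^ m)" by (simp only: dpt_mod)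
  finally have p: "p = dpt m (k * 2 ^ (m - n) mod 2 ^ m)" .
  define j where "j = k * 2 ^ (m - n) mod 2 ^ m"
  define i' where "i' = i mod 2 ^ m"
  have b: "0 \<le> j" "j + 1 \<le> 2 ^ m" "0 \<le> i'" "i' + 1 \<le> 2 ^ m"
    unfolding i'_def j_def by (simp_all add: zless_imp_add1_zle)
  have eq: "dpt m i = dpt m i'" "dpt m (i + 1) = dpt m (i' + 1)"
    unfolding i'_def by (simp_all only: dpt_mod dpt_mod_Suc)
  have le: "(of_int x :: real) / 2 ^ m \<le> of_int y / 2 ^ m \<longleftrightarrow> x \<le> y" for x y :: int
    by (simp add: divide_le_cancel)
  have u: "0 \<le> (of_int i' :: real) / 2 ^ m" "(of_int (i' + 1) :: real) / 2 ^ m \<le> 1" "0 \<le> (of_int j :: real) / 2 ^ m"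
    "(of_int j :: real) / 2 ^ m \<le> 1"
    using dyadic_unit[of i' m] dyadic_unit[of "i' + 1" m] dyadic_unit[of j m] b by auto
  have "of_int j / 2 ^ m \<le> (of_int i' :: real) / 2 ^ m \<or> (of_int (i' + 1) :: real) / 2 ^ m \<le> of_int j / 2 ^ m"
    unfolding le by linarith
  moreover have "(of_int i' :: real) / 2 ^ m \<le> of_int (i' + 1) / 2 ^ m" unfolding le by simp
  ultimately show ?thesis unfolding p j_def[symmetric] eq unfolding dpt_def
    using u by (intro area_bdry_nonneg)
qed

text \<open>
  Of two edges, the one of finer level has the end points of the other weakly on one side.
\<close>

lemma base_noncrossing: "noncrossing base_triangulation"
  unfolding noncrossing_def
proof
  show "base_triangulation \<subseteq> arcs"
  proof
    fix x assume "x \<in> base_triangulation"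
    then obtain n k where "1 \<le> n" "x = dyadic_edge n k" unfolding base_triangulation_eq by blast
    then show "x \<in> arcs" using dpt_in_dyadic[of n k] dpt_in_dyadic[of n "k + 1"] dpt_Suc_neq[of n k] unfolding arcs_def by blast
  qed
  have "dyadic_edge m j \<inter> dyadic_edge n k = {}"
    if "m \<le> n" "1 \<le> m" "dyadic_edge m j \<noteq> dyadic_edge n k" for m n j k
  proof -
    have "{dpt n k, dpt n (k + 1)} \<noteq> {dpt m j, dpt m (j + 1)}"
      using that(3) by (auto simp: doubleton_eq_iff open_segment_commute)
    moreover have "dpt m j \<noteq> dpt m (j + 1)" "dpt n k \<noteq> dpt n (k + 1)"
      using dpt_Suc_neq that by auto
    moreover have "area (dpt n k) (dpt n (k + 1)) (dpt m j) * area (dpt n k) (dpt n (k + 1)) (dpt m (j + 1)) \<ge> 0"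
      by (intro mult_nonneg_nonneg area_dyadic_edge_nonneg[OF that(1) dpt_on_level])
    ultimately show ?thesis
      using geodesics_meet_iff[of "dpt n k" "dpt n (k + 1)" "dpt m j" "dpt m (j + 1)"]
      by (simp add: not_less Int_commute)
  qed
  then have "disjnt (dyadic_edge m j) (dyadic_edge n k)"
    if "1 \<le> m" "1 \<le> n" "dyadic_edge m j \<noteq> dyadic_edge n k" for m n j k
    using that by (metis disjnt_def inf_commute linear)
  then show "pairwise disjnt base_triangulation"
    unfolding base_triangulation_eq pairwise_def by blast
qed

lemma ccw_dyadic_triangle:
  assumes "1 \<le> n"
  shows "ccw (dpt n k) (dpt (Suc n) (2 * k + 1)) (dpt n (k + 1))"
proof -
  have "(1::real) < 2 ^ n" using assms by simp
  then have "of_int (k + 1) / 2 ^ n < of_int k / 2 ^ n + (1::real)" by (simp add: field_simps)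
  moreover have "of_int k / 2 ^ n < of_int (2 * k + 1) / (2 ^ Suc n :: real)"
    "of_int (2 * k + 1) / (2 ^ Suc n :: real) < of_int (k + 1) / 2 ^ n" by (simp_all add: field_simps)
  ultimately show ?thesis unfolding ccw_def dpt_def by blast
qed

text \<open>The triangle of \<open>E\<close> just beyond the arc \<open>I_k^n\<close>.\<close>

definition dyadic_triangle :: "nat \<Rightarrow> int \<Rightarrow> complex set" where
  "dyadic_triangle n k = {dpt n k, dpt (Suc n) (2 * k + 1), dpt n (k + 1)}"

lemma dyadic_triangle_sides:
  fixes n :: nat and k :: int
  shows
  "geodesic (dpt n k) (dpt (Suc n) (2 * k + 1)) = dyadic_edge (Suc n) (2 * k)"
  "geodesic (dpt (Suc n) (2 * k + 1)) (dpt n (k + 1)) = dyadic_edge (Suc n) (2 * k + 1)"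
  "geodesic (dpt n (k + 1)) (dpt n k) = dyadic_edge n k"
proof -
  have "dpt n (k + 1) = dpt (Suc n) (2 * k + 1 + 1)" "dpt n k = dpt (Suc n) (2 * k)"
    using dpt_double[of n "k + 1"] dpt_double[of n k] by (simp_all add: algebra_simps)
  then show "geodesic (dpt n k) (dpt (Suc n) (2 * k + 1)) = dyadic_edge (Suc n) (2 * k)"
  "geodesic (dpt (Suc n) (2 * k + 1)) (dpt n (k + 1)) = dyadic_edge (Suc n) (2 * k + 1)"
    by (simp_all only:)
qed (rule open_segment_commute)

text \<open>In this form the agreement of a vertex with \<open>E\<close> outside a finite polygon is used.\<close>

definition has_dyadic_tail :: "nat \<Rightarrow> complex set set \<Rightarrow> bool" where
  "has_dyadic_tail n v \<longleftrightarrow> (\<forall>m\<ge>n. \<forall>k. dyadic_edge m k \<in> v)"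

lemma dyadic_triangle_in:
  assumes "noncrossing v" "has_dyadic_tail n v" "1 \<le> m" "n \<le> m"
  shows "dyadic_triangle m k \<in> triangles_of v"
  unfolding dyadic_triangle_def
  by (rule triangles_ofI[OF assms(1) ccw_dyadic_triangle[OF assms(3)]])
    (use assms in \<open>simp_all only: dyadic_triangle_sides has_dyadic_tail_def le_SucI\<close>)

lemma dist_bdry: "dist (bdry s) (bdry t) \<le> 2 * pi * \<bar>s - t\<bar>"
proof -
  have "dist (cis a) (cis b) \<le> \<bar>a - b\<bar>" for a b
  proof -
    have "(dist (cis a) (cis b))\<^sup>2 = 2 - 2 * cos (a - b)"
      using sin_cos_squared_add[of a] sin_cos_squared_add[of b]
      unfolding dist_norm cmod_power2 by (simp add: cos_diff power2_eq_square algebra_simps)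
    also have "\<dots> = 4 * (sin ((a - b) / 2))\<^sup>2"
    proof -
      have "2 * ((a - b) / 2) = a - b" by simp
      then have "cos (a - b) = 1 - 2 * (sin ((a - b) / 2))\<^sup>2" by (metis cos_double_sin)
      then show ?thesis by simp
    qed
    also have "\<dots> \<le> 4 * ((a - b) / 2)\<^sup>2"
      using abs_sin_x_le_abs_x[of "(a - b) / 2"] unfolding abs_le_square_iff by simp
    also have "\<dots> = \<bar>a - b\<bar>\<^sup>2" by (simp add: power2_eq_square)
    finally show ?thesis by (rule power2_le_imp_le) simp
  qed
  from this[of "2 * pi * s" "2 * pi * t"] show ?thesis
    by (simp add: bdry_def abs_mult flip: right_diff_distrib)
qed

text \<open>
  Only finitely many triangles of \<open>E\<close> are missing in \<open>v\<close>, and those of high level are not among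
  them because they are small.
\<close>

lemma vertex_has_dyadic_tail:
  assumes "v \<in> vertices"
  obtains n where "2 \<le> n" "has_dyadic_tail n v"
proof -
  let ?F = "triangles_of base_triangulation - triangles_of v"
  \<comment> \<open>The finitely many triangles of \<open>E\<close> that \<open>v\<close> lacks have a positive least distance between
    vertices, while a dyadic triangle of high level has two vertices that are closer than that.\<close>
  define D where "D = {dist p q | p q. p \<in> \<Union>?F \<and> q \<in> \<Union>?F \<and> p \<noteq> q}"
  have "finite ?F" using assms by (simp add: vertices_def)
  moreover have "finite T" if "T \<in> ?F" for T
    using that by (auto simp: triangles_of_def ideal_triangles_def intro: card_ge_0_finite)
  ultimately have fin: "finite (\<Union>?F)" by blast
  have "D \<subseteq> (\<lambda>(p, q). dist p q) ` (\<Union>?F \<times> \<Union>?F)" by (auto simp: D_def)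
  then have "finite D" using fin by (meson finite_SigmaI finite_imageI finite_subset)
  moreover have "\<forall>d\<in>D. d > 0" by (auto simp: D_def)
  ultimately have "0 < Min (insert 1 D)" "\<forall>d\<in>D. Min (insert 1 D) \<le> d" by auto
  then have "\<exists>e>0. \<forall>d\<in>D. e \<le> d" by blast
  then obtain e where e: "e > 0" "\<forall>d\<in>D. e \<le> d" by blast
  have "(\<lambda>n. 2 * pi * (1 / 2) ^ n) \<longlonglongrightarrow> 2 * pi * 0"
    by (intro tendsto_mult tendsto_const LIMSEQ_realpow_zero) auto
  then have "eventually (\<lambda>n. 2 * pi * (1 / 2) ^ n < e) sequentially"
    using e by (intro order_tendstoD(2)[of _ "2 * pi * 0"]) auto
  then obtain n where n: "\<And>m. m \<ge> n \<Longrightarrow> 2 * pi * (1 / 2) ^ m < e"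
    unfolding eventually_sequentially by blast
  have tail: "has_dyadic_tail 1 base_triangulation"
    unfolding has_dyadic_tail_def base_triangulation_eq by blast
  have "has_dyadic_tail (max 2 n) v"
    unfolding has_dyadic_tail_def
  proof (intro allI impI)
    fix m :: nat and k :: int assume m: "max 2 n \<le> m"
    have T: "dyadic_triangle m k \<in> triangles_of base_triangulation"
      using dyadic_triangle_in[OF base_noncrossing tail] m by simp
    have "dyadic_triangle m k \<in> triangles_of v"
    proof (rule ccontr)
      assume "\<not> ?thesis"
      then have "dyadic_triangle m k \<in> ?F" using T by blast
      moreover have "dpt m k \<in> dyadic_triangle m k" "dpt m (k + 1) \<in> dyadic_triangle m k"
        by (simp_all add: dyadic_triangle_def)
      moreover have "dpt m k \<noteq> dpt m (k + 1)" using m dpt_Suc_neq[of m k] by simp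
      ultimately have "dist (dpt m k) (dpt m (k + 1)) \<in> D" unfolding D_def by blast
      then have "e \<le> dist (dpt m k) (dpt m (k + 1))" using e by blast
      also have "\<dots> \<le> 2 * pi * (1 / 2) ^ m"
        using dist_bdry[of "of_int k / 2 ^ m" "of_int (k + 1) / 2 ^ m"]
        by (simp add: dpt_def power_one_over flip: diff_divide_distrib)
      also have "\<dots> < e" using n m by simp
      finally show False by simp
    qed
    then have "geodesic (dpt m (k + 1)) (dpt m k) \<in> v"
      using mem_triangles_of_iff[OF vertex_triangulation[OF assms]] unfolding dyadic_triangle_def by blast
    then show "dyadic_edge m k \<in> v" by (simp only: open_segment_commute)
  qed
  then show ?thesis using that[of "max 2 n"] by simp
qed

section \<open>Local finiteness\<close>

text \<open>
  The chord between two points at angular distance \<open>2 d\<close> has distance \<open>cos d\<close> from the centre.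
\<close>

lemma cap_norm:
  assumes "area (dpt m k) (dpt m (k + 1)) z \<le> 0" "1 \<le> m"
  shows "cos (pi / 2 ^ m) \<le> norm z"
proof -
  define d where "d = pi / 2 ^ m"
  define t where "t = 2 * pi * of_int k / 2 ^ m + d"
  have p: "dpt m k = cis (t - d)" "dpt m (k + 1) = cis (t + d)"
    by (simp_all add: dpt_def bdry_def t_def d_def field_simps)
  have "sin t * sin t = 1 - cos t * cos t"
    using sin_cos_squared_add[of t] by (simp add: power2_eq_square)
  then have "area (dpt m k) (dpt m (k + 1)) z = 2 * sin d * (cos d - (Im z * sin t + Re z * cos t))"
  proof -
    let ?c = "cos t" and ?s = "sin t" and ?C = "cos d" and ?S = "sin d"
    have "area (dpt m k) (dpt m (k + 1)) z = 2 * ?S * (?C * (?s * ?s + ?c * ?c) - (Im z * ?s + Re z * ?c))"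
    proof -
      have "(c * C - s * S - (c * C + s * S)) * (y - (s * C - c * S)) - ((s * C + c * S) - (s * C - c * S)) * (x - (c * C + s * S))
          = 2 * S * (C * (s * s + c * c) - (y * s + x * c))" for c s C S x y :: real
        by (simp add: algebra_simps)
      then show ?thesis
        unfolding p area_eq cis.sel cos_add cos_diff sin_add sin_diff .
    qed
    moreover have "?s * ?s + ?c * ?c = 1" using \<open>?s * ?s = _\<close> by simp
    ultimately show ?thesis by (simp only:) simp
  qed
  moreover have "sin d > 0"
  proof (rule sin_gt_zero)
    have "(1::real) < 2 ^ m" using assms(2) by simp
    then show "d < pi" by (simp add: d_def divide_less_eq)
  qed (simp add: d_def)
  ultimately have "cos d \<le> Im z * sin t + Re z * cos t"
    using assms(1) by (simp add: mult_le_0_iff)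
  also have "\<dots> \<le> norm z" by (rule Re_Im_le_cmod)
  finally show ?thesis by (simp add: d_def)
qed

lemma cos_pi_power_tendsto: "(\<lambda>n. cos (pi / 2 ^ n)) \<longlonglongrightarrow> 1"
proof -
  have "(\<lambda>n. pi * (1 / 2) ^ n) \<longlonglongrightarrow> pi * 0"
    by (intro tendsto_mult tendsto_const LIMSEQ_realpow_zero) auto
  then have "(\<lambda>n. cos (pi * (1 / 2) ^ n)) \<longlonglongrightarrow> cos (pi * 0)"
    by (rule tendsto_cos)
  moreover have "pi * (1 / 2) ^ n = pi / 2 ^ n" for n by (simp add: power_divide)
  ultimately show ?thesis by simp
qed

text \<open>
  In the cap cut off by a dyadic edge, a point is in the adjacent triangle, on one of its two
  other sides, or in one of the two smaller caps beyond them. The caps of level \<open>n\<close> move to the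
  circle as \<open>n\<close> grows, so the last case cannot repeat for ever.
\<close>

lemma cap_covered:
  assumes "norm z < 1" "1 \<le> m" "area (dpt m k) (dpt m (k + 1)) z < 0"
  shows "\<exists>n\<ge>m. \<exists>j. z \<in> dyadic_edge n j \<or> z \<in> triangle_region (dyadic_triangle n j)"
proof -
  have "eventually (\<lambda>n. norm z < cos (pi / 2 ^ n)) sequentially"
    using assms(1) by (intro order_tendstoD(1)[OF cos_pi_power_tendsto]) simp
  then obtain N where N: "\<And>n. n \<ge> N \<Longrightarrow> norm z < cos (pi / 2 ^ n)"
    unfolding eventually_sequentially by blast
  \<comment> \<open>Caps of level \<open>N\<close> and beyond miss \<open>z\<close>, so the descent into smaller caps stops before level \<open>N\<close>.\<close>
  show ?thesis using assms(2,3)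
  proof (induction "N - m" arbitrary: m k)
    case 0
    then show ?case using N[of m] cap_norm[of m k z] by auto
  next
    case (Suc d)
    let ?p = "dpt m k" and ?c = "dpt (Suc m) (2 * k + 1)" and ?q = "dpt m (k + 1)"
    have p: "?p = dpt (Suc m) (2 * k)" "?q = dpt (Suc m) (2 * k + 1 + 1)"
      using dpt_double[of m "k + 1"] dpt_double[of m k] by (simp_all add: algebra_simps)
    have IH: "\<exists>n\<ge>m. \<exists>j. z \<in> dyadic_edge n j \<or> z \<in> triangle_region (dyadic_triangle n j)"
      if "area (dpt (Suc m) i) (dpt (Suc m) (i + 1)) z \<le> 0" for i
    proof (cases "area (dpt (Suc m) i) (dpt (Suc m) (i + 1)) z = 0")
      case True
      then have "z \<in> dyadic_edge (Suc m) i"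
        using dpt_Suc_neq[of "Suc m" i] assms(1) by (subst mem_geodesic_iff) auto
      then show ?thesis by (intro exI[of _ "Suc m"] conjI exI[of _ i]) auto
    next
      case False
      then have "area (dpt (Suc m) i) (dpt (Suc m) (i + 1)) z < 0" using that by simp
      then have "\<exists>n\<ge>Suc m. \<exists>j. z \<in> dyadic_edge n j \<or> z \<in> triangle_region (dyadic_triangle n j)"
        using Suc(2) by (intro Suc(1)) auto
      then show ?thesis using Suc_leD by blast
    qed
    show ?case
    proof (cases "area ?p ?c z > 0 \<and> area ?c ?q z > 0")
      case True
      moreover have "area ?q ?p z > 0" using Suc(4) area_swap[of ?q ?p z] by simp
      ultimately have "z \<in> triangle_region (dyadic_triangle m k)"
        unfolding dyadic_triangle_def mem_triangle_region_iff[OF ccw_dyadic_triangle[OF Suc(3)]] by blast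
      then show ?thesis by blast
    next
      case False
      then show ?thesis using IH[of "2 * k"] IH[of "2 * k + 1"] unfolding p by (meson not_le)
    qed
  qed
qed

lemma finite_dyadic_level: "finite (dyadic_level n)"
proof -
  have "dyadic_level n = dpt n ` {0..<2 ^ n}"
  proof -
    have "dpt n k \<in> dpt n ` {0..<2 ^ n}" for k
      by (rule image_eqI[of _ _ "k mod 2 ^ n"]) (simp_all add: dpt_mod)
    then show ?thesis unfolding dyadic_level_def by blast
  qed
  then show ?thesis by simp
qed

lemma outside_dyadic_level:
  assumes "norm p = 1" "p \<notin> dyadic_level n" "1 \<le> n"
  obtains k where "0 \<le> k" "k < 2 ^ n" "of_int k / 2 ^ n < pos p" "pos p < of_int (k + 1) / 2 ^ n"
    "area (dpt n k) (dpt n (k + 1)) p < 0"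
proof -
  define k where "k = \<lfloor>pos p * 2 ^ n\<rfloor>"
  have "of_int k / 2 ^ n \<noteq> pos p"
    using assms bdry_pos[of p] unfolding dyadic_level_def dpt_def by (metis rangeI)
  moreover have "of_int k \<le> pos p * 2 ^ n" "pos p * 2 ^ n < of_int (k + 1)"
    using floor_correct[of "pos p * 2 ^ n"] unfolding k_def by auto
  then have "of_int k / 2 ^ n \<le> pos p" "pos p < of_int (k + 1) / 2 ^ n" by (simp_all add: field_simps)
  ultimately have k1: "of_int k / 2 ^ n < pos p" "pos p < of_int (k + 1) / 2 ^ n" by simp_all
  have "pos p * 2 ^ n < 1 * 2 ^ n" by (rule mult_strict_right_mono) (use pos_range in auto)
  then have k2: "0 \<le> k" "k < 2 ^ n"
    unfolding k_def using pos_range[of p] by (simp_all add: floor_less_iff)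
  have "(1::real) < 2 ^ n" using assms(3) by simp
  then have "of_int (k + 1) / 2 ^ n < of_int k / 2 ^ n + (1::real)" by (simp add: field_simps)
  then have "ccw (dpt n k) p (dpt n (k + 1))"
    unfolding ccw_def dpt_def using k1 bdry_pos[OF assms(1)] by metis
  then have "area (dpt n k) (dpt n (k + 1)) p < 0"
    using ccw_imp_area ccw_rot area_swap by (metis neg_0_less_iff_less)
  then show ?thesis using that k1 k2 by blast
qed

lemma mem_noncrossing_eq:
  assumes "noncrossing v" "a \<in> v" "b \<in> v" "z \<in> a" "z \<in> b"
  shows "a = b"
  using assms unfolding noncrossing_def pairwise_def disjnt_def by blast

lemma has_dyadic_tail_mono: "n \<le> m \<Longrightarrow> has_dyadic_tail n v \<Longrightarrow> has_dyadic_tail m v"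
  by (simp add: has_dyadic_tail_def)

text \<open>
  An arc with an end point beyond a side of the polygon of level \<open>n\<close> stays in the cap cut off by
  this side, which is already triangulated by dyadic edges.
\<close>

lemma tail_classification:
  assumes v: "noncrossing v" and n: "has_dyadic_tail n v" "1 \<le> n" and g: "g \<in> v"
  shows "(\<exists>m\<ge>n. \<exists>k. g = dyadic_edge m k) \<or>
    (\<exists>p\<in>dyadic_level n. \<exists>q\<in>dyadic_level n. g = geodesic p q)"
proof -
  have "g \<in> arcs" using v g by (auto simp: noncrossing_def)
  then obtain a b where ab: "g = geodesic a b" "a \<noteq> b" "norm a = 1" "norm b = 1" by (rule arcsE)
  have out: "\<exists>m\<ge>n. \<exists>k. g = dyadic_edge m k"
    if g': "g = geodesic p q" "norm p = 1" "norm q = 1" "p \<noteq> q" "p \<notin> dyadic_level n" for p q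
  proof -
    obtain k where k: "area (dpt n k) (dpt n (k + 1)) p < 0"
      using outside_dyadic_level[OF g'(2,5) n(2)] by blast
    have "dyadic_edge n k \<in> v" using n by (simp add: has_dyadic_tail_def)
    then have "area (dpt n k) (dpt n (k + 1)) p * area (dpt n k) (dpt n (k + 1)) q \<ge> 0"
      using noncrossing_area[OF v, of _ _ p q] g g' by simp
    then have q: "area (dpt n k) (dpt n (k + 1)) q \<le> 0" using k by (auto simp: zero_le_mult_iff)
    obtain z where z: "z \<in> g" using g' by fastforce
    then obtain t where t: "0 < t" "t < 1" "z = (1 - t) *\<^sub>R p + t *\<^sub>R q" using g' by (auto simp: in_segment)
    have "(1 - t) * area (dpt n k) (dpt n (k + 1)) p < 0" "t * area (dpt n k) (dpt n (k + 1)) q \<le> 0"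
      using t k q by (auto simp: mult_pos_neg mult_nonneg_nonpos)
    then have "area (dpt n k) (dpt n (k + 1)) z < 0" using t by (simp add: area_affine)
    moreover have "norm z < 1" using z g' norm_less_one_geodesic by blast
    ultimately obtain m j where m: "m \<ge> n" and mj: "z \<in> dyadic_edge m j \<or> z \<in> triangle_region (dyadic_triangle m j)"
      using cap_covered n(2) by blast
    have "dyadic_triangle m j \<in> triangles_of v" using dyadic_triangle_in[OF v n(1)] m n(2) by simp
    then have "z \<in> dyadic_edge m j"
      using mj z g triangles_of_region_disjoint by blast
    moreover have "dyadic_edge m j \<in> v" using m n by (simp add: has_dyadic_tail_def)
    ultimately show ?thesis using mem_noncrossing_eq[OF v g _ z] m by blast
  qed
  show ?thesis
  proof (cases "a \<in> dyadic_level n \<and> b \<in> dyadic_level n")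
    case False
    then show ?thesis using out[of a b] out[of b a] ab by (auto simp: open_segment_commute)
  qed (use ab in blast)
qed

text \<open>
  By \<open>tail_classification\<close>, all but finitely many arcs are dyadic edges of high level, and these
  are close to the circle.
\<close>

lemma locally_finite:
  assumes v: "v \<in> vertices" and r: "r < 1"
  shows "finite {g \<in> v. g \<inter> cball 0 r \<noteq> {}}"
proof -
  note v' = vertex_noncrossing[OF v]
  obtain n where n: "2 \<le> n" "has_dyadic_tail n v" using vertex_has_dyadic_tail[OF v] .
  have "eventually (\<lambda>m. r < cos (pi / 2 ^ m)) sequentially"
    using r by (intro order_tendstoD(1)[OF cos_pi_power_tendsto])
  then obtain N where N: "\<And>m. m \<ge> N \<Longrightarrow> r < cos (pi / 2 ^ m)" unfolding eventually_sequentially by blast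
  \<comment> \<open>Dyadic edges of level \<open>m\<close> and beyond stay outside the closed disc of radius \<open>r\<close>.\<close>
  define m where "m = max n N"
  have m: "has_dyadic_tail m v" "1 \<le> m" using has_dyadic_tail_mono[OF _ n(2)] n(1) by (auto simp: m_def)
  have "{g \<in> v. g \<inter> cball 0 r \<noteq> {}} \<subseteq> (\<lambda>(p, q). geodesic p q) ` (dyadic_level m \<times> dyadic_level m)"
  proof
    fix g assume g: "g \<in> {g \<in> v. g \<inter> cball 0 r \<noteq> {}}"
    then obtain z where z: "z \<in> g" "norm z \<le> r" by auto
    have "g \<noteq> dyadic_edge l k" if "l \<ge> m" for l k
    proof
      assume "g = dyadic_edge l k"
      then have "area (dpt l k) (dpt l (k + 1)) z = 0"
        using z mem_geodesic_iff[of "dpt l k" "dpt l (k + 1)" z] dpt_Suc_neq[of l k] that m by simp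
      then have "cos (pi / 2 ^ l) \<le> norm z" using cap_norm[of l k z] that m by simp
      moreover have "r < cos (pi / 2 ^ l)" using N that by (simp add: m_def)
      ultimately show False using z by simp
    qed
    then obtain p q where "p \<in> dyadic_level m" "q \<in> dyadic_level m" "g = geodesic p q"
      using tail_classification[OF v' m, of g] g by blast
    then show "g \<in> (\<lambda>(p, q). geodesic p q) ` (dyadic_level m \<times> dyadic_level m)" by auto
  qed
  then show ?thesis using finite_dyadic_level by (meson finite_SigmaI finite_imageI finite_subset)
qed

text \<open>
  Only finitely many arcs come near \<open>z\<close>, and all of them but \<open>a\<close> have a positive distance from
  it.
\<close>

lemma isolated_on_arc:
  assumes v: "v \<in> vertices" and a: "a \<in> v" "z \<in> a"
  obtains e where "e > 0" "ball z e \<subseteq> hyp_disc" "ball z e \<inter> \<Union>v \<subseteq> a"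
proof -
  note v' = vertex_noncrossing[OF v]
  have a': "a \<in> arcs" using v' a by (auto simp: noncrossing_def)
  have z1: "norm z < 1" using arcs_subset_disc[OF a'] a by auto
  define r where "r = (1 + norm z) / 2"
  have r: "norm z < r" "r < 1" using z1 by (auto simp: r_def)
  let ?F = "{g \<in> v. g \<inter> cball 0 r \<noteq> {}} - {a}"
  have fin: "finite ?F" using locally_finite[OF v r(2)] by simp
  have "z \<notin> closure g" if "g \<in> ?F" for g
  proof
    assume zc: "z \<in> closure g"
    have "g \<in> arcs" using that v' by (auto simp: noncrossing_def)
    then obtain p q where pq: "g = geodesic p q" "p \<noteq> q" "norm p = 1" "norm q = 1" by (rule arcsE)
    then have "z \<in> g" using zc z1 by (auto simp: closed_segment_eq_open)
    then show False using that mem_noncrossing_eq[OF v' a(1) _ a(2)] by blast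
  qed
  moreover have "closed (\<Union>g\<in>?F. closure g)" using fin by (intro closed_UN) auto
  ultimately have "open (ball 0 r - (\<Union>g\<in>?F. closure g))" "z \<in> ball 0 r - (\<Union>g\<in>?F. closure g)"
    using r by (auto intro: open_Diff)
  then obtain e where e: "e > 0" "ball z e \<subseteq> ball 0 r - (\<Union>g\<in>?F. closure g)"
    by (meson open_contains_ball)
  have "ball z e \<inter> \<Union>v \<subseteq> a"
  proof
    fix y assume y: "y \<in> ball z e \<inter> \<Union>v"
    then obtain g where g: "g \<in> v" "y \<in> g" by auto
    have yr: "y \<in> ball 0 r - (\<Union>g\<in>?F. closure g)" using e(2) y by blast
    have "g = a"
    proof (rule ccontr)
      assume "g \<noteq> a"
      moreover have "y \<in> cball 0 r" using yr by simp
      ultimately have "g \<in> ?F" using g by blast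
      moreover have "y \<in> closure g" using g(2) closure_subset by blast
      ultimately show False using yr by blast
    qed
    then show "y \<in> a" using g by simp
  qed
  moreover have "ball z e \<subseteq> hyp_disc" using e(2) r(2) by auto
  ultimately show ?thesis using that e(1) by blast
qed

lemma closure_region_cases:
  assumes T: "T \<in> triangles_of v" and z: "z \<in> closure (triangle_region T)" "norm z < 1"
  obtains (inner) "z \<in> triangle_region T" | (side) p q r where "T = {p, q, r}" "ccw p q r" "z \<in> geodesic p q"
proof -
  obtain p q r where pqr: "T = {p, q, r}" "ccw p q r" using T by (rule triangles_of_ccwE)
  note ge = area_nonneg_closure_triangle_region[OF pqr(2) z(1)[unfolded pqr(1)]]
  note n = ccw_on_circle[OF pqr(2)] and ne = ccw_distinct[OF pqr(2)]
  have rot: "T = {q, r, p}" "T = {r, p, q}" "ccw q r p" "ccw r p q" using pqr ccw_rot by auto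
  show thesis
  proof (cases "area p q z = 0 \<or> area q r z = 0 \<or> area r p z = 0")
    case True
    then have "z \<in> geodesic p q \<or> z \<in> geodesic q r \<or> z \<in> geodesic r p"
      using n ne z(2) mem_geodesic_iff[of p q z] mem_geodesic_iff[of q r z] mem_geodesic_iff[of r p z] by blast
    then show thesis using side[OF pqr] side[OF rot(1,3)] side[OF rot(2,4)] by blast
  next
    case False
    then show thesis using ge inner unfolding pqr(1) mem_triangle_region_iff[OF pqr(2)] by simp
  qed
qed

section \<open>Connectedness of the dual graph\<close>

text \<open>
  Near \<open>z\<close> there is no arc but \<open>pq\<close>, so a half disc to the left of \<open>pq\<close> lies in one component.
  This component is a triangle with \<open>z\<close> in its boundary, and its side through \<open>z\<close> can only be
  \<open>pq\<close>.
\<close>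

lemma half_ball_in_triangle:
  assumes v: "v \<in> vertices" and a: "geodesic p q \<in> v" "norm p = 1" "norm q = 1" and z: "z \<in> geodesic p q"
  obtains r e where "ccw p q r" "{p, q, r} \<in> triangles_of v" "e > 0"
    "ball z e \<subseteq> hyp_disc" "\<And>y. y \<in> ball z e \<Longrightarrow> area p q y > 0 \<Longrightarrow> y \<in> triangle_region {p, q, r}"
proof -
  note vt = vertex_triangulation[OF v]
  note v' = vertex_noncrossing[OF v]
  have ne: "p \<noteq> q" using a v' geodesic_in_arcsD(3) by (auto simp: noncrossing_def)
  have z0: "norm z < 1" "area p q z = 0" using mem_geodesic_iff[OF a(2,3) ne] z by auto
  obtain e where e: "e > 0" "ball z e \<subseteq> hyp_disc" "ball z e \<inter> \<Union>v \<subseteq> geodesic p q"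
    using isolated_on_arc[OF v a(1) z] .
  define H where "H = {y \<in> ball z e. area p q y > 0}"
  have "convex {y. area p q y > 0}"
  proof (rule convexI)
    fix x y :: complex and s t :: real
    assume h: "x \<in> {y. area p q y > 0}" "y \<in> {y. area p q y > 0}" "0 \<le> s" "0 \<le> t" "s + t = 1"
    then have "s = 1 - t" by simp
    moreover have "s * area p q x + t * area p q y > 0"
      using h by (cases "s = 0") (auto intro: add_pos_nonneg)
    ultimately show "s *\<^sub>R x + t *\<^sub>R y \<in> {y. area p q y > 0}" by (simp add: area_affine)
  qed
  moreover have "H = ball z e \<inter> {y. area p q y > 0}" by (auto simp: H_def)
  ultimately have "convex H" using convex_Int[OF convex_ball] by metis
  then have conn: "connected H" by (rule convex_connected)
  \<comment> \<open>The path \<open>f\<close> leaves \<open>z\<close> orthogonally to the arc, towards its left side.\<close>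
  define f where "f s = z + of_real s * (\<i> * (q - p))" for s :: real
  have fa: "area p q (f s) = s * (norm (q - p))\<^sup>2" for s
    using z0(2) unfolding f_def area_eq cmod_power2 by (simp add: power2_eq_square algebra_simps)
  have fz: "(f \<longlongrightarrow> z) (at_right 0)"
    unfolding f_def by (rule tendsto_eq_intros refl | simp)+
  have "eventually (\<lambda>s. f s \<in> ball z e) (at_right 0)"
    using fz e(1) by (intro topological_tendstoD) auto
  moreover have "eventually (\<lambda>s::real. 0 < s) (at_right 0)" by (rule eventually_at_right_less)
  ultimately have fH: "eventually (\<lambda>s. f s \<in> H) (at_right 0)"
    by eventually_elim (use ne in \<open>simp add: H_def fa\<close>)
  then have zH: "z \<in> closure H"
    using fz by (intro Lim_in_closed_set[of "closure H" f "at_right 0"])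
      (auto elim: eventually_mono intro: closure_subset[THEN subsetD])
  have HX: "H \<subseteq> hyp_disc - \<Union>v"
    using e mem_geodesic_iff[OF a(2,3) ne] unfolding H_def by fastforce
  obtain y0 where y0: "y0 \<in> H" using zH by (metis closure_empty empty_iff equals0I)
  then obtain T where T: "T \<in> triangles_of v" "y0 \<in> triangle_region T"
  proof -
    have "norm y0 < 1" "y0 \<notin> \<Union>v" using HX y0 by auto
    then show ?thesis using ideal_triangulationD[OF vt] that by blast
  qed
  have HT: "H \<subseteq> triangle_region T"
    using components_maximal[OF _ conn HX] T y0 unfolding triangles_of_def by blast
  then have zT: "z \<in> closure (triangle_region T)" using zH closure_mono by blast
  show ?thesis using T(1) zT z0(1)
  proof (cases rule: closure_region_cases)
    case inner
    then show ?thesis using triangles_of_region_disjoint[OF T(1)] a(1) z by blast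
  next
    case (side p' q' r')
    note n' = ccw_on_circle[OF side(2)]
    have "geodesic p' q' \<in> v" using T(1) mem_triangles_of_iff[OF vt] unfolding side(1) by blast
    then have "geodesic p' q' = geodesic p q" using mem_noncrossing_eq[OF v' _ a(1) side(3) z] by blast
    then have "{p', q'} = {p, q}" using geodesic_eq_iff[of p' q' p q] n' ccw_distinct[OF side(2)] a ne by blast
    then consider "p' = p" "q' = q" | "p' = q" "q' = p" by (auto simp: doubleton_eq_iff)
    then show ?thesis
    proof cases
      case 1
      then show ?thesis using that[of r' e] side T HT e unfolding H_def by blast
    next
      case 2
      then have "area q p y0 > 0" using T(2) mem_triangle_region_iff[OF side(2)] side(1) by simp
      moreover have "area p q y0 > 0" using y0 by (simp add: H_def)
      ultimately show ?thesis using area_swap[of q p y0] by simp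
    qed
  qed
qed

lemma triangle_on_left:
  assumes v: "v \<in> vertices" and a: "geodesic p q \<in> v" "norm p = 1" "norm q = 1"
  obtains r where "ccw p q r" "{p, q, r} \<in> triangles_of v"
proof -
  have "p \<noteq> q" using a vertex_noncrossing[OF v] geodesic_in_arcsD(3)
    by (auto simp: noncrossing_def)
  then obtain z where "z \<in> geodesic p q" by fastforce
  then show ?thesis using half_ball_in_triangle[OF assms] that by metis
qed

text \<open>
  By \<open>step\<close>, in both directions, \<open>P\<close> agrees on adjacent triangles. The triangles with \<open>P\<close>,
  together with their sides, form an open subset of the disc by \<open>half_ball_in_triangle\<close>, and so
  do the triangles without \<open>P\<close>. These two sets are disjoint and cover the disc, which is
  connected.
\<close>

lemma dual_graph_connected:
  assumes v: "v \<in> vertices"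
    and step: "\<And>p q r s. ccw p q r \<Longrightarrow> ccw q p s \<Longrightarrow> {p, q, r} \<in> triangles_of v \<Longrightarrow> {q, p, s} \<in> triangles_of v \<Longrightarrow>
      P {p, q, r} \<Longrightarrow> P {q, p, s}"
    and T0: "T0 \<in> triangles_of v" "P T0"
    and T1: "T1 \<in> triangles_of v"
  shows "P T1"
proof -
  note vt = vertex_triangulation[OF v]
  note v' = vertex_noncrossing[OF v]
  \<comment> \<open>The two classes of triangles, each with its sides, as subsets of the open disc.\<close>
  define U where "U b = {z \<in> hyp_disc. \<exists>T\<in>triangles_of v. P T = b \<and> z \<in> closure (triangle_region T)}" for b
  have step': "P {p, q, r} = P {q, p, s}"
    if "ccw p q r" "ccw q p s" "{p, q, r} \<in> triangles_of v" "{q, p, s} \<in> triangles_of v" for p q r s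
    using step[OF that] step[OF that(2,1,4,3)] by blast
  have side_v: "geodesic p q \<in> v" if "{p, q, r} \<in> triangles_of v" for p q r
    using that mem_triangles_of_iff[OF vt] by blast
  have op: "open (U b)" for b
    unfolding open_contains_ball
  proof
    fix z assume "z \<in> U b"
    then obtain T where T: "T \<in> triangles_of v" "P T = b" "z \<in> closure (triangle_region T)" and z: "norm z < 1"
      by (auto simp: U_def)
    show "\<exists>e>0. ball z e \<subseteq> U b"
      using T(1,3) z
    proof (cases rule: closure_region_cases)
      case inner
      then have "z \<in> triangle_region T \<inter> hyp_disc" using z by simp
      then obtain e where "e > 0" "ball z e \<subseteq> triangle_region T \<inter> hyp_disc"
        using open_triangle_region open_ball open_Int open_contains_ball by metis
      moreover have "triangle_region T \<inter> hyp_disc \<subseteq> U b" using T closure_subset[of "triangle_region T"] by (auto simp: U_def)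
      ultimately show ?thesis by blast
    next
      case (side p q r)
      note n = ccw_on_circle[OF side(2)]
      have pq: "geodesic p q \<in> v" "geodesic q p \<in> v" using side_v T(1) side(1) by (auto simp: open_segment_commute)
      obtain r' e1 where 1: "ccw p q r'" "{p, q, r'} \<in> triangles_of v" "e1 > 0" "ball z e1 \<subseteq> hyp_disc"
        and left: "\<And>y. y \<in> ball z e1 \<Longrightarrow> area p q y > 0 \<Longrightarrow> y \<in> triangle_region {p, q, r'}"
        using half_ball_in_triangle[OF v pq(1) _ _ side(3)] n by metis
      obtain s e2 where 2: "ccw q p s" "{q, p, s} \<in> triangles_of v" "e2 > 0" "ball z e2 \<subseteq> hyp_disc"
        and right: "\<And>y. y \<in> ball z e2 \<Longrightarrow> area q p y > 0 \<Longrightarrow> y \<in> triangle_region {q, p, s}"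
        using half_ball_in_triangle[OF v pq(2), of z] n side(3) by (metis open_segment_commute)
      have "r' = r" using third_vertex_unique[OF vt] 1 side T by blast
      then have T': "{p, q, r'} = T" using side by simp
      have P2: "P {q, p, s} = b" using step'[OF 1(1) 2(1) 1(2) 2(2)] T T' by simp
      have "ball z (min e1 e2) \<subseteq> U b"
      proof
        fix y assume y: "y \<in> ball z (min e1 e2)"
        then have yd: "y \<in> hyp_disc" using 1(4) by auto
        consider "area p q y > 0" | "area q p y > 0" | "area p q y = 0"
          using area_swap[of p q y] by linarith
        then show "y \<in> U b"
        proof cases
          case 1
          then have "y \<in> triangle_region T" using left[of y] y T' by simp
          then show ?thesis using T yd closure_subset by (auto simp: U_def)
        next
          case 2
          then have "y \<in> triangle_region {q, p, s}" using right[of y] y by simp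
          then show ?thesis using \<open>{q, p, s} \<in> _\<close> P2 yd closure_subset unfolding U_def by blast
        next
          case 3
          then have "y \<in> geodesic p q" using yd n ccw_distinct[OF side(2)] mem_geodesic_iff[of p q y] by auto
          then have "y \<in> convex hull {p, q}" by (auto simp: segment_convex_hull open_segment_def)
          moreover have "convex hull {p, q} \<subseteq> convex hull {p, q, r}" by (rule hull_mono) auto
          ultimately have "y \<in> closure (triangle_region T)" unfolding side(1) closure_triangle_region[OF side(2)] by blast
          then show ?thesis using T yd by (auto simp: U_def)
        qed
      qed
      then show ?thesis using 1(3) 2(3) by (intro exI[of _ "min e1 e2"]) simp
    qed
  qed
  have same: "P T = P T'" if TT: "T \<in> triangles_of v" "T' \<in> triangles_of v"
    "z \<in> closure (triangle_region T)" "z \<in> closure (triangle_region T')" "norm z < 1" for T T' z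
  proof -
    have meet: "A = B" if "A \<in> triangles_of v" "B \<in> triangles_of v" "z \<in> triangle_region A" "z \<in> closure (triangle_region B)" for A B
    proof -
      have "triangle_region A \<inter> closure (triangle_region B) \<noteq> {}" using that by blast
      then have "triangle_region A \<inter> triangle_region B \<noteq> {}"
        using open_Int_closure_eq_empty[OF open_triangle_region] by metis
      then show ?thesis by (rule triangles_of_regions_meet[OF that(1,2)])
    qed
    show ?thesis using TT(1,3,5)
    proof (cases rule: closure_region_cases)
      case inner
      then show ?thesis using meet TT by blast
    next
      case (side p q r)
      note side1 = side
      show ?thesis using TT(2,4,5)
      proof (cases rule: closure_region_cases)
        case inner
        then show ?thesis using meet TT by metis
      next
        case (side p' q' r')
        have "geodesic p q = geodesic p' q'"
          using mem_noncrossing_eq[OF v' side_v side_v] TT side side1 by metis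
        then have "{p, q} = {p', q'}"
          using geodesic_eq_iff ccw_on_circle[OF side(2)] ccw_on_circle[OF side1(2)] ccw_distinct[OF side(2)] ccw_distinct[OF side1(2)] by metis
        then consider "p' = p" "q' = q" | "p' = q" "q' = p" by (auto simp: doubleton_eq_iff)
        then show ?thesis
        proof cases
          case 1
          then show ?thesis using third_vertex_unique[OF vt] side side1 TT by metis
        next
          case 2
          then show ?thesis using step' side side1 TT by metis
        qed
      qed
    qed
  qed
  have cover: "hyp_disc \<subseteq> U True \<union> U False"
  proof
    fix z assume z: "z \<in> hyp_disc"
    have "\<exists>T\<in>triangles_of v. z \<in> closure (triangle_region T)"
    proof (cases "z \<in> \<Union>v")
      case False
      then obtain T where "T \<in> triangles_of v" "z \<in> triangle_region T"
        using ideal_triangulationD[OF vt, of z] z by auto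
      then show ?thesis using closure_subset by blast
    next
      case True
      then obtain a where a: "a \<in> v" "z \<in> a" by blast
      have "a \<in> arcs" using a v' by (auto simp: noncrossing_def)
      then obtain p q where pq: "a = geodesic p q" "p \<noteq> q" "norm p = 1" "norm q = 1" by (rule arcsE)
      obtain r where r: "ccw p q r" "{p, q, r} \<in> triangles_of v"
        using triangle_on_left[OF v, of p q] a pq by blast
      have "z \<in> convex hull {p, q}" using a pq by (auto simp: segment_convex_hull open_segment_def)
      moreover have "convex hull {p, q} \<subseteq> convex hull {p, q, r}" by (rule hull_mono) auto
      ultimately have "z \<in> closure (triangle_region {p, q, r})" unfolding closure_triangle_region[OF r(1)] by blast
      then show ?thesis using r by blast
    qed
    then show "z \<in> U True \<union> U False" using z by (auto simp: U_def)
  qed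
  have "False" if "z \<in> U True" "z \<in> U False" for z
  proof -
    from that obtain T T' where "T \<in> triangles_of v" "T' \<in> triangles_of v" "P T = True" "P T' = False"
      "z \<in> closure (triangle_region T)" "z \<in> closure (triangle_region T')" "norm z < 1"
      unfolding U_def by auto
    then show False using same[of T T' z] by simp
  qed
  then have "U True \<inter> U False \<inter> hyp_disc = {}" by blast
  then have "U True \<inter> hyp_disc = {} \<or> U False \<inter> hyp_disc = {}"
    using connectedD[OF _ op op, of hyp_disc True False] cover by auto
  moreover have "U (P T) \<inter> hyp_disc \<noteq> {}" if T: "T \<in> triangles_of v" for T
  proof -
    obtain p q r where pqr: "T = {p, q, r}" "ccw p q r" using T by (rule triangles_of_ccwE)
    then obtain z where z: "z \<in> triangle_region T" using triangle_region_nonempty by blast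
    then have "norm z < 1" using norm_less_one_triangle_region pqr by blast
    moreover have "z \<in> closure (triangle_region T)" using z closure_subset by blast
    ultimately have "z \<in> U (P T)" using T unfolding U_def by auto
    then show ?thesis using \<open>norm z < 1\<close> by auto
  qed
  ultimately show "P T1" using T0 T1 by (metis (full_types))
qed

section \<open>Connectedness of the flip graph\<close>

lemma adj_flipI:
  assumes "v \<in> vertices" "{p, q, r} \<in> triangles_of v" "{p, q, s} \<in> triangles_of v" "r \<noteq> s"
  shows "adj v (insert (geodesic r s) (v - {geodesic p q}))"
proof -
  have "geodesic p q \<in> v" using flip_triangulation(5)[OF vertex_triangulation[OF assms(1)] assms(2-4) refl] .
  then show ?thesis
    using is_flipI[OF assms] flip_vertex[OF assms refl] assms(1) unfolding adj_def by metis
qed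

lemma adj_sym: "adj v w \<Longrightarrow> adj w v"
  unfolding adj_def by blast

lemma adj_vertices: "adj v w \<Longrightarrow> v \<in> vertices \<and> w \<in> vertices"
  unfolding adj_def by blast

lemma dyadic_levelE:
  assumes "p \<in> dyadic_level n"
  obtains k where "0 \<le> k" "k < 2 ^ n" "p = dpt n k"
proof -
  from assms obtain k where "p = dpt n k" by (auto simp: dyadic_level_def)
  then have "p = dpt n (k mod 2 ^ n)" by (simp add: dpt_mod)
  then show ?thesis using that[of "k mod 2 ^ n"] by simp
qed

lemma dyadic_level_norm: "p \<in> dyadic_level n \<Longrightarrow> norm p = 1"
  by (auto simp: dyadic_level_def)

lemma pos_dpt:
  assumes "0 \<le> k" "k < 2 ^ n"
  shows "pos (dpt n k) = of_int k / 2 ^ n"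
proof -
  have "(of_int k :: real) < of_int (2 ^ n)" using assms(2) by (simp only: of_int_less_iff)
  then show ?thesis unfolding dpt_def using assms by (intro pos_bdry) auto
qed

lemma pos_dpt_less_iff:
  assumes "0 \<le> j" "j < 2 ^ n" "0 \<le> k" "k < 2 ^ n"
  shows "pos (dpt n j) < pos (dpt n k) \<longleftrightarrow> j < k"
  using assms by (simp add: pos_dpt divide_less_cancel)

lemma dpt_eq_iff:
  assumes "0 \<le> j" "j < 2 ^ n" "0 \<le> k" "k < 2 ^ n"
  shows "dpt n j = dpt n k \<longleftrightarrow> j = k"
  using pos_dpt_less_iff[OF assms] pos_dpt_less_iff[OF assms(3,4,1,2)] by (metis less_irrefl linorder_neqE)

lemma ccw_dpt_iff:
  assumes "0 \<le> i" "i < 2 ^ n" "0 \<le> j" "j < 2 ^ n" "0 \<le> k" "k < 2 ^ n"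
  shows "ccw (dpt n i) (dpt n j) (dpt n k) \<longleftrightarrow> i < j \<and> j < k \<or> j < k \<and> k < i \<or> k < i \<and> i < j"
  using assms by (simp add: ccw_iff_pos pos_dpt_less_iff)

text \<open>
  A dyadic edge of level at least \<open>n\<close> has all points of level \<open>n\<close> on one side and is therefore
  not crossed by the new diagonal.
\<close>

lemma flip_keeps_tail:
  assumes v: "ideal_triangulation v" "has_dyadic_tail n v"
    and T: "{p, q, r} \<in> triangles_of v" "{p, q, s} \<in> triangles_of v" "r \<noteq> s"
    and l: "r \<in> dyadic_level n" "s \<in> dyadic_level n"
  shows "has_dyadic_tail n (insert (geodesic r s) (v - {geodesic p q}))"
proof -
  have "dyadic_edge m k \<noteq> geodesic p q" if m: "n \<le> m" for m k
  proof
    assume eq: "dyadic_edge m k = geodesic p q"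
    have n: "norm p = 1" "norm q = 1" "p \<noteq> q" using T mem_triangles_of_iff[OF v(1)] by auto
    have "dpt m k \<noteq> dpt m (k + 1)" using eq n(3) by auto
    then have "{dpt m k, dpt m (k + 1)} = {p, q}" using geodesic_eq_iff[of "dpt m k" "dpt m (k + 1)" p q] eq n by simp
    then consider "dpt m k = p" "dpt m (k + 1) = q" | "dpt m k = q" "dpt m (k + 1) = p"
      by (auto simp: doubleton_eq_iff)
    then have "area p q r \<ge> 0 \<and> area p q s \<ge> 0 \<or> area q p r \<ge> 0 \<and> area q p s \<ge> 0"
      using area_dyadic_edge_nonneg[OF m l(1), of k] area_dyadic_edge_nonneg[OF m l(2), of k] by cases auto
    moreover have "ccw p q r \<and> ccw q p s \<or> ccw q p r \<and> ccw p q s"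
      by (rule opposite_third_vertices[OF v(1) T])
    ultimately show False using ccw_imp_area area_swap by (smt (verit))
  qed
  then show ?thesis using v(2) by (auto simp: has_dyadic_tail_def)
qed

text \<open>
  If the third vertex lies beyond the side \<open>I_k^n\<close> of the polygon, then \<open>p\<close> and \<open>q\<close> can only be
  the end points of this side, and the triangle is on its outer side.
\<close>

lemma third_vertex_level:
  assumes v: "ideal_triangulation v" "has_dyadic_tail n v" "1 \<le> n"
    and T: "{p, q, r} \<in> triangles_of v" "ccw p q r"
    and l: "p \<in> dyadic_level n" "q \<in> dyadic_level n" and r: "r \<notin> dyadic_level n"
  shows "\<exists>k\<ge>0. k < 2 ^ n \<and> p = dpt n (k + 1) \<and> q = dpt n k"
proof -
  note v' = ideal_triangulation_noncrossing[OF v(1)]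
  note nrm = ccw_on_circle[OF T(2)] and ne = ccw_distinct[OF T(2)]
  obtain k where k: "0 \<le> k" "k < 2 ^ n" "area (dpt n k) (dpt n (k + 1)) r < 0"
    using outside_dyadic_level[of r n] nrm r v(3) by blast
  have e: "dyadic_edge n k \<in> v" using v(2) by (simp add: has_dyadic_tail_def)
  have sides: "geodesic r p \<in> v" "geodesic r q \<in> v"
    using T mem_triangles_of_iff[OF v(1)] by (auto simp: open_segment_commute)
  have end_pt: "x = dpt n k \<or> x = dpt n (k + 1)" if "geodesic r x \<in> v" "x \<in> dyadic_level n" for x
  proof -
    have n: "norm x = 1" using that(2) by (rule dyadic_level_norm)
    have "area (dpt n k) (dpt n (k + 1)) r * area (dpt n k) (dpt n (k + 1)) x \<ge> 0"
      using noncrossing_area[OF v' e that(1)] nrm n by simp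
    then have "area (dpt n k) (dpt n (k + 1)) x \<le> 0" using k by (auto simp: zero_le_mult_iff)
    then have "area (dpt n k) (dpt n (k + 1)) x = 0" using area_dyadic_edge_nonneg[of n n x k] that by simp
    then show ?thesis using area_eq_0_iff[of "dpt n k" "dpt n (k + 1)" x] n dpt_Suc_neq[OF v(3), of k] by auto
  qed
  have "\<not> (p = dpt n k \<and> q = dpt n (k + 1))"
    using k(3) ccw_imp_area[OF T(2)] by auto
  then show ?thesis using end_pt[OF sides(1) l(1)] end_pt[OF sides(2) l(2)] ne k by auto
qed

abbreviation chord :: "nat \<Rightarrow> int \<Rightarrow> complex set" where
  "chord n k \<equiv> geodesic (dpt n 0) (dpt n k)"

definition is_fan :: "nat \<Rightarrow> complex set set \<Rightarrow> bool" where
  "is_fan n v \<longleftrightarrow> (\<forall>k\<in>{1..<2 ^ n}. chord n k \<in> v)"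

text \<open>
  The number of missing diagonals from \<open>0\<close> decreases; this makes the passage to the fan
  terminate.
\<close>

lemma flip_to_add_chord:
  assumes v: "v \<in> vertices" "has_dyadic_tail n v" "1 \<le> n" and nf: "\<not> is_fan n v"
  obtains w l where "adj v w" "has_dyadic_tail n w" "l \<in> {1..<2 ^ n}" "chord n l \<in> w" "chord n l \<notin> v"
    "\<And>k. k \<in> {1..<2 ^ n} \<Longrightarrow> chord n k \<in> v \<Longrightarrow> chord n k \<in> w"
proof -
  note vt = vertex_triangulation[OF v(1)]
  \<comment> \<open>The chord to \<open>k - 1\<close> is present and the chord to \<open>k\<close> is not: the triangle \<open>0, k - 1, j\<close> on it jumps
    over \<open>k\<close>, and flipping its side from \<open>k - 1\<close> to \<open>j\<close> gives a chord to some \<open>l\<close> in between.\<close>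
  define K where "K = {k \<in> {1..<2 ^ n :: int}. chord n k \<notin> v}"
  have "K \<subseteq> {1..<2 ^ n}" by (auto simp: K_def)
  then have K: "finite K" "K \<noteq> {}" using nf finite_subset by (auto simp: K_def is_fan_def)
  define k where "k = Min K"
  have kK: "k \<in> K" using K by (simp add: k_def)
  have kmin: "chord n i \<in> v" if "1 \<le> i" "i < k" for i
  proof (rule ccontr)
    assume "chord n i \<notin> v"
    then have "i \<in> K" using that kK by (auto simp: K_def)
    then have "k \<le> i" using K by (simp add: k_def)
    then show False using that by simp
  qed
  have edge: "dyadic_edge n i \<in> v" for i using v(2) by (simp add: has_dyadic_tail_def)
  have k2: "2 \<le> k" "k < 2 ^ n"
  proof -
    have "k \<noteq> 1" using edge[of 0] kK by (auto simp: K_def)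
    then show "2 \<le> k" "k < 2 ^ n" using kK by (auto simp: K_def)
  qed
  define a where "a = dpt n (k - 1)"
  have a: "geodesic (dpt n 0) a \<in> v" unfolding a_def using kmin[of "k - 1"] k2 by simp
  obtain x where x: "ccw (dpt n 0) a x" "{dpt n 0, a, x} \<in> triangles_of v"
    using triangle_on_left[OF v(1) a] unfolding a_def by auto
  have xl: "x \<in> dyadic_level n"
  proof (rule ccontr)
    assume "x \<notin> dyadic_level n"
    then obtain i where i: "0 \<le> i" "i < 2 ^ n" "dpt n 0 = dpt n (i + 1)" "a = dpt n i"
      using third_vertex_level[OF vt v(2,3) x(2,1)] dpt_on_level unfolding a_def by blast
    have "i = k - 1" using i k2 dpt_eq_iff[of "k - 1" n i] by (simp add: a_def)
    then show False using i(3) k2 dpt_eq_iff[of 0 n k] by simp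
  qed
  then obtain j where j: "0 \<le> j" "j < 2 ^ n" "x = dpt n j" by (rule dyadic_levelE)
  have "k - 1 < j" using x(1) ccw_dpt_iff[of 0 n "k - 1" j] j k2 by (auto simp: a_def)
  moreover have "j \<noteq> k"
  proof
    assume "j = k"
    then have "geodesic (dpt n 0) x \<notin> v" using kK j by (simp add: K_def)
    then show False using x(2) mem_triangles_of_iff[OF vt] by (metis open_segment_commute)
  qed
  ultimately have kj: "k < j" by simp
  have xa: "geodesic x a \<in> v" using x(2) mem_triangles_of_iff[OF vt] by (metis open_segment_commute)
  obtain y where y: "ccw x a y" "{x, a, y} \<in> triangles_of v"
    using triangle_on_left[OF v(1) xa] j unfolding a_def by auto
  have yl: "y \<in> dyadic_level n"
  proof (rule ccontr)
    assume "y \<notin> dyadic_level n"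
    then obtain i where i: "0 \<le> i" "i < 2 ^ n" "x = dpt n (i + 1)" "a = dpt n i"
      using third_vertex_level[OF vt v(2,3) y(2,1) xl] dpt_on_level unfolding a_def by blast
    have "i = k - 1" using i k2 dpt_eq_iff[of "k - 1" n i] by (simp add: a_def)
    then show False using i(3) k2 kj j dpt_eq_iff[of j n k] by simp
  qed
  then obtain l where l: "0 \<le> l" "l < 2 ^ n" "y = dpt n l" by (rule dyadic_levelE)
  have lkj: "k - 1 < l" "l < j" using y(1) ccw_dpt_iff[of j n "k - 1" l] j l k2 kj by (auto simp: a_def)
  have T: "{x, a, dpt n 0} \<in> triangles_of v" "{x, a, y} \<in> triangles_of v" "dpt n 0 \<noteq> y"
    using x y l lkj k2 dpt_eq_iff[of 0 n l] by (auto simp: insert_commute)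
  define w where "w = insert (geodesic (dpt n 0) y) (v - {geodesic x a})"
  have "adj v w" unfolding w_def by (rule adj_flipI[OF v(1) T])
  moreover have "has_dyadic_tail n w"
    unfolding w_def by (rule flip_keeps_tail[OF vt v(2) T dpt_on_level yl])
  moreover have "chord n l \<in> w" "l \<in> {1..<2 ^ n}" using l lkj k2 by (auto simp: w_def)
  moreover have "chord n l \<notin> v" using flip_triangulation(2)[OF vt T refl] l by simp
  moreover have "chord n i \<in> w" if "i \<in> {1..<2 ^ n}" "chord n i \<in> v" for i
  proof -
    have "dpt n 0 \<noteq> x" "dpt n 0 \<noteq> a" "x \<noteq> a" using ccw_distinct[OF x(1)] by auto
    moreover have "dpt n 0 \<noteq> dpt n i" using that dpt_eq_iff[of 0 n i] by simp
    ultimately have "chord n i \<noteq> geodesic x a"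
      using geodesic_eq_iff[of "dpt n 0" "dpt n i" x a] j by (auto simp: a_def doubleton_eq_iff)
    then show ?thesis using that by (simp add: w_def)
  qed
  ultimately show ?thesis using that by blast
qed

lemma flip_to_fan:
  assumes "v \<in> vertices" "has_dyadic_tail n v" "1 \<le> n"
  shows "\<exists>w. adj\<^sup>*\<^sup>* v w \<and> w \<in> vertices \<and> has_dyadic_tail n w \<and> is_fan n w"
  using assms
proof (induction "card {k \<in> {1..<2 ^ n :: int}. chord n k \<notin> v}" arbitrary: v rule: less_induct)
  case less
  show ?case
  proof (cases "is_fan n v")
    case True
    then show ?thesis using less by blast
  next
    case False
    obtain w l where w: "adj v w" "has_dyadic_tail n w" "l \<in> {1..<2 ^ n}" "chord n l \<in> w" "chord n l \<notin> v"
      "\<And>k. k \<in> {1..<2 ^ n} \<Longrightarrow> chord n k \<in> v \<Longrightarrow> chord n k \<in> w"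
      using flip_to_add_chord[OF less(2-4) False] by blast
    have "{k \<in> {1..<2 ^ n :: int}. chord n k \<notin> w} \<subset> {k \<in> {1..<2 ^ n}. chord n k \<notin> v}"
      using w(3-6) by blast
    then have "card {k \<in> {1..<2 ^ n :: int}. chord n k \<notin> w} < card {k \<in> {1..<2 ^ n :: int}. chord n k \<notin> v}"
      by (intro psubset_card_mono finite_subset[of "{k \<in> {1..<2 ^ n :: int}. chord n k \<notin> v}" "{1..<2 ^ n}"]) blast+
    then obtain u where "adj\<^sup>*\<^sup>* w u" "u \<in> vertices" "has_dyadic_tail n u" "is_fan n u"
      using less(1)[of w] w(1,2) less(4) adj_vertices by blast
    then show ?thesis using w(1) converse_rtranclp_into_rtranclp by metis
  qed
qed

text \<open>
  The diagonals from \<open>0\<close> cross every other diagonal of the polygon, and outside the polygon both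
  triangulations consist of dyadic edges.
\<close>

lemma fan_unique:
  assumes v: "v \<in> vertices" "has_dyadic_tail n v" "is_fan n v"
    and w: "w \<in> vertices" "has_dyadic_tail n w" "is_fan n w" and n: "1 \<le> n"
  shows "v = w"
proof -
  note v' = vertex_noncrossing[OF v(1)]
  have g: "geodesic (dpt n i) (dpt n j) \<in> w"
    if h: "geodesic (dpt n i) (dpt n j) \<in> v" "0 \<le> i" "i < j" "j < 2 ^ n" for i j
  proof -
    consider "i = 0" | "j = i + 1" | "0 < i" "i + 1 < j" using h(2,3) by linarith
    then show ?thesis
    proof cases
      case 1
      then show ?thesis using w(3) h by (simp add: is_fan_def)
    next
      case 2
      then show ?thesis using w(2) by (simp add: has_dyadic_tail_def)
    next
      case 3
      have "chord n (i + 1) \<in> v" using v(3) 3 h by (simp add: is_fan_def)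
      moreover have "ccw (dpt n 0) (dpt n (i + 1)) (dpt n j)" "ccw (dpt n (i + 1)) (dpt n 0) (dpt n i)"
        using 3 h by (simp_all add: ccw_dpt_iff)
      ultimately show ?thesis
        using noncrossing_ccw[OF v', of "dpt n 0" "dpt n (i + 1)" "dpt n j" "dpt n i"] h by (metis open_segment_commute)
    qed
  qed
  have "v \<subseteq> w"
  proof
    fix a assume a: "a \<in> v"
    consider m k where "m \<ge> n" "a = dyadic_edge m k"
      | p q where "p \<in> dyadic_level n" "q \<in> dyadic_level n" "a = geodesic p q"
      using tail_classification[OF v' v(2) n a] by blast
    then show "a \<in> w"
    proof cases
      case 1
      then show ?thesis using w(2) by (simp add: has_dyadic_tail_def)
    next
      case (2 p q)
      obtain i where i: "0 \<le> i" "i < 2 ^ n" "p = dpt n i" using 2(1) by (rule dyadic_levelE)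
      obtain j where j: "0 \<le> j" "j < 2 ^ n" "q = dpt n j" using 2(2) by (rule dyadic_levelE)
      have "a \<in> arcs" using a v' by (auto simp: noncrossing_def)
      then have "p \<noteq> q" using geodesic_in_arcsD(3)[of p q] 2 dyadic_level_norm by blast
      then have "i \<noteq> j" using i j by blast
      then show ?thesis using g[of i j] g[of j i] a 2 i j by (metis linorder_neqE open_segment_commute)
    qed
  qed
  then show ?thesis
    using triangulation_subset_eq vertex_triangulation v(1) w(1) ideal_triangulation_noncrossing by blast
qed

text \<open>
  Both vertices are flipped to the fan in a polygon that is large enough for both of them.
\<close>

lemma flip_graph_connected:
  assumes "v \<in> vertices" "w \<in> vertices"
  shows "adj\<^sup>*\<^sup>* v w"
proof -
  obtain m where m: "2 \<le> m" "has_dyadic_tail m v" using vertex_has_dyadic_tail[OF assms(1)] .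
  obtain n where n: "2 \<le> n" "has_dyadic_tail n w" using vertex_has_dyadic_tail[OF assms(2)] .
  define N where "N = max m n"
  have N: "has_dyadic_tail N v" "has_dyadic_tail N w" "1 \<le> N"
    using has_dyadic_tail_mono[of m N v] has_dyadic_tail_mono[of n N w] m n by (auto simp: N_def)
  obtain v' where v': "adj\<^sup>*\<^sup>* v v'" "v' \<in> vertices" "has_dyadic_tail N v'" "is_fan N v'"
    using flip_to_fan[OF assms(1) N(1,3)] by blast
  obtain w' where w': "adj\<^sup>*\<^sup>* w w'" "w' \<in> vertices" "has_dyadic_tail N w'" "is_fan N w'"
    using flip_to_fan[OF assms(2) N(2,3)] by blast
  have "v' = w'" by (rule fan_unique[OF v'(2-4) w'(2-4) N(3)])
  moreover have "adj\<^sup>*\<^sup>* w' w"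
    using w'(1) by (metis adj_sym sympI sympD symp_rtranclp)
  ultimately show ?thesis using v'(1) by simp
qed

section \<open>The flip at an arc\<close>

definition flip :: "complex set set \<Rightarrow> complex set \<Rightarrow> complex set set" where
  "flip v a = (THE w. is_flip v a w)"

text \<open>
  The flip does not depend on the choice of the quadrilateral, since an arc has only two
  triangles.
\<close>

lemma flip_eqI:
  assumes v: "v \<in> vertices" and T: "{p, q, r} \<in> triangles_of v" "{p, q, s} \<in> triangles_of v" "r \<noteq> s"
  shows "flip v (geodesic p q) = insert (geodesic r s) (v - {geodesic p q})"
  unfolding flip_def
proof (rule the_equality)
  show "is_flip v (geodesic p q) (insert (geodesic r s) (v - {geodesic p q}))"
    by (rule is_flipI[OF v T])
  fix w assume w: "is_flip v (geodesic p q) w"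
  note vt = vertex_triangulation[OF v]
  obtain p' q' r' s' where w': "geodesic p q = geodesic p' q'" "{p', q', r'} \<in> triangles_of v" "{p', q', s'} \<in> triangles_of v"
    "r' \<noteq> s'" "w = insert (geodesic r' s') (v - {geodesic p q})" using is_flipE[OF v w] by metis
  have n: "norm p = 1" "norm q = 1" "p \<noteq> q" "norm p' = 1" "norm q' = 1" "p' \<noteq> q'"
    using T w' mem_triangles_of_iff[OF vt] by auto
  then have "{p', q'} = {p, q}" using w'(1) geodesic_eq_iff by metis
  then have "{p, q, r'} \<in> triangles_of v" "{p, q, s'} \<in> triangles_of v"
    using w' by (auto simp: doubleton_eq_iff insert_commute)
  then have "r' = r \<or> r' = s" "s' = r \<or> s' = s" using third_vertex_cases[OF vt T] by auto
  then have "geodesic r' s' = geodesic r s" using w'(4) by (auto simp: open_segment_commute)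
  then show "w = insert (geodesic r s) (v - {geodesic p q})" using w'(5) by metis
qed

lemma flip_quadrilateral:
  assumes v: "v \<in> vertices" and a: "a \<in> v"
  obtains p q r s where "a = geodesic p q" "ccw p q r" "ccw q p s"
    "{p, q, r} \<in> triangles_of v" "{p, q, s} \<in> triangles_of v" "r \<noteq> s"
proof -
  have "a \<in> arcs" using a vertex_noncrossing[OF v] by (auto simp: noncrossing_def)
  then obtain p q where pq: "a = geodesic p q" "norm p = 1" "norm q = 1" by (metis arcsE)
  then have a': "geodesic p q \<in> v" "geodesic q p \<in> v" using a by (simp_all add: open_segment_commute)
  obtain r where r: "ccw p q r" "{p, q, r} \<in> triangles_of v" using triangle_on_left[OF v a'(1) pq(2,3)] .
  obtain s where s: "ccw q p s" "{q, p, s} \<in> triangles_of v" using triangle_on_left[OF v a'(2) pq(3,2)] .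
  have "r \<noteq> s" using r(1) s(1) ccw_asym by blast
  then show ?thesis using that[of p q r s] pq r s by (simp add: insert_commute)
qed

lemma is_flip_iff:
  assumes "v \<in> vertices"
  shows "is_flip v a w \<longleftrightarrow> a \<in> v \<and> w = flip v a"
proof
  assume f: "is_flip v a w"
  obtain p q r s where h: "a = geodesic p q" "{p, q, r} \<in> triangles_of v" "{p, q, s} \<in> triangles_of v" "r \<noteq> s"
    "w = insert (geodesic r s) (v - {a})" using is_flipE[OF assms f] by metis
  then have "w = flip v a" using flip_eqI[OF assms h(2-4)] by simp
  moreover have "a \<in> v" using f by (simp add: is_flip_def)
  ultimately show "a \<in> v \<and> w = flip v a" by simp
next
  assume h: "a \<in> v \<and> w = flip v a"
  obtain p q r s where "a = geodesic p q" "{p, q, r} \<in> triangles_of v" "{p, q, s} \<in> triangles_of v" "r \<noteq> s"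
    using flip_quadrilateral[OF assms, of a] h by metis
  then show "is_flip v a w" using flip_eqI[OF assms] is_flipI[OF assms] h by metis
qed

text \<open>The arc \<open>a'\<close> is the new diagonal; flipping it undoes the flip of \<open>a\<close>.\<close>

lemma flipE:
  assumes v: "v \<in> vertices" and a: "a \<in> v"
  obtains a' where "flip v a = insert a' (v - {a})" "a' \<notin> v" "flip v a \<in> vertices" "a \<notin> flip v a"
    "flip (flip v a) a' = v"
proof -
  obtain p q r s where h: "a = geodesic p q" "{p, q, r} \<in> triangles_of v" "{p, q, s} \<in> triangles_of v" "r \<noteq> s"
    using flip_quadrilateral[OF v a] by metis
  have w: "flip v a = insert (geodesic r s) (v - {geodesic p q})" using flip_eqI[OF v h(2-4)] h by simp
  note F = flip_triangulation[OF vertex_triangulation[OF v] h(2-4) w]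
  have wv: "flip v a \<in> vertices" by (rule flip_vertex[OF v h(2-4) w])
  have "flip (flip v a) (geodesic r s) = insert (geodesic p q) (flip v a - {geodesic r s})"
    by (rule flip_eqI[OF wv F(3,4,8)])
  then have "flip (flip v a) (geodesic r s) = v" using F(6) by simp
  then show ?thesis using that[of "geodesic r s"] w F wv h by simp
qed

lemma adj_iff_flip: "v \<in> vertices \<Longrightarrow> adj v w \<longleftrightarrow> (\<exists>a\<in>v. w = flip v a)"
proof
  assume v: "v \<in> vertices" and "adj v w"
  then have w: "w \<in> vertices" and "(\<exists>a\<in>v. is_flip v a w) \<or> (\<exists>a\<in>w. is_flip w a v)"
    by (auto simp: adj_def)
  then consider "\<exists>a\<in>v. w = flip v a" | a where "a \<in> w" "v = flip w a"
    using is_flip_iff[OF v] is_flip_iff[OF w] by blast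
  then show "\<exists>a\<in>v. w = flip v a"
  proof cases
    case (2 a)
    then obtain a' where "v = insert a' (w - {a})" "flip v a' = w" using flipE[OF w 2(1)] by metis
    then show ?thesis by blast
  qed
next
  assume v: "v \<in> vertices" and "\<exists>a\<in>v. w = flip v a"
  then obtain a where a: "a \<in> v" "w = flip v a" by blast
  moreover have "w \<in> vertices" using flipE[OF v a(1)] a(2) by metis
  ultimately show "adj v w" using v is_flip_iff[OF v] by (auto simp: adj_def)
qed

lemma flip_inj:
  assumes "v \<in> vertices" "a \<in> v" "b \<in> v" "flip v a = flip v b"
  shows "a = b"
proof -
  obtain a' where "flip v a = insert a' (v - {a})" "a' \<notin> v" using flipE[OF assms(1,2)] by metis
  moreover have "b \<notin> flip v b" using flipE[OF assms(1,3)] by metis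
  ultimately show ?thesis using assms(3,4) by (metis insertI2 Diff_iff singletonD)
qed

lemma flip_keeps:
  assumes "v \<in> vertices" "a \<in> v" "b \<in> v" "a \<noteq> b"
  shows "b \<in> flip v a"
proof -
  obtain a' where "flip v a = insert a' (v - {a})" using flipE[OF assms(1,2)] by metis
  then show ?thesis using assms by simp
qed

lemma flip_vertices: "v \<in> vertices \<Longrightarrow> a \<in> v \<Longrightarrow> flip v a \<in> vertices"
  by (metis flipE)

section \<open>Pentagons and links\<close>

text \<open>
  The triangulation of a pentagon by the two diagonals from its vertex \<open>p\<close>, together with the
  set \<open>R\<close> of its arcs that are not diagonals of the pentagon.
\<close>

definition pent_tri :: "complex set set \<Rightarrow> complex \<Rightarrow> complex \<Rightarrow> complex \<Rightarrow> complex set set" where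
  "pent_tri R p q r = insert (geodesic p q) (insert (geodesic p r) R)"

text \<open>
  Here \<open>p, s, q, r, t\<close> are the vertices of the pentagon in counterclockwise order, starting from
  the common end point \<open>p\<close> of the two diagonals.
\<close>

definition pent :: "complex set set \<Rightarrow> complex \<Rightarrow> complex \<Rightarrow> complex \<Rightarrow> complex \<Rightarrow> complex \<Rightarrow> bool" where
  "pent R p s q r t \<longleftrightarrow> pent_tri R p q r \<in> vertices \<and> geodesic p q \<notin> R \<and> geodesic p r \<notin> R \<and>
    ccw p s q \<and> ccw p q r \<and> ccw p r t \<and>
    {p, s, q} \<in> triangles_of (pent_tri R p q r) \<and> {p, q, r} \<in> triangles_of (pent_tri R p q r) \<and>
    {p, r, t} \<in> triangles_of (pent_tri R p q r)"

lemma pent_ccw: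
  assumes "pent R p s q r t"
  shows "ccw p s q" "ccw p q r" "ccw p r t" "ccw r t p" "ccw r p s" "ccw r s q" "ccw q p s" "ccw p q t" "ccw q t p"
    "ccw p s t" "ccw s t p"
proof -
  have h: "ccw p s q" "ccw p q r" "ccw p r t" using assms by (simp_all add: pent_def)
  note n = ccw_on_circle[OF h(1)] ccw_on_circle[OF h(2)] ccw_on_circle[OF h(3)]
  show "ccw p s q" "ccw p q r" "ccw p r t" by fact+
  show "ccw r t p" "ccw r p s" "ccw r s q" "ccw q p s" "ccw p q t" "ccw q t p" "ccw p s t" "ccw s t p"
    using h n by (auto simp: ccw_iff_pos)
qed

lemma pent_distinct:
  assumes "pent R p s q r t"
  shows "distinct [p, s, q, r, t]"
proof -
  note c = pent_ccw[OF assms]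
  have "ccw s q r" "ccw q r t"
    using c(1-3) ccw_on_circle[OF c(1)] ccw_on_circle[OF c(2)] ccw_on_circle[OF c(3)] by (auto simp: ccw_iff_pos)
  then show ?thesis using c ccw_distinct by auto
qed

lemma pent_norm:
  assumes "pent R p s q r t"
  shows "norm p = 1" "norm s = 1" "norm q = 1" "norm r = 1" "norm t = 1"
  using pent_ccw(1-3)[OF assms] ccw_on_circle by blast+

text \<open>
  Flipping the first diagonal from \<open>p\<close> gives the triangulation by the two diagonals from \<open>r\<close>.
  Statements about all five triangulations follow from statements about one, since five such
  steps go once round the pentagon of triangulations.
\<close>

lemma pent_rotate:
  assumes "pent R p s q r t"
  shows "pent R r t p s q" "flip (pent_tri R p q r) (geodesic p q) = pent_tri R r p s"
proof -
  let ?v = "pent_tri R p q r" and ?w = "pent_tri R r p s"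
  have v: "?v \<in> vertices" "geodesic p q \<notin> R" "geodesic p r \<notin> R"
    "{p, s, q} \<in> triangles_of ?v" "{p, q, r} \<in> triangles_of ?v" "{p, r, t} \<in> triangles_of ?v"
    using assms by (simp_all add: pent_def)
  note c = pent_ccw[OF assms] and d = pent_distinct[OF assms] and n = pent_norm[OF assms]
  have T: "{p, q, r} \<in> triangles_of ?v" "{p, q, s} \<in> triangles_of ?v" "r \<noteq> s"
    using v d by (auto simp: insert_commute)
  have "geodesic p r \<noteq> geodesic p q" using geodesic_eq_iff[of p r p q] n d by (auto simp: doubleton_eq_iff)
  then have w: "?w = insert (geodesic r s) (?v - {geodesic p q})"
    unfolding pent_tri_def open_segment_commute[of r p] using v(2) by blast
  note F = flip_triangulation[OF vertex_triangulation[OF v(1)] T w]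
  show "flip ?v (geodesic p q) = ?w" using flip_eqI[OF v(1) T] w by simp
  have wv: "?w \<in> vertices" by (rule flip_vertex[OF v(1) T w])
  have rs: "geodesic r s \<notin> R" using F(2) by (simp add: pent_tri_def)
  have sides: "geodesic r t \<in> ?v" "geodesic t p \<in> ?v" "geodesic p r \<in> ?v"
    using v(6) mem_triangles_of_iff[OF vertex_triangulation[OF v(1)]] by blast+
  have "geodesic r t \<in> ?w" "geodesic t p \<in> ?w" "geodesic p r \<in> ?w"
    using sides unfolding w using n d by (auto simp: doubleton_eq_iff)
  then have "{r, t, p} \<in> triangles_of ?w"
    using n d mem_triangles_of_iff[OF F(1)] by auto
  moreover have "{r, p, s} \<in> triangles_of ?w" "{r, s, q} \<in> triangles_of ?w"
    using F(3,4) by (auto simp: insert_commute)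
  ultimately show "pent R r t p s q"
    unfolding pent_def using wv rs v(3) c by (simp only: open_segment_commute[of r p]) simp
qed

lemma pent_rotations:
  assumes "pent R p s q r t"
  shows "pent R r t p s q" "pent R s q r t p" "pent R t p s q r" "pent R q r t p s"
  using pent_rotate(1) assms by blast+

definition pent_set :: "complex set set \<Rightarrow> complex \<Rightarrow> complex \<Rightarrow> complex \<Rightarrow> complex \<Rightarrow> complex \<Rightarrow> complex set set set" where
  "pent_set R p s q r t =
    {pent_tri R p q r, pent_tri R r p s, pent_tri R s r t, pent_tri R t s q, pent_tri R q t p}"

lemma pent_flips:
  assumes "pent R p s q r t"
  shows "flip (pent_tri R p q r) (geodesic p q) = pent_tri R r p s"
    "flip (pent_tri R p q r) (geodesic p r) = pent_tri R q t p"
proof -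
  show "flip (pent_tri R p q r) (geodesic p q) = pent_tri R r p s" by (rule pent_rotate(2)[OF assms])
  let ?w = "pent_tri R q t p" and ?v = "pent_tri R p q r"
  have p: "pent R q r t p s" by (rule pent_rotations(4)[OF assms])
  have f: "flip ?w (geodesic q t) = ?v" by (rule pent_rotate(2)[OF p])
  have w: "?w \<in> vertices" "geodesic q t \<in> ?w" "geodesic q t \<notin> R" using p by (auto simp: pent_def pent_tri_def)
  obtain a' where a': "flip ?w (geodesic q t) = insert a' (?w - {geodesic q t})" "a' \<notin> ?w" "flip ?v a' = ?w"
    using flipE[OF w(1,2)] f by metis
  have "geodesic p r \<noteq> geodesic q t" "geodesic p r \<noteq> geodesic p q"
    using pent_distinct[OF assms] pent_norm[OF assms] by (auto simp: doubleton_eq_iff)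
  moreover have "geodesic p r \<notin> R" using assms by (simp add: pent_def)
  ultimately have "geodesic p r \<notin> ?w" by (simp add: pent_tri_def open_segment_commute)
  moreover have "geodesic p r \<in> insert a' (?w - {geodesic q t})" using a'(1) f by (simp add: pent_tri_def)
  ultimately have "a' = geodesic p r" by auto
  then show "flip ?v (geodesic p r) = ?w" using a'(3) by simp
qed

text \<open>Unlike \<open>pent_set\<close>, this does not single out a vertex of the pentagon.\<close>

definition pent_family :: "complex set set set \<Rightarrow> complex set set \<Rightarrow> bool" where
  "pent_family \<F> R \<longleftrightarrow> (\<exists>p s q r t. pent R p s q r t \<and> \<F> = pent_set R p s q r t)"

lemma pent_familyE:
  assumes "pent_family \<F> R" "w \<in> \<F>"
  obtains p s q r t where "pent R p s q r t" "\<F> = pent_set R p s q r t" "w = pent_tri R p q r"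
proof -
  obtain p s q r t where h: "pent R p s q r t" "\<F> = pent_set R p s q r t"
    using assms(1) by (auto simp: pent_family_def)
  note rot = pent_rotations[OF h(1)]
  have "\<F> = pent_set R r t p s q" "\<F> = pent_set R s q r t p" "\<F> = pent_set R t p s q r" "\<F> = pent_set R q r t p s"
    unfolding h(2) pent_set_def by (simp_all add: insert_commute)
  moreover have "w = pent_tri R p q r \<or> w = pent_tri R r p s \<or> w = pent_tri R s r t \<or>
      w = pent_tri R t s q \<or> w = pent_tri R q t p"
    using assms(2) unfolding h(2) pent_set_def by blast
  ultimately show thesis using h rot that by metis
qed

text \<open>
  By a rotation of the pentagon, \<open>w\<close> may be taken to be the triangulation by the diagonals from
  the first vertex.
\<close>

lemma pent_family_member:
  assumes "pent_family \<F> R" "w \<in> \<F>"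
  obtains A B where "w \<in> vertices" "R \<subseteq> w" "A \<noteq> B" "w - R = {A, B}" "share_triangle w A B"
    "flip w A \<in> \<F>" "flip w B \<in> \<F>"
proof -
  obtain p s q r t where h: "pent R p s q r t" "\<F> = pent_set R p s q r t" "w = pent_tri R p q r"
    using pent_familyE[OF assms] .
  have "geodesic p q \<noteq> geodesic p r"
    using pent_distinct[OF h(1)] pent_norm[OF h(1)] by (auto simp: doubleton_eq_iff)
  moreover have "share_triangle w (geodesic p q) (geodesic p r)"
    unfolding share_triangle_def
  proof
    show "{p, q, r} \<in> triangles_of w" using h by (simp add: pent_def)
    show "is_side (geodesic p q) {p, q, r} \<and> is_side (geodesic p r) {p, q, r}"
      using pent_distinct[OF h(1)] unfolding is_side_def by auto
  qed
  moreover have "flip w (geodesic p q) \<in> \<F>" "flip w (geodesic p r) \<in> \<F>"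
    using pent_flips[OF h(1)] h by (simp_all add: pent_set_def)
  moreover have "w - R = {geodesic p q, geodesic p r}" "R \<subseteq> w" "w \<in> vertices"
    using h by (auto simp: pent_def pent_tri_def)
  ultimately show thesis using that by metis
qed

text \<open>
  A triangulation is determined by its two diagonals, and the five diagonals are distinct.
\<close>

lemma pent_family_card:
  assumes "pent_family \<F> R"
  shows "card \<F> = 5"
proof -
  obtain p s q r t where h: "pent R p s q r t" "\<F> = pent_set R p s q r t"
    using assms by (auto simp: pent_family_def)
  note d = pent_distinct[OF h(1)] and n = pent_norm[OF h(1)]
  have R: "geodesic p q \<notin> R" "geodesic p r \<notin> R" "geodesic r s \<notin> R" "geodesic s t \<notin> R" "geodesic t q \<notin> R"
    using h(1) pent_rotations[OF h(1)] by (auto simp: pent_def)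
  define f where "f D = D \<union> R" for D
  have inj: "D = D'" if "f D = f D'" "D \<inter> R = {}" "D' \<inter> R = {}" for D D' using that unfolding f_def by blast
  let ?D = "{{geodesic p q, geodesic p r}, {geodesic p r, geodesic r s}, {geodesic r s, geodesic s t},
    {geodesic s t, geodesic t q}, {geodesic t q, geodesic p q}}"
  have "\<F> = f ` ?D"
    unfolding h(2) pent_set_def pent_tri_def f_def by (simp add: open_segment_commute insert_commute)
  moreover have "inj_on f ?D"
  proof (rule inj_onI)
    have disj: "\<forall>D\<in>?D. D \<inter> R = {}"
      using R by (simp only: ball_simps Int_insert_left if_False Int_empty_left simp_thms)
    show "D = D'" if "D \<in> ?D" "D' \<in> ?D" "f D = f D'" for D D'
      by (rule inj[OF that(3) bspec[OF disj that(1)] bspec[OF disj that(2)]])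
  qed
  moreover have "card ?D = 5"
  proof -
    have pairs: "card {{a, b}, {b, c}, {c, e}, {e, f}, {f, a}} = 5" if "distinct [a, b, c, e, f]"
      for a b c e f :: "complex set"
      using that by (auto simp: card_insert_if doubleton_eq_iff)
    have "distinct [geodesic p q, geodesic p r, geodesic r s, geodesic s t, geodesic t q]"
      using d n by (auto simp: doubleton_eq_iff)
    then show ?thesis by (rule pairs)
  qed
  ultimately show ?thesis by (metis card_image)
qed

text \<open>
  Two sides of a triangle have a common end point \<open>p\<close>. The triangle itself and its neighbours
  across the two sides form the pentagon.
\<close>

lemma share_triangle_pent:
  assumes v: "v \<in> vertices" and ab: "a \<in> v" "b \<in> v" "a \<noteq> b" and sh: "share_triangle v a b"
  obtains R p s q r t where "pent R p s q r t" "v = pent_tri R p q r" "{a, b} = {geodesic p q, geodesic p r}" "R = v - {a, b}"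
proof -
  note vt = vertex_triangulation[OF v]
  obtain T where T: "T \<in> triangles_of v" "is_side a T" "is_side b T" using sh by (auto simp: share_triangle_def)
  obtain x y z where xyz: "T = {x, y, z}" "ccw x y z" using T(1) by (rule triangles_of_ccwE)
  have side: "c = geodesic x y \<or> c = geodesic x z \<or> c = geodesic y z" if "is_side c T" for c
    using that unfolding is_side_def xyz(1) by (auto simp: open_segment_commute)
  have "{a, b} = {geodesic x y, geodesic x z} \<or> {a, b} = {geodesic y z, geodesic y x} \<or> {a, b} = {geodesic z x, geodesic z y}"
  proof -
    have pairs: "{a, b} = {X, Y} \<or> {a, b} = {Z, X} \<or> {a, b} = {Y, Z}"
      if "a = X \<or> a = Y \<or> a = Z" "b = X \<or> b = Y \<or> b = Z" for X Y Z
      using that ab(3) by (elim disjE) (simp_all add: insert_commute)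
    show ?thesis
      using pairs[OF side[OF T(2)] side[OF T(3)]]
      unfolding open_segment_commute[of y x] open_segment_commute[of z x] open_segment_commute[of z y] .
  qed
  moreover have "T = {y, z, x}" "T = {z, x, y}" "ccw y z x" "ccw z x y" using xyz ccw_rot by auto
  ultimately obtain p q r where pqr: "T = {p, q, r}" "ccw p q r" "{a, b} = {geodesic p q, geodesic p r}"
    using xyz by metis
  note n = ccw_on_circle[OF pqr(2)]
  have e: "geodesic q p \<in> v" "geodesic p r \<in> v" "geodesic p q \<in> v"
    using ab pqr(3) by (metis insertCI open_segment_commute singletonD insertE)+
  obtain s where s: "ccw q p s" "{q, p, s} \<in> triangles_of v" using triangle_on_left[OF v e(1)] n by metis
  obtain t where t: "ccw p r t" "{p, r, t} \<in> triangles_of v" using triangle_on_left[OF v e(2)] n by metis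
  have R: "v = pent_tri (v - {a, b}) p q r" using e pqr(3) unfolding pent_tri_def pqr(3) by blast
  have "pent (v - {a, b}) p s q r t"
    unfolding pent_def R[symmetric]
  proof (intro conjI)
    show "{p, s, q} \<in> triangles_of v" using s(2) by (simp add: insert_commute)
    show "{p, q, r} \<in> triangles_of v" using T(1) pqr(1) by simp
    show "geodesic p q \<notin> v - {a, b}" "geodesic p r \<notin> v - {a, b}" using pqr(3) by auto
    show "ccw p s q" using s(1) by (rule ccw_rot)
  qed (use v pqr t in auto)
  then show thesis using that[of "v - {a, b}" p s q r t] R pqr by blast
qed

lemma pent_crossing:
  assumes h: "pent R p s q r t" and w: "noncrossing w"
  shows "\<not> (geodesic p q \<in> w \<and> geodesic r s \<in> w)" "\<not> (geodesic p q \<in> w \<and> geodesic s t \<in> w)"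
  using noncrossing_ccw[OF w, of p q r s] noncrossing_ccw[OF w, of p q t s] pent_ccw[OF h]
  by (auto simp: open_segment_commute)

lemma pent_sides:
  assumes h: "pent R p s q r t"
  shows "geodesic p s \<in> R" "geodesic s q \<in> R" "geodesic q r \<in> R" "geodesic r t \<in> R" "geodesic t p \<in> R"
proof -
  have side: "geodesic p s \<in> R" "geodesic t p \<in> R" if h: "pent R p s q r t" for p s q r t
  proof -
    have "{p, s, q} \<in> triangles_of (pent_tri R p q r)" "{p, r, t} \<in> triangles_of (pent_tri R p q r)" "pent_tri R p q r \<in> vertices"
      using h by (simp_all add: pent_def)
    then have "geodesic p s \<in> pent_tri R p q r" "geodesic t p \<in> pent_tri R p q r"
      using mem_triangles_of_iff[OF vertex_triangulation] by blast+
    then show "geodesic p s \<in> R" "geodesic t p \<in> R"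
      using pent_distinct[OF h] pent_norm[OF h] by (auto simp: pent_tri_def doubleton_eq_iff)
  qed
  show "geodesic p s \<in> R" "geodesic s q \<in> R" "geodesic q r \<in> R" "geodesic r t \<in> R" "geodesic t p \<in> R"
    using side[OF h] side[OF pent_rotations(1)[OF h]] side[OF pent_rotations(2)[OF h]]
      side[OF pent_rotations(4)[OF h]] by auto
qed

lemma pentagon_points_pent:
  assumes h: "pent R p s q r t" and ab: "{a, b} = {geodesic p q, geodesic p r}"
  shows "pentagon_points (pent_tri R p q r) a b = {p, s, q, r, t}"
proof -
  let ?v = "pent_tri R p q r"
  note d = pent_distinct[OF h] and n = pent_norm[OF h]
  have v: "?v \<in> vertices" and T: "{p, q, s} \<in> triangles_of ?v" "{p, q, r} \<in> triangles_of ?v" "{p, r, q} \<in> triangles_of ?v" "{p, r, t} \<in> triangles_of ?v"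
    using h by (auto simp: pent_def insert_commute)
  note vt = vertex_triangulation[OF v]
  have third: "T = {x, y, y1} \<or> T = {x, y, y2}"
    if T: "T \<in> triangles_of ?v" "is_side (geodesic x y) T" "{x, y, y1} \<in> triangles_of ?v" "{x, y, y2} \<in> triangles_of ?v" "y1 \<noteq> y2"
    for T x y y1 y2
  proof -
    obtain i j k where ijk: "T = {i, j, k}" "ccw i j k" using T(1) by (rule triangles_of_ccwE)
    note c = ccw_on_circle[OF ijk(2)] ccw_distinct[OF ijk(2)]
    have xy: "norm x = 1" "norm y = 1" "x \<noteq> y" using T(3) mem_triangles_of_iff[OF vt] by auto
    obtain g h where gh: "g \<in> T" "h \<in> T" "g \<noteq> h" "geodesic x y = geodesic g h" using T(2) by (auto simp: is_side_def)
    have "norm g = 1" "norm h = 1" using gh c ijk(1) by auto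
    then have "{x, y} = {g, h}" using gh xy geodesic_eq_iff by metis
    then have "{x, y} \<subseteq> T" using gh by auto
    then obtain z where z: "T = {x, y, z}" using xy(3) unfolding ijk(1) by (auto simp: insert_commute)
    then show ?thesis using third_vertex_cases[OF vt T(3,4,5)] T(1) by auto
  qed
  have "{T \<in> triangles_of ?v. is_side a T \<or> is_side b T} = {{p, q, s}, {p, q, r}, {p, r, t}}"
  proof (intro equalityI subsetI)
    fix T assume "T \<in> {T \<in> triangles_of ?v. is_side a T \<or> is_side b T}"
    then have T': "T \<in> triangles_of ?v" "is_side (geodesic p q) T \<or> is_side (geodesic p r) T"
      using ab by (auto simp: doubleton_eq_iff)
    have "T = {p, q, s} \<or> T = {p, q, r} \<or> T = {p, r, q} \<or> T = {p, r, t}"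
    proof -
      have "s \<noteq> r" "q \<noteq> t" using d by auto
      then show ?thesis using third[OF T'(1) _ T(1,2)] third[OF T'(1) _ T(3,4)] T'(2) by metis
    qed
    then show "T \<in> {{p, q, s}, {p, q, r}, {p, r, t}}" by (auto simp: insert_commute)
  next
    fix T assume "T \<in> {{p, q, s}, {p, q, r}, {p, r, t}}"
    moreover have "is_side (geodesic p q) {p, q, s}" "is_side (geodesic p q) {p, q, r}" "is_side (geodesic p r) {p, r, t}"
      using d unfolding is_side_def by auto
    ultimately show "T \<in> {T \<in> triangles_of ?v. is_side a T \<or> is_side b T}"
      using T ab by (auto simp: doubleton_eq_iff)
  qed
  then show ?thesis unfolding pentagon_points_def by auto
qed

text \<open>
  The forbidden pairs leave only neighbours in the cyclic sequence \<open>a, b, c, d, e\<close> compatible,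
  and no three of these five are pairwise neighbours.
\<close>

lemma pentagon_independent:
  assumes "w \<subseteq> R \<union> {a, b, c, d, e}"
    and no: "\<not> (a \<in> w \<and> c \<in> w)" "\<not> (a \<in> w \<and> d \<in> w)" "\<not> (b \<in> w \<and> d \<in> w)"
      "\<not> (b \<in> w \<and> e \<in> w)" "\<not> (c \<in> w \<and> e \<in> w)"
  shows "w \<subseteq> insert a (insert b R) \<or> w \<subseteq> insert b (insert c R) \<or> w \<subseteq> insert c (insert d R) \<or>
    w \<subseteq> insert d (insert e R) \<or> w \<subseteq> insert e (insert a R)"
proof -
  have sub: "w \<subseteq> insert x (insert y R)" if "\<forall>z\<in>w. z \<in> {a, b, c, d, e} \<longrightarrow> z = x \<or> z = y" for x y
  proof
    fix z assume z: "z \<in> w"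
    then have "z \<in> R \<or> z \<in> {a, b, c, d, e}" using assms(1) by (meson Un_iff subsetD)
    then show "z \<in> insert x (insert y R)" using bspec[OF that z] by (metis insertI1 insertI2)
  qed
  consider "a \<in> w" "b \<in> w" | "a \<in> w" "b \<notin> w" | "a \<notin> w" "b \<in> w" | "a \<notin> w" "b \<notin> w" "c \<in> w" | "a \<notin> w" "b \<notin> w" "c \<notin> w"
    by blast
  then show ?thesis
  proof cases
    case 1
    then have "w \<subseteq> insert a (insert b R)" using no by (intro sub) blast
    then show ?thesis by - (rule disjI1, assumption)
  next
    case 2
    then have "w \<subseteq> insert e (insert a R)" using no by (intro sub) blast
    then show ?thesis by - (rule disjI2, rule disjI2, rule disjI2, rule disjI2, assumption)
  next
    case 3
    then have "w \<subseteq> insert b (insert c R)" using no by (intro sub) blast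
    then show ?thesis by - (rule disjI2, rule disjI1, assumption)
  next
    case 4
    then have "w \<subseteq> insert c (insert d R)" using no by (intro sub) blast
    then show ?thesis by - (rule disjI2, rule disjI2, rule disjI1, assumption)
  next
    case 5
    then have "w \<subseteq> insert d (insert e R)" using no by (intro sub) blast
    then show ?thesis by - (rule disjI2, rule disjI2, rule disjI2, rule disjI1, assumption)
  qed
qed

text \<open>
  A triangulation that keeps \<open>R\<close> adds pairwise non-crossing diagonals, hence is contained in one
  of the five, and equal to it because triangulations are maximal.
\<close>

lemma pentagon_triangulations_pent:
  assumes h: "pent R p s q r t" and ab: "{a, b} = {geodesic p q, geodesic p r}"
  shows "pentagon_triangulations (pent_tri R p q r) a b = pent_set R p s q r t"
proof -
  let ?v = "pent_tri R p q r" and ?G = "{geodesic x y | x y. x \<in> {p, s, q, r, t} \<and> y \<in> {p, s, q, r, t} \<and> x \<noteq> y}"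
  let ?W = "{w. ideal_triangulation w \<and> (\<exists>S\<subseteq>?G. w = R \<union> S)}"
  note rot = pent_rotations[OF h] and d = pent_distinct[OF h]
  have R: "?v - {a, b} = R" using h unfolding ab pent_def pent_tri_def by auto
  have Pi: "pentagon_triangulations ?v a b = ?W"
    unfolding pentagon_triangulations_def pentagon_points_pent[OF h ab] R ..
  show ?thesis
  proof (intro equalityI subsetI)
    fix w assume w: "w \<in> pent_set R p s q r t"
    have it: "ideal_triangulation (pent_tri R x y z)" if "pent R x u y z u'" for x u y z u'
      using that vertex_triangulation by (simp add: pent_def)
    have geo: "geodesic x y \<in> ?G" if "x \<in> {p, s, q, r, t}" "y \<in> {p, s, q, r, t}" "x \<noteq> y" for x y
      using that by blast
    have mem: "pent_tri R x y z \<in> ?W"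
      if "pent R x u y z u'" "x \<in> {p, s, q, r, t}" "y \<in> {p, s, q, r, t}" "z \<in> {p, s, q, r, t}" "x \<noteq> y" "x \<noteq> z" for x u y z u'
    proof -
      have "pent_tri R x y z = R \<union> {geodesic x y, geodesic x z}" by (auto simp: pent_tri_def)
      moreover have "{geodesic x y, geodesic x z} \<subseteq> ?G" using geo[of x y] geo[of x z] that by simp
      ultimately show ?thesis using it[OF that(1)] by blast
    qed
    show "w \<in> pentagon_triangulations ?v a b"
    proof -
      have "pent_tri R p q r \<in> ?W" "pent_tri R r p s \<in> ?W" "pent_tri R s r t \<in> ?W" "pent_tri R t s q \<in> ?W" "pent_tri R q t p \<in> ?W"
        by (rule mem[OF h] mem[OF rot(1)] mem[OF rot(2)] mem[OF rot(3)] mem[OF rot(4)]; use d in auto)+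
      then show ?thesis using w unfolding Pi pent_set_def by blast
    qed
  next
    fix w assume "w \<in> pentagon_triangulations ?v a b"
    then obtain S where w: "ideal_triangulation w" "S \<subseteq> ?G" "w = R \<union> S" unfolding Pi by blast
    note w' = ideal_triangulation_noncrossing[OF w(1)]
    define U where "U = R \<union> {geodesic p q, geodesic p r, geodesic r s, geodesic s t, geodesic t q}"
    have U1: "geodesic p s \<in> U" "geodesic s q \<in> U" "geodesic q r \<in> U" "geodesic r t \<in> U" "geodesic t p \<in> U"
      "geodesic p q \<in> U" "geodesic p r \<in> U" "geodesic r s \<in> U" "geodesic s t \<in> U" "geodesic t q \<in> U"
      using pent_sides[OF h] unfolding U_def by blast+
    note U2 = U1[unfolded open_segment_commute[of p s] open_segment_commute[of s q] open_segment_commute[of q r]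
        open_segment_commute[of r t] open_segment_commute[of t p] open_segment_commute[of p q]
        open_segment_commute[of p r] open_segment_commute[of r s] open_segment_commute[of s t] open_segment_commute[of t q]]
    have GU: "\<forall>x\<in>{p, s, q, r, t}. \<forall>y\<in>{p, s, q, r, t}. x \<noteq> y \<longrightarrow> geodesic x y \<in> U"
      by (simp only: ball_simps U1 U2 simp_thms)
    have "?G \<subseteq> U"
    proof
      fix g assume "g \<in> ?G"
      then obtain x y where xy: "x \<in> {p, s, q, r, t}" "y \<in> {p, s, q, r, t}" "x \<noteq> y" and g: "g = geodesic x y"
        unfolding mem_Collect_eq by (elim exE conjE)
      show "g \<in> U" unfolding g using bspec[OF bspec[OF GU xy(1)] xy(2)] xy(3) by (rule mp)
    qed
    moreover have "R \<subseteq> U" unfolding U_def by (rule Un_upper1)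
    ultimately have "w \<subseteq> U" unfolding w(3) by (intro Un_least subset_trans[OF w(2)])
    then have sub: "w \<subseteq> R \<union> {geodesic p q, geodesic p r, geodesic r s, geodesic s t, geodesic t q}" unfolding U_def .
    have cr: "\<not> (geodesic p q \<in> w \<and> geodesic r s \<in> w)" "\<not> (geodesic p q \<in> w \<and> geodesic s t \<in> w)"
       "\<not> (geodesic p r \<in> w \<and> geodesic s t \<in> w)" "\<not> (geodesic p r \<in> w \<and> geodesic t q \<in> w)"
       "\<not> (geodesic r s \<in> w \<and> geodesic t q \<in> w)"
      using pent_crossing[OF h w'] pent_crossing[OF rot(1) w'] pent_crossing[OF rot(2) w']
      by (auto simp: open_segment_commute)
    have max: "w = pent_tri R x y z" if "pent R x u y z u'" "w \<subseteq> pent_tri R x y z" for x u y z u'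
      using that triangulation_subset_eq[OF w(1)] vertex_triangulation ideal_triangulation_noncrossing
      unfolding pent_def by blast
    have "w \<subseteq> pent_tri R p q r \<or> w \<subseteq> pent_tri R r p s \<or> w \<subseteq> pent_tri R s r t \<or> w \<subseteq> pent_tri R t s q \<or> w \<subseteq> pent_tri R q t p"
    proof -
      show ?thesis
        unfolding pent_tri_def open_segment_commute[of r p] open_segment_commute[of s r]
          open_segment_commute[of t s] open_segment_commute[of q t] open_segment_commute[of q p]
        by (rule pentagon_independent[OF sub cr])
    qed
    then show "w \<in> pent_set R p s q r t"
      unfolding pent_set_def using max[OF h] max[OF rot(1)] max[OF rot(2)] max[OF rot(3)] max[OF rot(4)] by auto
  qed
qed

text \<open>
  Each of the five triangulations is an end point of some edge of the cycle, so the cycle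
  determines the set of its vertices.
\<close>

lemma Union_pentagon_cycle:
  assumes "pent_family \<F> R"
  shows "\<Union>{{w, w'} | w w'. w \<in> \<F> \<and> w' \<in> \<F> \<and> adj w w'} = \<F>"
proof (intro equalityI subsetI)
  fix w assume w: "w \<in> \<F>"
  obtain A B where "w \<in> vertices" "w - R = {A, B}" "flip w A \<in> \<F>"
    using pent_family_member[OF assms w] by metis
  moreover have "A \<in> w" using \<open>w - R = {A, B}\<close> by auto
  ultimately have "adj w (flip w A)" "flip w A \<in> \<F>" using adj_iff_flip by auto
  then show "w \<in> \<Union>{{w, w'} | w w'. w \<in> \<F> \<and> w' \<in> \<F> \<and> adj w w'}" using w by blast
qed auto

lemma pentagon_cycle_family:
  assumes "c \<in> pentagon_cycles"
  obtains \<F> R where "pent_family \<F> R" "\<Union>c = \<F>"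
proof -
  obtain v a b where vab: "v \<in> vertices" "a \<in> v" "b \<in> v" "a \<noteq> b" "share_triangle v a b"
    and c: "c = {{w, w'} | w w'. w \<in> pentagon_triangulations v a b \<and> w' \<in> pentagon_triangulations v a b \<and> adj w w'}"
    using assms unfolding pentagon_cycles_def mem_Collect_eq by (elim exE conjE)
  obtain R p s q r t where h: "pent R p s q r t" "v = pent_tri R p q r" "{a, b} = {geodesic p q, geodesic p r}"
    using share_triangle_pent[OF vab] by metis
  have P: "pentagon_triangulations v a b = pent_set R p s q r t"
    unfolding h(2) by (rule pentagon_triangulations_pent[OF h(1,3)])
  have f: "pent_family (pent_set R p s q r t) R" using h(1) unfolding pent_family_def by blast
  show thesis
    by (rule that[OF f]) (unfold c P, rule Union_pentagon_cycle[OF f])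
qed

lemma share_triangle_cycle:
  assumes v: "v \<in> vertices" and ab: "a \<in> v" "b \<in> v" "a \<noteq> b" and sh: "share_triangle v a b"
  obtains c where "c \<in> pentagon_cycles" "pent_family (\<Union>c) (v - {a, b})" "v \<in> \<Union>c"
proof -
  obtain R p s q r t where h: "pent R p s q r t" "v = pent_tri R p q r" "{a, b} = {geodesic p q, geodesic p r}" "R = v - {a, b}"
    using share_triangle_pent[OF assms] .
  have P: "pentagon_triangulations v a b = pent_set R p s q r t"
    unfolding h(2) by (rule pentagon_triangulations_pent[OF h(1,3)])
  define c where "c = {{w, w'} | w w'. w \<in> pentagon_triangulations v a b \<and> w' \<in> pentagon_triangulations v a b \<and> adj w w'}"
  have f: "pent_family (pent_set R p s q r t) R" using h(1) unfolding pent_family_def by blast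
  have "\<Union>c = pent_set R p s q r t" unfolding c_def P by (rule Union_pentagon_cycle[OF f])
  moreover have "c \<in> pentagon_cycles" using assms unfolding c_def pentagon_cycles_def by blast
  moreover have "v \<in> pent_set R p s q r t" using h(2) by (simp add: pent_set_def)
  ultimately show thesis using that f h(4) by metis
qed

lemma pent_family_adj:
  assumes P: "pent_family \<F> R" "v \<in> \<F>" "w \<in> \<F>" "adj v w"
  obtains a where "a \<in> v - R" "w = flip v a"
proof -
  obtain A B where v: "v \<in> vertices" "R \<subseteq> v" "v - R = {A, B}" using pent_family_member[OF P(1,2)] by metis
  have "R \<subseteq> w" using pent_family_member[OF P(1,3)] by metis
  moreover obtain a where a: "a \<in> v" "w = flip v a" using P(4) adj_iff_flip[OF v(1)] by blast
  moreover have "a \<notin> flip v a" using flipE[OF v(1) a(1)] by metis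
  ultimately show thesis using that by blast
qed

lemma share_triangle_sym: "share_triangle v a b \<Longrightarrow> share_triangle v b a"
  by (auto simp: share_triangle_def)

text \<open>
  Two neighbours of \<open>v\<close> in a pentagonal cell arise by flipping the two arcs of \<open>v\<close> that are not
  in the common complement \<open>R\<close>.
\<close>

lemma link_adj_iff:
  assumes v: "v \<in> vertices"
  shows "link_adj v x y \<longleftrightarrow>
    (\<exists>a\<in>v. \<exists>b\<in>v. a \<noteq> b \<and> share_triangle v a b \<and> x = flip v a \<and> y = flip v b)"
proof
  assume l: "link_adj v x y"
  then obtain c where c: "c \<in> pentagon_cycles" "{v, x, y} \<subseteq> \<Union>c" and xy: "adj v x" "adj v y" "x \<noteq> y"
    by (auto simp: link_adj_def)
  obtain \<F> R where P: "pent_family \<F> R" "\<Union>c = \<F>" using pentagon_cycle_family[OF c(1)] .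
  have m: "v \<in> \<F>" "x \<in> \<F>" "y \<in> \<F>" using c P by auto
  obtain a where a: "a \<in> v - R" "x = flip v a" using pent_family_adj[OF P(1) m(1,2) xy(1)] .
  obtain b where b: "b \<in> v - R" "y = flip v b" using pent_family_adj[OF P(1) m(1,3) xy(2)] .
  obtain A B where AB: "v - R = {A, B}" "share_triangle v A B" using pent_family_member[OF P(1) m(1)] by metis
  have "a \<noteq> b" using a b xy by auto
  then have "share_triangle v a b" using a b AB share_triangle_sym by auto
  then show "\<exists>a\<in>v. \<exists>b\<in>v. a \<noteq> b \<and> share_triangle v a b \<and> x = flip v a \<and> y = flip v b"
    using a b \<open>a \<noteq> b\<close> by blast
next
  assume "\<exists>a\<in>v. \<exists>b\<in>v. a \<noteq> b \<and> share_triangle v a b \<and> x = flip v a \<and> y = flip v b"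
  then obtain a b where ab: "a \<in> v" "b \<in> v" "a \<noteq> b" "share_triangle v a b" and xy: "x = flip v a" "y = flip v b" by blast
  obtain c where c: "c \<in> pentagon_cycles" "pent_family (\<Union>c) (v - {a, b})" "v \<in> \<Union>c"
    using share_triangle_cycle[OF v ab] .
  obtain A B where "v - (v - {a, b}) = {A, B}" "flip v A \<in> \<Union>c" "flip v B \<in> \<Union>c"
    using pent_family_member[OF c(2,3)] by metis
  moreover have "v - (v - {a, b}) = {a, b}" using ab by auto
  ultimately have "x \<in> \<Union>c" "y \<in> \<Union>c" using xy by (auto simp: doubleton_eq_iff)
  moreover have "x \<noteq> y" using flip_inj[OF v ab(1,2)] xy ab(3) by auto
  moreover have "adj v x" "adj v y" using xy ab adj_iff_flip[OF v] by auto
  ultimately show "link_adj v x y" using c unfolding link_adj_def by blast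
qed

section \<open>The action of an automorphism on arcs\<close>

lemma share_triangle_geodesics:
  assumes v: "v \<in> vertices" and ab: "geodesic x y \<in> v" "b \<in> v" "geodesic x y \<noteq> b"
    and n: "norm x = 1" "norm y = 1" and sh: "share_triangle v (geodesic x y) b"
  obtains t where "{x, y, t} \<in> triangles_of v" "b = geodesic x t \<or> b = geodesic y t"
proof -
  obtain R p s q r u where h: "pent R p s q r u" "v = pent_tri R p q r" "{geodesic x y, b} = {geodesic p q, geodesic p r}"
    using share_triangle_pent[OF v ab sh] by metis
  note d = pent_distinct[OF h(1)] and m = pent_norm[OF h(1)]
  have T: "{p, q, r} \<in> triangles_of v" using h by (simp add: pent_def)
  have xy: "x \<noteq> y" using ab(1) n v vertex_noncrossing[OF v] geodesic_in_arcsD(3)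
    by (auto simp: noncrossing_def)
  from h(3) consider "geodesic x y = geodesic p q" "b = geodesic p r" | "geodesic x y = geodesic p r" "b = geodesic p q"
    by (auto simp: doubleton_eq_iff)
  then show thesis
  proof cases
    case 1
    then have e: "{x, y} = {p, q}" using geodesic_eq_iff[of x y p q] n m xy d by simp
    then have "{x, y, r} = {p, q, r}" by auto
    then show thesis using that[of r] T 1 e by (auto simp: doubleton_eq_iff)
  next
    case 2
    then have e: "{x, y} = {p, r}" using geodesic_eq_iff[of x y p r] n m xy d by simp
    then have "{x, y, q} = {p, q, r}" by auto
    then show thesis using that[of q] T 2 e by (auto simp: doubleton_eq_iff)
  qed
qed

text \<open>
  If \<open>a = pq\<close> and \<open>b = qr\<close> and the third arc is not \<open>rp\<close>, then it ends in \<open>q\<close>, say \<open>c = qt\<close>. The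
  common triangles contain all arcs between \<open>p, q, r, t\<close>, which is impossible without crossings.
\<close>

lemma pairwise_share_triangle:
  assumes v: "v \<in> vertices" and abc: "a \<in> v" "b \<in> v" "c \<in> v" "a \<noteq> b" "b \<noteq> c" "c \<noteq> a"
    and sh: "share_triangle v a b" "share_triangle v b c" "share_triangle v c a"
  obtains p q r where "{p, q, r} \<in> triangles_of v" "a = geodesic p q" "b = geodesic q r" "c = geodesic r p"
proof -
  note vt = vertex_triangulation[OF v]
  note v' = vertex_noncrossing[OF v]
  note concl = that
  obtain R q u p r w where h: "pent R q u p r w" "v = pent_tri R q p r" "{a, b} = {geodesic q p, geodesic q r}"
    using share_triangle_pent[OF v abc(1,2,4) sh(1)] by metis
  have T0: "{q, p, r} \<in> triangles_of v" using h by (simp add: pent_def)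
  have main: thesis
    if T: "{p, q, r} \<in> triangles_of v" and a: "a = geodesic p q" and b: "b = geodesic q r" for p q r
  proof -
    have n: "norm p = 1" "norm q = 1" "norm r = 1" and d: "p \<noteq> q" "q \<noteq> r" "p \<noteq> r"
      and e: "geodesic p q \<in> v" "geodesic q r \<in> v" "geodesic r p \<in> v"
      using T mem_triangles_of_iff[OF vt] by auto
    obtain t where t: "{q, r, t} \<in> triangles_of v" "c = geodesic q t \<or> c = geodesic r t"
      using share_triangle_geodesics[OF v, of q r c] abc sh b n by auto
    obtain u where u: "{p, q, u} \<in> triangles_of v" "c = geodesic p u \<or> c = geodesic q u"
      using share_triangle_geodesics[OF v, of p q c] abc share_triangle_sym[OF sh(3)] a n by auto
    have t': "norm t = 1" "q \<noteq> t" "r \<noteq> t" "geodesic r t \<in> v" "geodesic t q \<in> v"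
      and u': "norm u = 1" "p \<noteq> u" "q \<noteq> u" "geodesic q u \<in> v" "geodesic u p \<in> v"
      using t(1) u(1) mem_triangles_of_iff[OF vt] by auto
    have *: "{x, y} = {x', y'}" if "c = geodesic x y" "c = geodesic x' y'" "norm x = 1" "norm y = 1" "norm x' = 1" "norm y' = 1" "x \<noteq> y" "x' \<noteq> y'"
      for x y x' y' using that geodesic_eq_iff[of x y x' y'] by simp
    consider "c = geodesic r t" "c = geodesic p u" | "c = geodesic r t" "c = geodesic q u"
      | "c = geodesic q t" "c = geodesic p u" | "c = geodesic q t" "c = geodesic q u"
      using t(2) u(2) by blast
    then show thesis
    proof cases
      case 1
      then have "{r, t} = {p, u}" using * n t' u' by blast
      then have "c = geodesic r p" using d 1 by (auto simp: doubleton_eq_iff)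
      then show thesis using concl[OF T a b] by simp
    next
      case 2
      then have "{r, t} = {q, u}" using * n t' u' by blast
      then show thesis using d t' by (auto simp: doubleton_eq_iff)
    next
      case 3
      then have "{q, t} = {p, u}" using * n t' u' by blast
      then show thesis using d u' by (auto simp: doubleton_eq_iff)
    next
      case 4
      then have "{q, t} = {q, u}" using * n t' u' by blast
      then have "t = u" using u' by (auto simp: doubleton_eq_iff)
      \<comment> \<open>The three common triangles contain all six arcs between \<open>p, q, r, t\<close>.\<close>
      then show thesis
        using no_noncrossing_K4[OF v' n(1,2,3) t'(1)] e t' u' by (metis open_segment_commute)
    qed
  qed
  from h(3) consider "a = geodesic p q" "b = geodesic q r" | "a = geodesic r q" "b = geodesic q p"
    by (auto simp: doubleton_eq_iff open_segment_commute)
  then show thesis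
  proof cases
    case 1
    have "{p, q, r} \<in> triangles_of v" using T0 by (simp add: insert_commute)
    then show thesis using main 1 by blast
  next
    case 2
    have "{r, q, p} \<in> triangles_of v" using T0 by (simp add: insert_commute)
    then show thesis using main 2 by blast
  qed
qed

lemma aut_vertex: "cellular_automorphism \<phi> \<Longrightarrow> v \<in> vertices \<Longrightarrow> \<phi> v \<in> vertices"
  unfolding cellular_automorphism_def bij_betw_def by blast

lemma aut_inj: "cellular_automorphism \<phi> \<Longrightarrow> inj_on \<phi> vertices"
  unfolding cellular_automorphism_def bij_betw_def by blast

lemma aut_adj: "cellular_automorphism \<phi> \<Longrightarrow> adj v w \<Longrightarrow> adj (\<phi> v) (\<phi> w)"
  unfolding cellular_automorphism_def using adj_vertices by blast

lemma Union_map_cycle: "\<Union>(map_cycle \<phi> c) = \<phi> ` \<Union>c"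
  by (auto simp: map_cycle_def)

lemma card_square_cycle:
  assumes "c \<in> square_cycles" shows "card (\<Union>c) \<le> 4"
proof -
  obtain v w1 u w2 where "c = {{v, w1}, {w1, u}, {u, w2}, {w2, v}}"
    using assms unfolding square_cycles_def mem_Collect_eq by (elim exE conjE)
  then have "\<Union>c = set [v, w1, u, w2]" by auto
  then show ?thesis using card_length[of "[v, w1, u, w2]"] by simp
qed

text \<open>Cells with five vertices are pentagons, since squares have at most four.\<close>

lemma aut_pentagon:
  assumes \<phi>: "cellular_automorphism \<phi>" and c: "c \<in> pentagon_cycles"
  shows "map_cycle \<phi> c \<in> pentagon_cycles"
proof -
  obtain \<F> R where F: "pent_family \<F> R" "\<Union>c = \<F>" using pentagon_cycle_family[OF c] .
  have "\<F> \<subseteq> vertices" using pent_family_member[OF F(1)] by (metis subsetI)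
  then have "card (\<Union>(map_cycle \<phi> c)) = 5"
    unfolding Union_map_cycle F(2) using card_image inj_on_subset[OF aut_inj[OF \<phi>]] pent_family_card[OF F(1)] by metis
  moreover have "map_cycle \<phi> c \<in> cell_cycles"
    using \<phi> c unfolding cellular_automorphism_def cell_cycles_def by blast
  ultimately show ?thesis using card_square_cycle unfolding cell_cycles_def by fastforce
qed

lemma aut_link_adj:
  assumes \<phi>: "cellular_automorphism \<phi>" and l: "link_adj v x y"
  shows "link_adj (\<phi> v) (\<phi> x) (\<phi> y)"
proof -
  obtain c where c: "c \<in> pentagon_cycles" "{v, x, y} \<subseteq> \<Union>c" and xy: "adj v x" "adj v y" "x \<noteq> y"
    using l by (auto simp: link_adj_def)
  have "\<phi> x \<noteq> \<phi> y" using aut_inj[OF \<phi>] xy adj_vertices by (meson inj_onD)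
  moreover have "{\<phi> v, \<phi> x, \<phi> y} \<subseteq> \<Union>(map_cycle \<phi> c)" 
    using image_mono[OF c(2), of \<phi>] by (simp only: Union_map_cycle image_insert image_empty)
  ultimately show ?thesis
    unfolding link_adj_def using aut_adj[OF \<phi>] xy aut_pentagon[OF \<phi> c(1)] by blast
qed

definition arc_map :: "(complex set set \<Rightarrow> complex set set) \<Rightarrow> complex set set \<Rightarrow> complex set \<Rightarrow> complex set" where
  "arc_map \<phi> v a = (SOME A. A \<in> \<phi> v \<and> \<phi> (flip v a) = flip (\<phi> v) A)"

lemma arc_map:
  assumes "cellular_automorphism \<phi>" "v \<in> vertices" "a \<in> v"
  shows "arc_map \<phi> v a \<in> \<phi> v" "\<phi> (flip v a) = flip (\<phi> v) (arc_map \<phi> v a)"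
proof -
  have "adj v (flip v a)" using assms adj_iff_flip by blast
  then have "adj (\<phi> v) (\<phi> (flip v a))" by (rule aut_adj[OF assms(1)])
  then have "\<exists>A. A \<in> \<phi> v \<and> \<phi> (flip v a) = flip (\<phi> v) A"
    unfolding adj_iff_flip[OF aut_vertex[OF assms(1,2)]] Bex_def .
  then have "arc_map \<phi> v a \<in> \<phi> v \<and> \<phi> (flip v a) = flip (\<phi> v) (arc_map \<phi> v a)"
    unfolding arc_map_def by (rule someI_ex)
  then show "arc_map \<phi> v a \<in> \<phi> v" "\<phi> (flip v a) = flip (\<phi> v) (arc_map \<phi> v a)" by auto
qed

lemma arc_map_eqI:
  assumes "cellular_automorphism \<phi>" "v \<in> vertices" "a \<in> v" "A \<in> \<phi> v" "\<phi> (flip v a) = flip (\<phi> v) A"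
  shows "arc_map \<phi> v a = A"
  using flip_inj[OF aut_vertex[OF assms(1,2)] arc_map(1)[OF assms(1-3)] assms(4)] arc_map(2)[OF assms(1-3)] assms(5)
  by simp

lemma arc_map_inj:
  assumes "cellular_automorphism \<phi>" "v \<in> vertices" "a \<in> v" "b \<in> v" "arc_map \<phi> v a = arc_map \<phi> v b"
  shows "a = b"
proof -
  have "\<phi> (flip v a) = \<phi> (flip v b)" using arc_map(2) assms by metis
  then have "flip v a = flip v b"
    using aut_inj[OF assms(1)] flip_vertices assms by (meson inj_onD)
  then show ?thesis using flip_inj assms by blast
qed

lemma arc_map_share:
  assumes \<phi>: "cellular_automorphism \<phi>" and v: "v \<in> vertices" and ab: "a \<in> v" "b \<in> v" "a \<noteq> b" "share_triangle v a b"
  shows "share_triangle (\<phi> v) (arc_map \<phi> v a) (arc_map \<phi> v b)" "arc_map \<phi> v a \<noteq> arc_map \<phi> v b"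
proof -
  have "link_adj v (flip v a) (flip v b)"
    unfolding link_adj_iff[OF v] using ab by (intro bexI[of _ a] bexI[of _ b]) auto
  then have "link_adj (\<phi> v) (\<phi> (flip v a)) (\<phi> (flip v b))" by (rule aut_link_adj[OF \<phi>])
  then obtain A B where AB: "A \<in> \<phi> v" "B \<in> \<phi> v" "share_triangle (\<phi> v) A B" "\<phi> (flip v a) = flip (\<phi> v) A" "\<phi> (flip v b) = flip (\<phi> v) B"
    unfolding link_adj_iff[OF aut_vertex[OF \<phi> v]] by (elim bexE conjE)
  have "arc_map \<phi> v a = A" "arc_map \<phi> v b = B"
    using arc_map_eqI[OF \<phi> v ab(1) AB(1,4)] arc_map_eqI[OF \<phi> v ab(2) AB(2,5)] .
  then show "share_triangle (\<phi> v) (arc_map \<phi> v a) (arc_map \<phi> v b)" using AB by simp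
  show "arc_map \<phi> v a \<noteq> arc_map \<phi> v b" using arc_map_inj[OF \<phi> v ab(1,2)] ab(3) by blast
qed

text \<open>
  The flip of \<open>b\<close> in \<open>flip v a\<close> is the next vertex on the pentagon determined by \<open>v\<close>, \<open>a\<close> and
  \<open>b\<close>. Its image is the next vertex on the image pentagon, which is determined by \<open>\<phi> v\<close> and the
  images of \<open>a\<close> and \<open>b\<close>.
\<close>

lemma arc_map_flip:
  assumes \<phi>: "cellular_automorphism \<phi>" and v: "v \<in> vertices" and ab: "a \<in> v" "b \<in> v" "a \<noteq> b" "share_triangle v a b"
  shows "arc_map \<phi> (flip v a) b = arc_map \<phi> v b"
proof -
  let ?w = "flip v a" and ?A = "arc_map \<phi> v a" and ?B = "arc_map \<phi> v b"
  let ?X = "flip (\<phi> v) ?A"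
  note V = aut_vertex[OF \<phi> v]
  note A = arc_map[OF \<phi> v ab(1)] and B = arc_map[OF \<phi> v ab(2)] and ne = arc_map_share(2)[OF \<phi> v ab]
  have w: "?w \<in> vertices" using flip_vertices v ab by blast
  obtain a' where a': "?w = insert a' (v - {a})" "a' \<notin> v" "flip ?w a' = v" using flipE[OF v ab(1)] by metis
  obtain A' where A': "?X = insert A' (\<phi> v - {?A})" "A' \<notin> \<phi> v" "flip ?X A' = \<phi> v" "?X \<in> vertices"
    using flipE[OF V A(1)] by metis
  have bw: "b \<in> ?w" using flip_keeps v ab by blast
  obtain c where c: "c \<in> pentagon_cycles" "pent_family (\<Union>c) (v - {a, b})" "v \<in> \<Union>c"
    using share_triangle_cycle[OF v ab] .
  have R: "v - (v - {a, b}) = {a, b}" "?w - (v - {a, b}) = {a', b}" using ab a' by auto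
  have in_c: "flip u x \<in> \<Union>c" if "u \<in> \<Union>c" "x \<in> u - (v - {a, b})" for u x
    using pent_family_member[OF c(2) that(1)] that(2) by (metis insertE singletonD)
  have "?w \<in> \<Union>c" "flip v b \<in> \<Union>c" using in_c[OF c(3)] R by auto
  moreover have "flip ?w b \<in> \<Union>c" using in_c[OF \<open>?w \<in> \<Union>c\<close>] R(2) by auto
  ultimately have img: "\<phi> v \<in> \<Union>(map_cycle \<phi> c)" "?X \<in> \<Union>(map_cycle \<phi> c)" "flip (\<phi> v) ?B \<in> \<Union>(map_cycle \<phi> c)"
    "\<phi> (flip ?w b) \<in> \<Union>(map_cycle \<phi> c)"
    unfolding Union_map_cycle A(2)[symmetric] B(2)[symmetric] using c(3) by blast+
  obtain \<F> R' where F: "pent_family \<F> R'" "\<Union>(map_cycle \<phi> c) = \<F>"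
    using pentagon_cycle_family[OF aut_pentagon[OF \<phi> c(1)]] .
  have notR: "x \<notin> R'" if "x \<in> \<phi> v" "flip (\<phi> v) x \<in> \<F>" for x
  proof -
    have "R' \<subseteq> flip (\<phi> v) x" using pent_family_member[OF F(1) that(2)] by metis
    moreover have "x \<notin> flip (\<phi> v) x" using flipE[OF V that(1)] by metis
    ultimately show ?thesis by blast
  qed
  \<comment> \<open>The image pentagon contains \<open>\<phi> v\<close> and its flips at \<open>?A\<close> and \<open>?B\<close>, so these are its two diagonals in
    \<open>\<phi> v\<close>; after the flip of \<open>?A\<close> the diagonals are \<open>A'\<close> and \<open>?B\<close>.\<close>
  have AB: "?A \<notin> R'" "?B \<notin> R'" using notR A B img F by auto
  obtain C D where CD: "R' \<subseteq> \<phi> v" "\<phi> v - R' = {C, D}" using pent_family_member[OF F(1)] img(1) F(2) by metis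
  have "\<phi> v - R' = {?A, ?B}" using CD(2) AB A(1) B(1) ne by auto
  then have XR: "?X - R' \<subseteq> {A', ?B}" using A'(1) by auto
  have "adj ?w (flip ?w b)" using adj_iff_flip[OF w] bw by blast
  then have "adj ?X (\<phi> (flip ?w b))" using aut_adj[OF \<phi>] A(2) by metis
  then obtain x where x: "x \<in> ?X - R'" "\<phi> (flip ?w b) = flip ?X x"
    using pent_family_adj[OF F(1)] img F(2) by metis
  \<comment> \<open>Flipping \<open>A'\<close> leads back to \<open>\<phi> v\<close>, and flipping \<open>b\<close> in \<open>flip v a\<close> does not lead back to \<open>v\<close>.\<close>
  have "x \<noteq> A'"
  proof
    assume "x = A'"
    then have "\<phi> (flip ?w b) = \<phi> v" using x A'(3) by simp
    then have "flip ?w b = v" using aut_inj[OF \<phi>] flip_vertices[OF w bw] v by (meson inj_onD)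
    moreover have "a' \<in> ?w" using a'(1) by auto
    ultimately have "a' = b" using flip_inj[OF w _ bw] a'(3) by metis
    then show False using a'(2) ab(2) by simp
  qed
  then have "x = ?B" using x XR by blast
  then show ?thesis using arc_map_eqI[OF \<phi> w bw, of ?B] x A(2) by auto
qed

text \<open>
  Flipping the new diagonal leads back to \<open>v\<close>, and flipping its image leads back to \<open>\<phi> v\<close>.
\<close>

lemma arc_map_new_arc:
  assumes \<phi>: "cellular_automorphism \<phi>" and v: "v \<in> vertices"
    and T: "{p, q, r} \<in> triangles_of v" "{p, q, s} \<in> triangles_of v" "r \<noteq> s"
    and I: "arc_map \<phi> v (geodesic p q) = geodesic P Q" "{P, Q, R} \<in> triangles_of (\<phi> v)" "{P, Q, S} \<in> triangles_of (\<phi> v)" "R \<noteq> S"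
  shows "arc_map \<phi> (flip v (geodesic p q)) (geodesic r s) = geodesic R S"
proof -
  let ?w = "flip v (geodesic p q)" and ?W = "flip (\<phi> v) (geodesic P Q)"
  note V = aut_vertex[OF \<phi> v]
  note w = flip_eqI[OF v T] and W = flip_eqI[OF V I(2-4)]
  note F = flip_triangulation[OF vertex_triangulation[OF v] T w]
  note G = flip_triangulation[OF vertex_triangulation[OF V] I(2-4) W]
  have wv: "?w \<in> vertices" and Wv: "?W \<in> vertices" using flip_vertices v V F(5) G(5) by blast+
  have \<phi>w: "\<phi> ?w = ?W" using arc_map(2)[OF \<phi> v F(5)] I(1) by simp
  have fw: "flip ?w (geodesic r s) = v" using flip_eqI[OF wv F(3,4,8)] F(6) by simp
  have fW: "flip ?W (geodesic R S) = \<phi> v" using flip_eqI[OF Wv G(3,4,8)] G(6) by simp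
  show ?thesis
  proof (rule arc_map_eqI[OF \<phi> wv])
    show "geodesic r s \<in> ?w" unfolding w by (rule insertI1)
    show "geodesic R S \<in> \<phi> ?w" unfolding \<phi>w W by (rule insertI1)
    show "\<phi> (flip ?w (geodesic r s)) = flip (\<phi> ?w) (geodesic R S)" unfolding \<phi>w fw fW ..
  qed
qed

section \<open>Images of triangles and the orientation\<close>

text \<open>
  The labelling of the image triangle by \<open>P, Q, R\<close> is determined by the images of the three
  sides; whether it is counterclockwise is the sign of \<open>\<phi>\<close> on the triangle.
\<close>

definition triangle_image ::
  "(complex set set \<Rightarrow> complex set set) \<Rightarrow> complex set set \<Rightarrow> complex \<Rightarrow> complex \<Rightarrow> complex \<Rightarrow> complex \<Rightarrow> complex \<Rightarrow> complex \<Rightarrow> bool" where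
  "triangle_image \<phi> v p q r P Q R \<longleftrightarrow> {P, Q, R} \<in> triangles_of (\<phi> v) \<and>
    arc_map \<phi> v (geodesic p q) = geodesic P Q \<and> arc_map \<phi> v (geodesic q r) = geodesic Q R \<and>
    arc_map \<phi> v (geodesic r p) = geodesic R P"

lemma triangle_side_shares:
  assumes "ideal_triangulation v" "{p, q, r} \<in> triangles_of v"
  shows "share_triangle v (geodesic p q) (geodesic q r)" "geodesic p q \<noteq> geodesic q r"
proof -
  have d: "p \<noteq> q" "q \<noteq> r" "p \<noteq> r" using mem_triangles_of_iff[OF assms(1)] assms(2) by auto
  then have "is_side (geodesic p q) {p, q, r}" "is_side (geodesic q r) {p, q, r}" unfolding is_side_def by blast+
  then show "share_triangle v (geodesic p q) (geodesic q r)" using assms unfolding share_triangle_def by blast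
  show "geodesic p q \<noteq> geodesic q r" using d by (auto simp: doubleton_eq_iff)
qed

lemma triangle_image_exists:
  assumes \<phi>: "cellular_automorphism \<phi>" and v: "v \<in> vertices" and T: "{p, q, r} \<in> triangles_of v"
  obtains P Q R where "triangle_image \<phi> v p q r P Q R"
proof -
  note vt = vertex_triangulation[OF v]
  have e: "geodesic p q \<in> v" "geodesic q r \<in> v" "geodesic r p \<in> v" using T mem_triangles_of_iff[OF vt] by blast+
  have T': "{q, r, p} \<in> triangles_of v" "{r, p, q} \<in> triangles_of v" using T by (simp_all add: insert_commute)
  note s = triangle_side_shares[OF vt T] triangle_side_shares[OF vt T'(1)] triangle_side_shares[OF vt T'(2)]
  note m1 = arc_map_share[OF \<phi> v e(1,2) s(2,1)] and m2 = arc_map_share[OF \<phi> v e(2,3) s(4,3)]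
    and m3 = arc_map_share[OF \<phi> v e(3,1) s(6,5)]
  note i = arc_map(1)[OF \<phi> v e(1)] arc_map(1)[OF \<phi> v e(2)] arc_map(1)[OF \<phi> v e(3)]
  show thesis
    by (rule pairwise_share_triangle[OF aut_vertex[OF \<phi> v] i m1(2) m2(2) m3(2) m1(1) m2(1) m3(1)])
      (rule that, unfold triangle_image_def, intro conjI)
qed

lemma arc_map_flip_sides:
  assumes \<phi>: "cellular_automorphism \<phi>" and v: "v \<in> vertices" and T: "{p, q, r} \<in> triangles_of v"
  shows "arc_map \<phi> (flip v (geodesic p q)) (geodesic q r) = arc_map \<phi> v (geodesic q r)"
    "arc_map \<phi> (flip v (geodesic p q)) (geodesic r p) = arc_map \<phi> v (geodesic r p)"
proof -
  note vt = vertex_triangulation[OF v]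
  have e: "geodesic p q \<in> v" "geodesic q r \<in> v" "geodesic r p \<in> v" using T mem_triangles_of_iff[OF vt] by blast+
  have T': "{r, p, q} \<in> triangles_of v" using T by (simp add: insert_commute)
  note s1 = triangle_side_shares[OF vt T] and s2 = triangle_side_shares[OF vt T']
  show "arc_map \<phi> (flip v (geodesic p q)) (geodesic q r) = arc_map \<phi> v (geodesic q r)"
    by (rule arc_map_flip[OF \<phi> v e(1,2) s1(2,1)])
  show "arc_map \<phi> (flip v (geodesic p q)) (geodesic r p) = arc_map \<phi> v (geodesic r p)"
    by (rule arc_map_flip[OF \<phi> v e(1,3) s2(2)[symmetric] share_triangle_sym[OF s2(1)]])
qed

text \<open>
  The images of two adjacent triangles are adjacent, on different sides of the image of the
  common arc. The content of the lemma is that the labelling at the common arc agrees.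
\<close>

lemma neighbour_image:
  assumes \<phi>: "cellular_automorphism \<phi>" and v: "v \<in> vertices"
    and T: "{p, q, r} \<in> triangles_of v" "{p, q, s} \<in> triangles_of v" "r \<noteq> s"
    and I: "triangle_image \<phi> v p q r P Q R"
  obtains S where "triangle_image \<phi> v q p s Q P S" "R \<noteq> S"
proof -
  note vt = vertex_triangulation[OF v]
  note V = aut_vertex[OF \<phi> v]
  note Vt = vertex_triangulation[OF V]
  have n: "norm p = 1" "norm q = 1" "norm r = 1" "norm s = 1"
    and d: "p \<noteq> q" "q \<noteq> r" "p \<noteq> r" "q \<noteq> s" "p \<noteq> s"
    and e: "geodesic p q \<in> v" "geodesic q r \<in> v" "geodesic r p \<in> v" "geodesic q s \<in> v" "geodesic s p \<in> v"
    using T mem_triangles_of_iff[OF vt] by auto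
  have e': "geodesic p s \<in> v" "geodesic s q \<in> v" using e by (simp_all add: open_segment_commute)
  have I': "{P, Q, R} \<in> triangles_of (\<phi> v)" "arc_map \<phi> v (geodesic p q) = geodesic P Q"
    "arc_map \<phi> v (geodesic q r) = geodesic Q R" "arc_map \<phi> v (geodesic r p) = geodesic R P"
    using I by (simp_all add: triangle_image_def)
  have N: "norm P = 1" "norm Q = 1" "norm R = 1" "P \<noteq> Q" "Q \<noteq> R" "P \<noteq> R" using I'(1) mem_triangles_of_iff[OF Vt] by auto
  have T2: "{q, p, s} \<in> triangles_of v" using T(2) by (simp add: insert_commute)
  obtain X Y S where X: "triangle_image \<phi> v q p s X Y S" using triangle_image_exists[OF \<phi> v T2] .
  have X': "{X, Y, S} \<in> triangles_of (\<phi> v)" "geodesic X Y = geodesic P Q"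
    "arc_map \<phi> v (geodesic p s) = geodesic Y S" "arc_map \<phi> v (geodesic s q) = geodesic S X"
  proof -
    have "arc_map \<phi> v (geodesic q p) = geodesic X Y" using X unfolding triangle_image_def by blast
    then show "geodesic X Y = geodesic P Q"
      unfolding open_segment_commute[of q p] using I'(2) by (metis (no_types))
  qed (use X in \<open>unfold triangle_image_def, blast+\<close>)
  have M: "norm X = 1" "norm Y = 1" "norm S = 1" "X \<noteq> Y" "Y \<noteq> S" "X \<noteq> S" using X'(1) mem_triangles_of_iff[OF Vt] by auto
  have ps_ne: "geodesic p s \<noteq> geodesic r p" "geodesic p s \<noteq> geodesic q r"
    using d T(3) by (auto simp: doubleton_eq_iff)
  have "{X, Y} = {P, Q}" using X'(2) M N geodesic_eq_iff by metis
  then consider "X = Q" "Y = P" | "X = P" "Y = Q" by (auto simp: doubleton_eq_iff)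
  then show thesis
  proof cases
    case 1
    have "R \<noteq> S"
    proof
      assume "R = S"
      then have "arc_map \<phi> v (geodesic p s) = arc_map \<phi> v (geodesic r p)"
        using X'(3) I'(4) 1 by (simp add: open_segment_commute)
      then show False using arc_map_inj[OF \<phi> v e'(1) e(3)] ps_ne by blast
    qed
    then show thesis using that X 1 by simp
  next
    case 2
    \<comment> \<open>The neighbour is glued with a twist. After the flip of \<open>pq\<close> the arcs \<open>rp\<close> and \<open>ps\<close> are sides of one
      triangle, so their images \<open>RP\<close> and \<open>QS\<close> have a common end point. This forces \<open>R = S\<close>, and then
      \<open>ps\<close> and \<open>qr\<close> have the same image.\<close>
    let ?w = "flip v (geodesic p q)"
    note w = flip_eqI[OF v T]
    note F = flip_triangulation[OF vt T w]
    have wv: "?w \<in> vertices" using flip_vertices v e by blast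
    have ne: "geodesic p q \<noteq> geodesic r p" "geodesic p q \<noteq> geodesic p s" using d by (auto simp: doubleton_eq_iff)
    have am: "arc_map \<phi> ?w (geodesic r p) = geodesic R P" "arc_map \<phi> ?w (geodesic p s) = geodesic Q S"
      using arc_map_flip_sides(2)[OF \<phi> v T(1)] arc_map_flip_sides(1)[OF \<phi> v T2, unfolded open_segment_commute[of q p]]
        I'(4) X'(3) 2 by (simp_all only:)
    have T3: "{r, p, s} \<in> triangles_of ?w" using F(3) by (simp add: insert_commute)
    have iw: "geodesic r p \<in> ?w" "geodesic p s \<in> ?w" using flip_keeps[OF v e(1)] e(3) e'(1) ne by auto
    note sh' = triangle_side_shares[OF F(1) T3]
    note W = arc_map_share[OF \<phi> wv iw sh'(2,1), unfolded am]
    have iW: "geodesic R P \<in> \<phi> ?w" "geodesic Q S \<in> \<phi> ?w" using arc_map(1)[OF \<phi> wv] iw am by metis+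
    obtain t where t: "{R, P, t} \<in> triangles_of (\<phi> ?w)" "geodesic Q S = geodesic R t \<or> geodesic Q S = geodesic P t"
      using share_triangle_geodesics[OF aut_vertex[OF \<phi> wv] iW W(2) N(3,1) W(1)] .
    have "norm t = 1" "R \<noteq> t" "P \<noteq> t"
      using t(1) mem_triangles_of_iff[OF vertex_triangulation[OF aut_vertex[OF \<phi> wv]]] by auto
    then have "{Q, S} = {R, t} \<or> {Q, S} = {P, t}" using t(2) geodesic_eq_iff M N 2 by metis
    then have "S = R" using N M 2 by (auto simp: doubleton_eq_iff)
    then have "arc_map \<phi> v (geodesic p s) = arc_map \<phi> v (geodesic q r)" using X'(3) I'(3) 2 by simp
    then show thesis using arc_map_inj[OF \<phi> v e'(1) e(2)] ps_ne by blast
  qed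
qed

text \<open>\<open>\<sigma>\<close> is true if \<open>\<phi>\<close> preserves the orientation of \<open>T\<close> and false if it reverses it.\<close>

definition orientation_on :: "bool \<Rightarrow> (complex set set \<Rightarrow> complex set set) \<Rightarrow> complex set set \<Rightarrow> complex set \<Rightarrow> bool" where
  "orientation_on \<sigma> \<phi> v T \<longleftrightarrow> (\<exists>p q r P Q R. T = {p, q, r} \<and> ccw p q r \<and>
    triangle_image \<phi> v p q r P Q R \<and> (ccw P Q R \<longleftrightarrow> \<sigma>))"

lemma triangle_image_rotate: "triangle_image \<phi> v p q r P Q R \<Longrightarrow> triangle_image \<phi> v q r p Q R P"
  by (simp add: triangle_image_def insert_commute)

text \<open>
  The sign can be read off from any counterclockwise labelling, since these differ by rotations.
\<close>

lemma orientation_onE: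
  assumes "orientation_on \<sigma> \<phi> v {p, q, r}" "ccw p q r"
  obtains P Q R where "triangle_image \<phi> v p q r P Q R" "ccw P Q R \<longleftrightarrow> \<sigma>"
proof -
  obtain p' q' r' P Q R where h: "{p, q, r} = {p', q', r'}" "ccw p' q' r'" "triangle_image \<phi> v p' q' r' P Q R" "ccw P Q R \<longleftrightarrow> \<sigma>"
    using assms(1) unfolding orientation_on_def by metis
  have rot: "ccw Q R P \<longleftrightarrow> \<sigma>" "ccw R P Q \<longleftrightarrow> \<sigma>" using h(4) ccw_rot by blast+
  consider "p' = p" "q' = q" "r' = r" | "p' = q" "q' = r" "r' = p" | "p' = r" "q' = p" "r' = q"
  proof -
    have o: "\<not> ccw q p r" "\<not> ccw p r q" "\<not> ccw r q p" using assms(2) ccw_asym ccw_rot by blast+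
    have "p' \<in> {p, q, r}" "q' \<in> {p, q, r}" "r' \<in> {p, q, r}" using h(1) by auto
    then have "(p' = p \<and> q' = q \<and> r' = r) \<or> (p' = q \<and> q' = r \<and> r' = p) \<or> (p' = r \<and> q' = p \<and> r' = q)"
      using o h(2) ccw_distinct[OF h(2)] by (elim insertE emptyE) auto
    then show thesis using that by blast
  qed
  then show thesis
  proof cases
    case 1
    then show thesis using that[of P Q R] h(3,4) by simp
  next
    case 2
    then show thesis using that[of R P Q] triangle_image_rotate[OF triangle_image_rotate[OF h(3)]] rot by simp
  next
    case 3
    then show thesis using that[of Q R P] triangle_image_rotate[OF h(3)] rot by simp
  qed
qed

text \<open>
  Besides the two triangles at \<open>pq\<close>, the conclusion gives the sign for \<open>rps\<close>, which becomes a
  triangle when \<open>pq\<close> is flipped.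
\<close>

lemma orientation_on_neighbour:
  assumes \<phi>: "cellular_automorphism \<phi>" and v: "v \<in> vertices"
    and c: "ccw p q r" "ccw q p s" and T: "{p, q, r} \<in> triangles_of v" "{q, p, s} \<in> triangles_of v"
    and o: "orientation_on \<sigma> \<phi> v {p, q, r}"
  obtains P Q R S where "triangle_image \<phi> v p q r P Q R" "triangle_image \<phi> v q p s Q P S" "R \<noteq> S"
    "ccw P Q R \<longleftrightarrow> \<sigma>" "ccw Q P S \<longleftrightarrow> \<sigma>" "ccw R P S \<longleftrightarrow> \<sigma>"
proof -
  note Vt = vertex_triangulation[OF aut_vertex[OF \<phi> v]]
  obtain P Q R where I: "triangle_image \<phi> v p q r P Q R" "ccw P Q R \<longleftrightarrow> \<sigma>" using orientation_onE[OF o c(1)] .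
  have "r \<noteq> s" using c ccw_asym by blast
  moreover have "{p, q, s} \<in> triangles_of v" using T(2) by (simp add: insert_commute)
  ultimately obtain S where S: "triangle_image \<phi> v q p s Q P S" "R \<noteq> S"
    using neighbour_image[OF \<phi> v T(1) _ _ I(1)] by blast
  have "{P, Q, R} \<in> triangles_of (\<phi> v)" "{P, Q, S} \<in> triangles_of (\<phi> v)"
    using I(1) S(1) by (simp_all add: triangle_image_def insert_commute)
  then have opp: "ccw P Q R \<and> ccw Q P S \<or> ccw Q P R \<and> ccw P Q S" by (rule opposite_third_vertices[OF Vt _ _ S(2)])
  then have n: "norm P = 1" "norm Q = 1" "norm R = 1" "norm S = 1" using ccw_on_circle by blast+
  have "ccw Q P S \<longleftrightarrow> \<sigma>" using opp I(2) ccw_asym by blast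
  moreover have "ccw R P S \<longleftrightarrow> \<sigma>"
  proof -
    have "ccw P Q R \<and> ccw Q P S \<Longrightarrow> ccw R P S" "ccw Q P R \<and> ccw P Q S \<Longrightarrow> ccw P R S"
      using n by (auto simp: ccw_iff_pos)
    then show ?thesis using opp I(2) ccw_asym by blast
  qed
  ultimately show thesis using that I S by blast
qed

lemma orientation_on_step:
  assumes \<phi>: "cellular_automorphism \<phi>" and v: "v \<in> vertices"
    and c: "ccw p q r" "ccw q p s" and T: "{p, q, r} \<in> triangles_of v" "{q, p, s} \<in> triangles_of v"
    and o: "orientation_on \<sigma> \<phi> v {p, q, r}"
  shows "orientation_on \<sigma> \<phi> v {q, p, s}"
proof -
  obtain P Q R S where "triangle_image \<phi> v q p s Q P S" "ccw Q P S \<longleftrightarrow> \<sigma>"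
    using orientation_on_neighbour[OF assms] by metis
  then show ?thesis using c(2) unfolding orientation_on_def by blast
qed

lemma orientation_on_all:
  assumes \<phi>: "cellular_automorphism \<phi>" and v: "v \<in> vertices"
    and "T0 \<in> triangles_of v" "orientation_on \<sigma> \<phi> v T0" "T \<in> triangles_of v"
  shows "orientation_on \<sigma> \<phi> v T"
  by (rule dual_graph_connected[OF v orientation_on_step[OF \<phi> v] assms(3-5)])

lemma orientation_on_flip:
  assumes \<phi>: "cellular_automorphism \<phi>" and vw: "adj v w"
    and o: "\<forall>T\<in>triangles_of v. orientation_on \<sigma> \<phi> v T"
  shows "\<forall>T\<in>triangles_of w. orientation_on \<sigma> \<phi> w T"
proof
  have v: "v \<in> vertices" and w: "w \<in> vertices" using adj_vertices[OF vw] by auto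
  note vt = vertex_triangulation[OF v]
  fix T assume T: "T \<in> triangles_of w"
  obtain a where a: "a \<in> v" "w = flip v a" using vw adj_iff_flip[OF v] by blast
  obtain p q r s where q: "a = geodesic p q" "ccw p q r" "ccw q p s"
    "{p, q, r} \<in> triangles_of v" "{p, q, s} \<in> triangles_of v" "r \<noteq> s" using flip_quadrilateral[OF v a(1)] .
  have T2: "{q, p, s} \<in> triangles_of v" using q(5) by (simp add: insert_commute)
  obtain P Q R S where I: "triangle_image \<phi> v p q r P Q R" "triangle_image \<phi> v q p s Q P S" "R \<noteq> S"
    "ccw P Q R \<longleftrightarrow> \<sigma>" "ccw Q P S \<longleftrightarrow> \<sigma>" "ccw R P S \<longleftrightarrow> \<sigma>"
    using orientation_on_neighbour[OF \<phi> v q(2,3,4) T2] o q(4) by metis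
  have J: "{P, Q, R} \<in> triangles_of (\<phi> v)" "{P, Q, S} \<in> triangles_of (\<phi> v)" "arc_map \<phi> v (geodesic p q) = geodesic P Q"
    "arc_map \<phi> v (geodesic r p) = geodesic R P" "arc_map \<phi> v (geodesic p s) = geodesic P S"
    using I(1,2) by (simp_all add: triangle_image_def insert_commute)
  have wq: "w = flip v (geodesic p q)" using a q by simp
  note F = flip_triangulation[OF vt q(4,5,6) flip_eqI[OF v q(4,5,6)], folded wq]
  have e: "geodesic p q \<in> v" using a(1) q(1) by simp
  have am: "arc_map \<phi> w (geodesic r p) = geodesic R P" "arc_map \<phi> w (geodesic p s) = geodesic P S"
    "arc_map \<phi> w (geodesic s r) = geodesic S R"
    unfolding wq
    using arc_map_flip_sides(2)[OF \<phi> v q(4)] arc_map_flip_sides(1)[OF \<phi> v T2, unfolded open_segment_commute[of q p]]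
      arc_map_new_arc[OF \<phi> v q(4,5,6) J(3,1,2) I(3)] J(4,5)
      open_segment_commute[of s r] open_segment_commute[of S R] by (simp_all only:)
  have \<phi>w: "\<phi> w = flip (\<phi> v) (geodesic P Q)" using arc_map(2)[OF \<phi> v e] J(3) wq by simp
  note V = aut_vertex[OF \<phi> v]
  \<comment> \<open>One triangle of \<open>w\<close> suffices, and \<open>rps\<close> has two sides that are arcs of \<open>v\<close>.\<close>
  have "{R, S, P} \<in> triangles_of (\<phi> w)"
    using flip_triangulation(3)[OF vertex_triangulation[OF V] J(1,2) I(3) flip_eqI[OF V J(1,2) I(3)]] \<phi>w by simp
  then have "triangle_image \<phi> w r p s R P S" using am by (simp add: triangle_image_def insert_commute)
  moreover have "ccw r p s"
    using q(2,3) ccw_on_circle[OF q(2)] ccw_on_circle[OF q(3)] by (auto simp: ccw_iff_pos)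
  ultimately have "orientation_on \<sigma> \<phi> w {r, p, s}" using I(6) unfolding orientation_on_def by blast
  moreover have "{r, p, s} \<in> triangles_of w" using F(3) by (simp add: insert_commute)
  ultimately show "orientation_on \<sigma> \<phi> w T" using orientation_on_all[OF \<phi> w _ _ T] by blast
qed

lemma link_triangle_sides:
  assumes v: "v \<in> vertices" and D: "\<Delta> \<in> link_triangles v"
  obtains T where "T \<in> triangles_of v"
    "\<forall>p q r. T = {p, q, r} \<longrightarrow> ccw p q r \<longrightarrow> \<Delta> = {flip v (geodesic p q), flip v (geodesic q r), flip v (geodesic r p)}"
proof -
  obtain x y z where xyz: "\<Delta> = {x, y, z}" "link_adj v x y" "link_adj v y z" "link_adj v z x"
    using D by (auto simp: link_triangles_def)
  obtain a b where ab: "a \<in> v" "b \<in> v" "a \<noteq> b" "share_triangle v a b" "x = flip v a" "y = flip v b"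
    using xyz(2) unfolding link_adj_iff[OF v] by (elim bexE conjE)
  obtain b' c where bc: "b' \<in> v" "c \<in> v" "b' \<noteq> c" "share_triangle v b' c" "y = flip v b'" "z = flip v c"
    using xyz(3) unfolding link_adj_iff[OF v] by (elim bexE conjE)
  obtain c' a' where ca: "c' \<in> v" "a' \<in> v" "c' \<noteq> a'" "share_triangle v c' a'" "z = flip v c'" "x = flip v a'"
    using xyz(4) unfolding link_adj_iff[OF v] by (elim bexE conjE)
  have "b' = b" "c' = c" "a' = a" using flip_inj[OF v] ab bc ca by auto
  then obtain p q r where T: "{p, q, r} \<in> triangles_of v" "a = geodesic p q" "b = geodesic q r" "c = geodesic r p"
    using pairwise_share_triangle[OF v ab(1,2) bc(2) ab(3)] ab bc ca by metis
  have "\<Delta> = {flip v (geodesic p' q'), flip v (geodesic q' r'), flip v (geodesic r' p')}"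
    if "{p, q, r} = {p', q', r'}" "ccw p' q' r'" for p' q' r'
  proof -
    have "p' \<in> {p, q, r}" "q' \<in> {p, q, r}" "r' \<in> {p, q, r}" using that by auto
    moreover have "p' \<noteq> q'" "q' \<noteq> r'" "p' \<noteq> r'" using ccw_distinct[OF that(2)] by auto
    ultimately have "(p' = p \<and> q' = q \<and> r' = r) \<or> (p' = q \<and> q' = r \<and> r' = p) \<or> (p' = r \<and> q' = p \<and> r' = q)
      \<or> (p' = q \<and> q' = p \<and> r' = r) \<or> (p' = p \<and> q' = r \<and> r' = q) \<or> (p' = r \<and> q' = q \<and> r' = p)"
      by (elim insertE emptyE) auto
    then show ?thesis unfolding xyz(1) ab(5,6) bc(6) T
      by (elim disjE conjE) (simp_all add: open_segment_commute insert_commute)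
  qed
  then show thesis using that[OF T(1)] by blast
qed

lemma aut_link_triangle:
  assumes "cellular_automorphism \<phi>" "\<Delta> \<in> link_triangles v"
  shows "\<phi> ` \<Delta> \<in> link_triangles (\<phi> v)"
proof -
  obtain x y z where xyz: "\<Delta> = {x, y, z}" "link_adj v x y" "link_adj v y z" "link_adj v z x"
    using assms(2) by (auto simp: link_triangles_def)
  then have "\<phi> ` \<Delta> = {\<phi> x, \<phi> y, \<phi> z}" by simp
  moreover have "link_adj (\<phi> v) (\<phi> x) (\<phi> y)" "link_adj (\<phi> v) (\<phi> y) (\<phi> z)" "link_adj (\<phi> v) (\<phi> z) (\<phi> x)"
    using xyz(2-4)[THEN aut_link_adj[OF assms(1)]] .
  ultimately show ?thesis unfolding link_triangles_def mem_Collect_eq by (intro exI conjI)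
qed

text \<open>
  The orientation of a link triangle is defined by the cyclic order of the sides of the
  underlying triangle. If \<open>PQR\<close> is clockwise, then \<open>QPR\<close> is counterclockwise and runs through
  the images of \<open>pq\<close>, \<open>rp\<close>, \<open>qr\<close>.
\<close>

lemma orientation_on_link_triangle:
  assumes \<phi>: "cellular_automorphism \<phi>" and v: "v \<in> vertices"
    and o: "\<forall>T\<in>triangles_of v. orientation_on \<sigma> \<phi> v T" and D: "\<Delta> \<in> link_triangles v"
  obtains x y z where "\<Delta> = {x, y, z}" "link_oriented v x y z"
    "if \<sigma> then link_oriented (\<phi> v) (\<phi> x) (\<phi> y) (\<phi> z) else link_oriented (\<phi> v) (\<phi> x) (\<phi> z) (\<phi> y)"
proof -
  note V = aut_vertex[OF \<phi> v]
  obtain T where T: "T \<in> triangles_of v"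
    "\<forall>p q r. T = {p, q, r} \<longrightarrow> ccw p q r \<longrightarrow> \<Delta> = {flip v (geodesic p q), flip v (geodesic q r), flip v (geodesic r p)}"
    using link_triangle_sides[OF v D] .
  obtain p q r P Q R where h: "T = {p, q, r}" "ccw p q r" "triangle_image \<phi> v p q r P Q R" "ccw P Q R \<longleftrightarrow> \<sigma>"
    using o T(1) unfolding orientation_on_def by blast
  define x where "x = flip v (geodesic p q)"
  define y where "y = flip v (geodesic q r)"
  define z where "z = flip v (geodesic r p)"
  have Delta: "\<Delta> = {x, y, z}" using T(2) h(1,2) unfolding x_def y_def z_def by blast
  have e: "geodesic p q \<in> v" "geodesic q r \<in> v" "geodesic r p \<in> v"
    using T(1) h(1) mem_triangles_of_iff[OF vertex_triangulation[OF v]] by blast+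
  then have "is_flip v (geodesic p q) x" "is_flip v (geodesic q r) y" "is_flip v (geodesic r p) z"
    using is_flip_iff[OF v] by (simp_all add: x_def y_def z_def)
  then have 1: "link_oriented v x y z" using D T(1) h(1,2) unfolding link_oriented_def Delta by blast
  have I: "{P, Q, R} \<in> triangles_of (\<phi> v)" "arc_map \<phi> v (geodesic p q) = geodesic P Q"
    "arc_map \<phi> v (geodesic q r) = geodesic Q R" "arc_map \<phi> v (geodesic r p) = geodesic R P"
    using h(3) by (simp_all add: triangle_image_def)
  have f: "is_flip (\<phi> v) (geodesic P Q) (\<phi> x)" "is_flip (\<phi> v) (geodesic Q R) (\<phi> y)" "is_flip (\<phi> v) (geodesic R P) (\<phi> z)"
    unfolding is_flip_iff[OF V] x_def y_def z_def using arc_map[OF \<phi> v] e I by metis+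
  have L: "{\<phi> x, \<phi> y, \<phi> z} \<in> link_triangles (\<phi> v)" using aut_link_triangle[OF \<phi> D] Delta by simp
  have "if \<sigma> then link_oriented (\<phi> v) (\<phi> x) (\<phi> y) (\<phi> z) else link_oriented (\<phi> v) (\<phi> x) (\<phi> z) (\<phi> y)"
  proof (cases \<sigma>)
    case True
    then have "ccw P Q R" using h(4) by simp
    then have "link_oriented (\<phi> v) (\<phi> x) (\<phi> y) (\<phi> z)" using L I(1) f unfolding link_oriented_def by blast
    then show ?thesis using True by simp
  next
    case False
    have "norm P = 1" "norm Q = 1" "norm R = 1" "P \<noteq> Q" "Q \<noteq> R" "P \<noteq> R"
      using I(1) mem_triangles_of_iff[OF vertex_triangulation[OF V]] by auto
    then have "ccw Q P R" using ccw_total[of P Q R] False h(4) by blast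
    moreover have "{\<phi> x, \<phi> z, \<phi> y} \<in> link_triangles (\<phi> v)" "{Q, P, R} \<in> triangles_of (\<phi> v)"
      using L I(1) by (simp_all add: insert_commute)
    moreover have "is_flip (\<phi> v) (geodesic Q P) (\<phi> x)" "is_flip (\<phi> v) (geodesic P R) (\<phi> z)" "is_flip (\<phi> v) (geodesic R Q) (\<phi> y)"
      using f by (simp_all add: open_segment_commute)
    ultimately have "link_oriented (\<phi> v) (\<phi> x) (\<phi> z) (\<phi> y)" unfolding link_oriented_def by blast
    then show ?thesis using False by simp
  qed
  then show thesis using that Delta 1 by blast
qed

theorem proposition6:
  fixes \<phi> :: "complex set set \<Rightarrow> complex set set"
  assumes "cellular_automorphism \<phi>"
  shows "orientation_preserving_aut \<phi> \<or> orientation_reversing_aut \<phi>"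
proof (cases "vertices = {}")
  case True
  then show ?thesis by (simp add: orientation_preserving_aut_def)
next
  case False
  then obtain v0 where v0: "v0 \<in> vertices" by blast
  obtain n where n: "2 \<le> n" "has_dyadic_tail n v0" using vertex_has_dyadic_tail[OF v0] .
  have T0: "dyadic_triangle n 0 \<in> triangles_of v0"
    using dyadic_triangle_in[OF vertex_noncrossing[OF v0] n(2)] n(1) by simp
  obtain p q r where pqr: "dyadic_triangle n 0 = {p, q, r}" "ccw p q r" using T0 by (rule triangles_of_ccwE)
  obtain P Q R where I: "triangle_image \<phi> v0 p q r P Q R" using triangle_image_exists[OF assms v0] T0 pqr by metis
  define \<sigma> where "\<sigma> = ccw P Q R"
  have "orientation_on \<sigma> \<phi> v0 (dyadic_triangle n 0)" using pqr I unfolding orientation_on_def \<sigma>_def by blast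
  then have all0: "\<forall>T\<in>triangles_of v0. orientation_on \<sigma> \<phi> v0 T" using orientation_on_all[OF assms v0 T0] by blast
  have all: "\<forall>T\<in>triangles_of v. orientation_on \<sigma> \<phi> v T" if "v \<in> vertices" for v
    using flip_graph_connected[OF v0 that]
    by (induction rule: rtranclp_induct) (use all0 orientation_on_flip[OF assms] in blast)+
  show ?thesis
  proof (cases \<sigma>)
    case True
    have "preserving_on \<phi> v \<Delta>" if "v \<in> vertices" "\<Delta> \<in> link_triangles v" for v \<Delta>
      using orientation_on_link_triangle[OF assms that(1) all[OF that(1)] that(2)] True
      unfolding preserving_on_def by metis
    then show ?thesis by (simp add: orientation_preserving_aut_def preserving_at_def)
  next
    case False
    have "reversing_on \<phi> v \<Delta>" if "v \<in> vertices" "\<Delta> \<in> link_triangles v" for v \<Delta>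
      using orientation_on_link_triangle[OF assms that(1) all[OF that(1)] that(2)] False
      unfolding reversing_on_def by metis
    then show ?thesis by (simp add: orientation_reversing_aut_def reversing_at_def)
  qed
qed

end
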